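(* Let $d,k,\ell\in\mathbb{Z}_{>0}$, and let $(r_p)_{p\in[d]}\in\mathbb{R}_{>0}^d$ be strictly increasing. For $p\in[d]$ define $\mathbf{z}_p=(k+p-1,\ \ell+d-p)$. Let $\omega$ be the i.i.d. $\mathrm{Exp}\{1\}$ environment on $\mathbb{Z}_{>0}^2$ with Busemann functions $\mathcal{I}^r_{\mathbf{u}}[\omega],\mathcal{J}^r_{\mathbf{u}}[\omega]$, and let $\eta$ be the independent inhomogeneous environment on $[k+d-1]\times[\ell+d-1]$, both as defined in the context. Then the following two collections of random variables are equal in joint distribution: $$\Bigl(\mathcal{I}^{r_p}_{\mathbf{u}}[\omega],\ \mathcal{J}^{r_p}_{\mathbf{v}}[\omega]\ :\ \mathbf{u}\in[k-1]\times[\ell],\ \mathbf{v}\in[k]\times[\ell-1],\ p\in[d]\Bigr)$$ $$\stackrel{\mathrm{dist.}}{=}\ \Bigl(\underline{\mathrm{I}}_{\mathbf{u},\mathbf{z}_p}[\eta],\ \underline{\mathrm{J}}_{\mathbf{v},\mathbf{z}_p}[\eta]\ :\ \mathbf{u}\in[k-1]\times[\ell],\ \mathbf{v}\in[k]\times[\ell-1],\ p\in[d]\Bigr).$$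
   Context: Notation: $[n]=\{i\in\mathbb{Z}_{>0}: i\le n\}$. A random variable $X$ is $\mathrm{Exp}\{a\}$, $a>0$, if $\mathbf{P}(X>t)=e^{-at}$ for $t\ge 0$. Last-passage times: $\le$ is the coordinatewise partial order on $\mathbb{Z}^2$. For $\mathbf{u}\le\mathbf{v}$ in $\mathbb{Z}^2$, $\Pi_{\mathbf{u},\mathbf{v}}$ is the set of up-right lattice paths (steps $(1,0)$ or $(0,1)$) from $\mathbf{u}$ to $\mathbf{v}$, each viewed as its set of vertices including both endpoints. For real weights $\mathrm{w}=(\mathrm{w}_{\mathbf{p}})$ defined at least on the vertices $\mathbf{p}$ with $\mathbf{u}\le\mathbf{p}\le\mathbf{v}$, set $\mathrm{L}_{\mathbf{u},\mathbf{v}}[\mathrm{w}]=\max_{\pi\in\Pi_{\mathbf{u},\mathbf{v}}}\sum_{\mathbf{p}\in\pi}\mathrm{w}_{\mathbf{p}}$, and $\mathrm{L}_{\mathbf{u},\mathbf{v}}[\mathrm{w}]=-\infty$ if $\mathbf{u}\le\mathbf{v}$ fails. The increments with respect to the initial point are $$\underline{\mathrm{I}}_{\mathbf{u},\mathbf{v}}[\mathrm{w}]=\mathrm{L}_{\mathbf{u},\mathbf{v}}[\mathrm{w}]-\mathrm{L}_{\mathbf{u}+(1,0),\mathbf{v}}[\mathrm{w}],\qquad \underline{\mathrm{J}}_{\mathbf{u},\mathbf{v}}[\mathrm{w}]=\mathrm{L}_{\mathbf{u},\mathbf{v}}[\mathrm{w}]-\mathrm{L}_{\mathbf{u}+(0,1),\mathbf{v}}[\mathrm{w}].$$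 Busemann functions: let $\omega=\{\omega_{\mathbf{v}}:\mathbf{v}\in\mathbb{Z}_{>0}^2\}$ be i.i.d. $\mathrm{Exp}\{1\}$. It is known that for each fixed $r\in(0,\infty)$ and $\mathbf{u}\in\mathbb{Z}_{>0}^2$ there exist random variables $\mathcal{I}^r_{\mathbf{u}}[\omega]$ and $\mathcal{J}^r_{\mathbf{u}}[\omega]$ such that almost surely, simultaneously for all sequences $\mathbf{v}_n=(m_n,j_n)\in\mathbb{Z}^2$ with $\min\{m_n,j_n\}\to\infty$ and $m_n/j_n\to r$, one has $\lim_n\underline{\mathrm{I}}_{\mathbf{u},\mathbf{v}_n}[\omega]=\mathcal{I}^r_{\mathbf{u}}[\omega]$ and $\lim_n\underline{\mathrm{J}}_{\mathbf{u},\mathbf{v}_n}[\omega]=\mathcal{J}^r_{\mathbf{u}}[\omega]$. These are the Busemann functions in direction $r$. The environment $\eta$: let $\zeta(r)=\frac{\sqrt r}{1+\sqrt r}$. Define $$a_i=\begin{cases}0,&1\le i<k,\\ -\zeta(r_{i-k+1}),&k\le i\le k+d-1,\end{cases}\qquad b_j=\begin{cases}1,&1\le j<\ell,\\ \zeta(r_{\ell+d-j}),&\ell\le j\le \ell+d-1.\end{cases}$$ Then $\eta=\{\eta_{(i,j)}: i\in[k+d-1],\,j\in[\ell+d-1]\}$ are independent with $\eta_{(i,j)}\sim\mathrm{Exp}\{a_i+b_j\}$ if $a_i+b_j>0$ and $\eta_{(i,j)}=0$ otherwise. *)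

theory Defs
  imports "HOL-Probability.Probability"
begin

section \<open>Last-passage times on the integer lattice\<close>

text \<open>The order \<open>\<le>\<close> on \<^typ>\<open>int \<times> int\<close> is the coordinatewise one.\<close>

definition up_right_paths :: "int \<times> int \<Rightarrow> int \<times> int \<Rightarrow> (int \<times> int) set set" where
  "up_right_paths u v =
     {set ps | ps. ps \<noteq> [] \<and> hd ps = u \<and> last ps = v \<and>
        successively (\<lambda>p q. q = p + (1, 0) \<or> q = p + (0, 1)) ps}"

definition last_passage ::
  "int \<times> int \<Rightarrow> int \<times> int \<Rightarrow> (int \<times> int \<Rightarrow> real) \<Rightarrow> ereal" where
  "last_passage u v w =
     (if u \<le> v then ereal (Max ((\<lambda>\<pi>. \<Sum>p\<in>\<pi>. w p) ` up_right_paths u v)) else -\<infinity>)"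

definition incr_I :: "int \<times> int \<Rightarrow> int \<times> int \<Rightarrow> (int \<times> int \<Rightarrow> real) \<Rightarrow> ereal" where
  "incr_I u v w = last_passage u v w - last_passage (u + (1, 0)) v w"

definition incr_J :: "int \<times> int \<Rightarrow> int \<times> int \<Rightarrow> (int \<times> int \<Rightarrow> real) \<Rightarrow> ereal" where
  "incr_J u v w = last_passage u v w - last_passage (u + (0, 1)) v w"

text \<open>The maximum in \<^const>\<open>last_passage\<close> is over a finite nonempty set.\<close>

lemma up_right_path_subset:
  fixes u v :: "int \<times> int"
  assumes "ps \<noteq> []" "hd ps = u" "last ps = v"
    and "successively (\<lambda>p q. q = p + (1, 0) \<or> q = p + (0, 1)) ps"
  shows "set ps \<subseteq> {u..v}"
  using assms
proof (induction ps arbitrary: u)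
  case (Cons p ps)
  show ?case
  proof (cases "ps = []")
    case False
    then have sub: "set ps \<subseteq> {hd ps..v}"
      and step: "hd ps = p + (1, 0) \<or> hd ps = p + (0, 1)"
      using Cons by (auto simp: successively_Cons)
    have "p \<le> hd ps" using step by (auto simp: less_eq_prod_def)
    moreover have "hd ps \<le> v" using sub False hd_in_set by fastforce
    ultimately show ?thesis using sub Cons.prems by fastforce
  qed (use Cons in auto)
qed simp

lemma finite_up_right_paths: "finite (up_right_paths u v)"
proof -
  have "{u..v} \<subseteq> {fst u..fst v} \<times> {snd u..snd v}" by (auto simp: less_eq_prod_def)
  then have "finite {u..v}" by (rule finite_subset) simp
  moreover have "up_right_paths u v \<subseteq> Pow {u..v}"
    unfolding up_right_paths_def using up_right_path_subset by blast
  ultimately show ?thesis by (meson finite_Pow_iff finite_subset)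
qed

lemma up_right_paths_nonempty:
  assumes "u \<le> v"
  shows "up_right_paths u v \<noteq> {}"
  using assms
proof (induction "nat (fst v - fst u + (snd v - snd u))" arbitrary: u)
  case 0
  then have "u = v" by (auto simp: less_eq_prod_def prod_eq_iff)
  then have "set [u] \<in> up_right_paths u v" unfolding up_right_paths_def by fastforce
  then show ?case by blast
next
  case (Suc n)
  then obtain e where e: "e = (1, 0) \<or> e = (0, 1)" "u + e \<le> v"
    "n = nat (fst v - fst (u + e) + (snd v - snd (u + e)))"
  proof (cases "fst u < fst v")
    case True
    with Suc that[of "(1, 0)"] show ?thesis by (auto simp: less_eq_prod_def)
  next
    case False
    with Suc that[of "(0, 1)"] show ?thesis by (auto simp: less_eq_prod_def)
  qed
  from Suc.hyps(1)[OF e(3,2)] obtain ps where "ps \<noteq> []" "hd ps = u + e" "last ps = v"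
    "successively (\<lambda>p q. q = p + (1, 0) \<or> q = p + (0, 1)) ps"
    unfolding up_right_paths_def by blast
  then have "set (u # ps) \<in> up_right_paths u v"
    unfolding up_right_paths_def mem_Collect_eq using e(1)
    by (intro exI[of _ "u # ps"]) (auto simp: successively_Cons)
  then show ?case by blast
qed

section \<open>The i.i.d. exponential environment and its Busemann functions\<close>

definition quadrant :: "(int \<times> int) set" where
  "quadrant = {0<..} \<times> {0<..}"

definition iid_exp_environment :: "'a measure \<Rightarrow> (int \<times> int \<Rightarrow> 'a \<Rightarrow> real) \<Rightarrow> bool" where
  "iid_exp_environment M \<omega> \<longleftrightarrow>
     prob_space M \<and>
     prob_space.indep_vars M (\<lambda>_. borel) \<omega> quadrant \<and>
     (\<forall>v\<in>quadrant. distributed M lborel (\<omega> v) (exponential_density 1))"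

definition has_direction :: "real \<Rightarrow> (nat \<Rightarrow> int \<times> int) \<Rightarrow> bool" where
  "has_direction r v \<longleftrightarrow>
     filterlim (\<lambda>n. min (fst (v n)) (snd (v n))) at_top sequentially \<and>
     (\<lambda>n. real_of_int (fst (v n)) / real_of_int (snd (v n))) \<longlonglongrightarrow> r"

text \<open>
  Busemann functions are determined only up to null sets, so they are described by their
  defining property instead of as a chosen family. The null set may depend on \<open>r\<close> and \<open>u\<close>,
  but not on the sequence.
\<close>

definition busemann_functions ::
  "'a measure \<Rightarrow> (int \<times> int \<Rightarrow> 'a \<Rightarrow> real) \<Rightarrow>
   (real \<Rightarrow> int \<times> int \<Rightarrow> 'a \<Rightarrow> real) \<Rightarrow> (real \<Rightarrow> int \<times> int \<Rightarrow> 'a \<Rightarrow> real) \<Rightarrow> bool" where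
  "busemann_functions M \<omega> I J \<longleftrightarrow>
     (\<forall>r>0. \<forall>u\<in>quadrant.
        I r u \<in> borel_measurable M \<and> J r u \<in> borel_measurable M \<and>
        (AE x in M. \<forall>v. has_direction r v \<longrightarrow>
           (\<lambda>n. incr_I u (v n) (\<lambda>p. \<omega> p x)) \<longlonglongrightarrow> ereal (I r u x) \<and>
           (\<lambda>n. incr_J u (v n) (\<lambda>p. \<omega> p x)) \<longlonglongrightarrow> ereal (J r u x)))"

section \<open>The inhomogeneous environment\<close>

definition zeta :: "real \<Rightarrow> real" where
  "zeta r = sqrt r / (1 + sqrt r)"

definition a_param :: "int \<Rightarrow> (int \<Rightarrow> real) \<Rightarrow> int \<Rightarrow> real" where
  "a_param k r i = (if i < k then 0 else - zeta (r (i - k + 1)))"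

definition b_param :: "int \<Rightarrow> int \<Rightarrow> (int \<Rightarrow> real) \<Rightarrow> int \<Rightarrow> real" where
  "b_param l d r j = (if j < l then 1 else zeta (r (l + d - j)))"

definition inhomogeneous_environment ::
  "'b measure \<Rightarrow> (int \<times> int \<Rightarrow> 'b \<Rightarrow> real) \<Rightarrow> int \<Rightarrow> int \<Rightarrow> int \<Rightarrow> (int \<Rightarrow> real) \<Rightarrow> bool" where
  "inhomogeneous_environment N \<eta> k l d r \<longleftrightarrow>
     prob_space N \<and>
     prob_space.indep_vars N (\<lambda>_. borel) \<eta> ({1..k + d - 1} \<times> {1..l + d - 1}) \<and>
     (\<forall>i\<in>{1..k + d - 1}. \<forall>j\<in>{1..l + d - 1}.
        if a_param k r i + b_param l d r j > 0
        then distributed N lborel (\<eta> (i, j)) (exponential_density (a_param k r i + b_param l d r j))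
        else (AE y in N. \<eta> (i, j) y = 0))"

section \<open>Equality in joint distribution\<close>

text \<open>
  Measurability of all members is included because \<^const>\<open>distr\<close> is only meaningful for
  measurable maps.
\<close>

definition eq_in_joint_distr ::
  "'i set \<Rightarrow> 'a measure \<Rightarrow> ('i \<Rightarrow> 'a \<Rightarrow> ereal) \<Rightarrow> 'b measure \<Rightarrow> ('i \<Rightarrow> 'b \<Rightarrow> ereal) \<Rightarrow> bool" where
  "eq_in_joint_distr S M X N Y \<longleftrightarrow>
     (\<forall>i\<in>S. X i \<in> borel_measurable M) \<and>
     (\<forall>i\<in>S. Y i \<in> borel_measurable N) \<and>
     distr M (Pi\<^sub>M S (\<lambda>_. borel)) (\<lambda>x. \<lambda>i\<in>S. X i x) =
     distr N (Pi\<^sub>M S (\<lambda>_. borel)) (\<lambda>y. \<lambda>i\<in>S. Y i y)"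

end

theory Submission
  imports Defs
begin

text \<open>
  By the Burke property of the exponential distribution, two neighbouring columns (or rows) of an
  inhomogeneous environment exchange their parameters under a map of the weights that preserves
  all passage times across them. Moving columns and rows out of the way shows that the law of the
  increments near the origin does not depend on the size \<open>k\<close>, \<open>l\<close> of the bulk of rate 1, so the bulk
  may be taken arbitrarily large. Then, with high probability, the geodesic to the \<open>p\<close>-th corner
  leaves a large bulk box near the direction \<open>r p\<close>: a forced exit on the wrong side is dominated by
  the environment of another parameter, whose passage time concentrates at a strictly smaller value.
  By planarity the increments are therefore squeezed between bulk increments towards points in
  directions slightly below and slightly above \<open>r p\<close>, and both of these converge to the Busemann
  functions.
\<close>

section \<open>Last-passage times\<close>

text \<open>The obstacle is that the bulk grows along the limit: increments towards the corners of
  ever larger boxes live on unrelated probability spaces, so they have no almost sure limit. What is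
  fixed is their joint law, and what converges almost surely are the bulk increments that enclose
  them, whose law can be read off from the i.i.d. environment. Hence the sandwich is carried out on
  expectations of decreasing test functions.

  Exit points are needed for one direction at a time. The comparison at one corner is a function of
  the increments towards that corner, so all other directions can be removed from its law. This
  leaves a bulk of rate 1 with a top row of rate \<open>s\<close> and a right column of rate
  \<open>1 - s\<close>, the stationary model. Its mean passage time over a box of width
  \<open>x\<close> and height \<open>y\<close> is \<open>x / s + y / (1 - s)\<close>, which for
  \<open>x / y = t\<close> is minimal exactly at \<open>s = zeta t\<close>: this is the origin of
  \<open>zeta\<close> and of the strict inequality between the competing means.

  An exchange of columns preserves the passage times to a corner only up to a common additive term,
  and each of them contains the weight of the corner. Both effects disappear in differences of
  passage times with the same endpoint.\<close>

definition lpp :: "int \<times> int \<Rightarrow> int \<times> int \<Rightarrow> (int \<times> int \<Rightarrow> real) \<Rightarrow> real" where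
  "lpp u v w = Max ((\<lambda>\<pi>. \<Sum>p\<in>\<pi>. w p) ` up_right_paths u v)"

lemma last_passage_eq_lpp: "u \<le> v \<Longrightarrow> last_passage u v w = ereal (lpp u v w)"
  by (simp add: last_passage_def lpp_def)

lemma up_right_paths_subset: "\<pi> \<in> up_right_paths u v \<Longrightarrow> \<pi> \<subseteq> {u..v}"
  unfolding up_right_paths_def using up_right_path_subset by blast

lemma finite_up_right_path: "\<pi> \<in> up_right_paths u v \<Longrightarrow> finite \<pi>"
  by (auto simp: up_right_paths_def)

lemma start_in_up_right_path: "\<pi> \<in> up_right_paths u v \<Longrightarrow> u \<in> \<pi>"
  unfolding up_right_paths_def by (force intro: hd_in_set)

lemma up_right_paths_empty: "\<not> u \<le> v \<Longrightarrow> up_right_paths u v = {}"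
proof (rule equals0I)
  fix \<pi> assume "\<not> u \<le> v" and \<pi>: "\<pi> \<in> up_right_paths u v"
  have "u \<in> {u..v}" using start_in_up_right_path[OF \<pi>] up_right_paths_subset[OF \<pi>] by (rule rev_subsetD)
  then show False using \<open>\<not> u \<le> v\<close> by simp
qed

lemma up_right_paths_self: "up_right_paths v v = {{v}}"
proof (intro equalityI subsetI)
  fix \<pi> assume \<pi>: "\<pi> \<in> up_right_paths v v"
  have "\<pi> \<subseteq> {v}" using up_right_paths_subset[OF \<pi>] by simp
  then show "\<pi> \<in> {{v}}" using start_in_up_right_path[OF \<pi>] by blast
next
  fix \<pi> assume "\<pi> \<in> {{v}}"
  then show "\<pi> \<in> up_right_paths v v"
    unfolding up_right_paths_def by (intro CollectI exI[of _ "[v]"]) simp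
qed

lemma up_right_paths_step:
  assumes "u \<noteq> v"
  shows "up_right_paths u v = insert u ` (up_right_paths (u + (1, 0)) v \<union> up_right_paths (u + (0, 1)) v)"
proof (intro equalityI subsetI)
  fix \<pi> assume "\<pi> \<in> up_right_paths u v"
  then obtain ps where ps: "\<pi> = set ps" "ps \<noteq> []" "hd ps = u" "last ps = v"
    "successively (\<lambda>p q. q = p + (1, 0) \<or> q = p + (0, 1)) ps"
    by (auto simp: up_right_paths_def)
  then obtain qs where qs: "ps = u # qs" by (metis list.collapse)
  with ps assms have "qs \<noteq> []" by auto
  with ps qs have "hd qs = u + (1, 0) \<or> hd qs = u + (0, 1)" "last qs = v"
    "successively (\<lambda>p q. q = p + (1, 0) \<or> q = p + (0, 1)) qs"
    by (auto simp: successively_Cons)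
  then have "set qs \<in> up_right_paths (u + (1, 0)) v \<union> up_right_paths (u + (0, 1)) v"
    using \<open>qs \<noteq> []\<close> by (auto simp: up_right_paths_def)
  then show "\<pi> \<in> insert u ` (up_right_paths (u + (1, 0)) v \<union> up_right_paths (u + (0, 1)) v)"
    using ps qs by auto
next
  fix \<pi> assume "\<pi> \<in> insert u ` (up_right_paths (u + (1, 0)) v \<union> up_right_paths (u + (0, 1)) v)"
  then obtain ps where ps: "\<pi> = set (u # ps)" "ps \<noteq> []" "hd ps = u + (1, 0) \<or> hd ps = u + (0, 1)"
    "last ps = v" "successively (\<lambda>p q. q = p + (1, 0) \<or> q = p + (0, 1)) ps"
    by (auto simp: up_right_paths_def)
  then have "successively (\<lambda>p q. q = p + (1, 0) \<or> q = p + (0, 1)) (u # ps)"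
    "hd (u # ps) = u" "last (u # ps) = v" by (auto simp: successively_Cons)
  then show "\<pi> \<in> up_right_paths u v" unfolding up_right_paths_def using ps(1) by blast
qed

lemma lpp_self [simp]: "lpp v v w = w v"
  by (simp add: lpp_def up_right_paths_self)

lemma Max_insert_path_sums:
  fixes w :: "int \<times> int \<Rightarrow> real"
  assumes "finite A" "A \<noteq> {}" "\<And>\<pi>. \<pi> \<in> A \<Longrightarrow> finite \<pi> \<and> u \<notin> \<pi>"
  shows "Max ((\<lambda>\<pi>. \<Sum>p\<in>\<pi>. w p) ` insert u ` A) = w u + Max ((\<lambda>\<pi>. \<Sum>p\<in>\<pi>. w p) ` A)"
proof -
  have "(\<lambda>\<pi>. \<Sum>p\<in>\<pi>. w p) ` insert u ` A = (\<lambda>x. x + w u) ` (\<lambda>\<pi>. \<Sum>p\<in>\<pi>. w p) ` A"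
    unfolding image_image using assms(3) by (intro image_cong) auto
  also have "Max \<dots> = Max ((\<lambda>\<pi>. \<Sum>p\<in>\<pi>. w p) ` A) + w u"
    using assms by (subst mono_Max_commute[symmetric]) (auto intro: monoI)
  finally show ?thesis by simp
qed

lemma not_in_later_paths:
  assumes "\<pi> \<in> up_right_paths (u + (1, 0)) v \<union> up_right_paths (u + (0, 1)) v"
  shows "finite \<pi> \<and> u \<notin> \<pi>"
proof -
  have "\<not> u + (1, 0) \<le> u" "\<not> u + (0, 1) \<le> u" by (auto simp: less_eq_prod_def)
  moreover consider "\<pi> \<subseteq> {u + (1, 0)..v}" | "\<pi> \<subseteq> {u + (0, 1)..v}"
    using assms up_right_paths_subset by blast
  then have "u \<in> \<pi> \<Longrightarrow> u + (1, 0) \<le> u \<or> u + (0, 1) \<le> u"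
    by cases (meson atLeastAtMost_iff subsetD)+
  ultimately show ?thesis using assms finite_up_right_path by blast
qed

lemma lpp_unfold:
  assumes "u \<noteq> v"
    and "up_right_paths (u + (1, 0)) v \<union> up_right_paths (u + (0, 1)) v \<noteq> {}"
  shows "lpp u v w =
    w u + Max ((\<lambda>\<pi>. \<Sum>p\<in>\<pi>. w p) ` (up_right_paths (u + (1, 0)) v \<union> up_right_paths (u + (0, 1)) v))"
  unfolding lpp_def up_right_paths_step[OF assms(1)]
  using assms(2) by (intro Max_insert_path_sums not_in_later_paths) (simp_all add: finite_up_right_paths)

lemma lpp_top:
  assumes "i < a"
  shows "lpp (i, b) (a, b) w = w (i, b) + lpp (i + 1, b) (a, b) w"
proof -
  have "up_right_paths ((i, b) + (0, 1)) (a, b) = {}"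
    by (rule up_right_paths_empty) (simp add: less_eq_prod_def)
  moreover have "up_right_paths ((i, b) + (1, 0)) (a, b) \<noteq> {}"
    using assms by (intro up_right_paths_nonempty) (simp add: less_eq_prod_def)
  ultimately show ?thesis
    using lpp_unfold[of "(i, b)" "(a, b)" w] assms by (simp add: lpp_def)
qed

lemma lpp_right:
  assumes "j < b"
  shows "lpp (a, j) (a, b) w = w (a, j) + lpp (a, j + 1) (a, b) w"
proof -
  have "up_right_paths ((a, j) + (1, 0)) (a, b) = {}"
    by (rule up_right_paths_empty) (simp add: less_eq_prod_def)
  moreover have "up_right_paths ((a, j) + (0, 1)) (a, b) \<noteq> {}"
    using assms by (intro up_right_paths_nonempty) (simp add: less_eq_prod_def)
  ultimately show ?thesis
    using lpp_unfold[of "(a, j)" "(a, b)" w] assms by (simp add: lpp_def)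
qed

lemma lpp_step:
  assumes "i < a" "j < b"
  shows "lpp (i, j) (a, b) w = w (i, j) + max (lpp (i + 1, j) (a, b) w) (lpp (i, j + 1) (a, b) w)"
proof -
  have "up_right_paths ((i, j) + (1, 0)) (a, b) \<noteq> {}" "up_right_paths ((i, j) + (0, 1)) (a, b) \<noteq> {}"
    using assms by (auto intro!: up_right_paths_nonempty simp: less_eq_prod_def)
  then show ?thesis
    using lpp_unfold[of "(i, j)" "(a, b)" w] assms
    by (simp add: lpp_def image_Un Max_Un finite_up_right_paths)
qed

lemma lattice_induct [consumes 2, case_names step]:
  fixes i j a b :: int
  assumes "i \<le> a" "j \<le> b"
    and step: "\<And>i j. i \<le> a \<Longrightarrow> j \<le> b \<Longrightarrow>
      (i < a \<Longrightarrow> P (i + 1) j) \<Longrightarrow> (j < b \<Longrightarrow> P i (j + 1)) \<Longrightarrow> P i j"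
  shows "P i j"
  using assms(1,2)
proof (induction "nat (a - i + (b - j))" arbitrary: i j rule: less_induct)
  case less
  show ?case by (rule step) (use less in auto)
qed

text \<open>Every path ends at \<open>(a, b)\<close>, so the weight there enters all path sums
  equally. Later this allows any law for the weight at a corner.\<close>

lemma lpp_weight_at_end:
  assumes "i \<le> a" "j \<le> b"
    and "\<And>i' j'. i \<le> i' \<Longrightarrow> i' \<le> a \<Longrightarrow> j \<le> j' \<Longrightarrow> j' \<le> b \<Longrightarrow> (i', j') \<noteq> (a, b) \<Longrightarrow> w (i', j') = w' (i', j')"
  shows "lpp (i, j) (a, b) w = lpp (i, j) (a, b) w' + (w (a, b) - w' (a, b))"
  using assms
proof (induction i j rule: lattice_induct)
  case (step i j)
  consider "i = a" "j = b" | "i < a" "j = b" | "i = a" "j < b" | "i < a" "j < b"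
    using step.hyps by linarith
  then show ?case
  proof cases
    case 1
    then show ?thesis by simp
  next
    case 2
    then have "w (i, b) = w' (i, b)"
      "lpp (i + 1, b) (a, b) w = lpp (i + 1, b) (a, b) w' + (w (a, b) - w' (a, b))"
      using step.IH(1) step.prems by auto
    then show ?thesis using 2 by (simp add: lpp_top)
  next
    case 3
    then have "w (a, j) = w' (a, j)"
      "lpp (a, j + 1) (a, b) w = lpp (a, j + 1) (a, b) w' + (w (a, b) - w' (a, b))"
      using step.IH(2) step.prems by auto
    then show ?thesis using 3 by (simp add: lpp_right)
  next
    case 4
    then have "w (i, j) = w' (i, j)"
      "lpp (i + 1, j) (a, b) w = lpp (i + 1, j) (a, b) w' + (w (a, b) - w' (a, b))"
      "lpp (i, j + 1) (a, b) w = lpp (i, j + 1) (a, b) w' + (w (a, b) - w' (a, b))"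
      using step.IH step.prems by auto
    then show ?thesis using 4 by (simp add: lpp_step)
  qed
qed

lemma lpp_cong:
  assumes "i \<le> a" "j \<le> b"
    and "\<And>i' j'. i \<le> i' \<Longrightarrow> i' \<le> a \<Longrightarrow> j \<le> j' \<Longrightarrow> j' \<le> b \<Longrightarrow> w (i', j') = w' (i', j')"
  shows "lpp (i, j) (a, b) w = lpp (i, j) (a, b) w'"
  using lpp_weight_at_end[of i a j b w w'] assms by simp

text \<open>Columns to the left of \<open>c\<close> see the rest of the grid only through the
  passage times from column \<open>c\<close>. A common additive term \<open>K\<close> passes through
  all maxima unchanged.\<close>

lemma lpp_column_cong:
  assumes "i \<le> c" "j \<le> b" "c \<le> a" "c \<le> a'"
    and "\<And>j'. j \<le> j' \<Longrightarrow> j' \<le> b \<Longrightarrow> lpp (c, j') (a, b) w = lpp (c, j') (a', b) w' + K"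
    and "\<And>i' j'. i' < c \<Longrightarrow> j \<le> j' \<Longrightarrow> j' \<le> b \<Longrightarrow> w (i', j') = w' (i', j')"
  shows "lpp (i, j) (a, b) w = lpp (i, j) (a', b) w' + K"
  using assms
proof (induction i j rule: lattice_induct)
  case (step i j)
  show ?case
  proof (cases "i = c")
    case False
    then have i: "i < c" "i < a" "i < a'" and w: "w (i, j) = w' (i, j)" using step by auto
    have 1: "lpp (i + 1, j) (a, b) w = lpp (i + 1, j) (a', b) w' + K"
      using step i by simp
    show ?thesis
    proof (cases "j = b")
      case True
      then show ?thesis using 1 w i by (simp add: lpp_top)
    next
      case False
      then have j: "j < b" using step by auto
      have "lpp (i, j + 1) (a, b) w = lpp (i, j + 1) (a', b) w' + K"
        using step.IH(2)[OF j] step.prems by simp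
      then show ?thesis using 1 w i j by (simp add: lpp_step)
    qed
  qed (use step in auto)
qed

lemma lpp_transpose:
  assumes "i \<le> a" "j \<le> b"
  shows "lpp (i, j) (a, b) w = lpp (j, i) (b, a) (\<lambda>p. w (prod.swap p))"
  using assms
proof (induction i j rule: lattice_induct)
  case (step i j)
  consider "i = a" "j = b" | "i < a" "j = b" | "i = a" "j < b" | "i < a" "j < b"
    using step.hyps by linarith
  then show ?case
  proof cases
    case 1
    then show ?thesis by simp
  next
    case 2
    then show ?thesis using step.IH(1) lpp_top[OF 2(1), of b w] lpp_right[OF 2(1), of b "\<lambda>p. w (prod.swap p)"]
      by simp
  next
    case 3
    then show ?thesis using step.IH(2) lpp_right[OF 3(2), of a w] lpp_top[OF 3(2), of a "\<lambda>p. w (prod.swap p)"]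
      by simp
  next
    case 4
    then show ?thesis using step.IH lpp_step[OF 4, of w] lpp_step[OF 4(2,1), of "\<lambda>p. w (prod.swap p)"]
      by (simp add: max.commute)
  qed
qed

section \<open>Recursion at the endpoint and planar monotonicity\<close>

lemma lpp_last_top:
  assumes "i \<le> a"
  shows "lpp (i, b) (a + 1, b) w = lpp (i, b) (a, b) w + w (a + 1, b)"
  using assms
proof (induction "nat (a - i)" arbitrary: i)
  case 0
  then show ?case by (simp add: lpp_top)
next
  case (Suc n)
  then show ?case using Suc.hyps(1)[of "i + 1"] by (simp add: lpp_top)
qed

lemma lpp_last_right:
  assumes "j \<le> b"
  shows "lpp (a, j) (a, b + 1) w = lpp (a, j) (a, b) w + w (a, b + 1)"
  using assms
proof (induction "nat (b - j)" arbitrary: j)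
  case 0
  then show ?case by (simp add: lpp_right)
next
  case (Suc n)
  then show ?case using Suc.hyps(1)[of "j + 1"] by (simp add: lpp_right)
qed

text \<open>Peeling off the last site instead of the first shows through which neighbour of the
  endpoint a geodesic arrives.\<close>

lemma lpp_last_step:
  assumes "i \<le> a" "j \<le> b"
  shows "lpp (i, j) (a + 1, b + 1) w =
    w (a + 1, b + 1) + max (lpp (i, j) (a, b + 1) w) (lpp (i, j) (a + 1, b) w)"
  using assms
proof (induction i j rule: lattice_induct)
  case (step i j)
  have L: "lpp (i, j) (a + 1, b + 1) w =
      w (i, j) + max (lpp (i + 1, j) (a + 1, b + 1) w) (lpp (i, j + 1) (a + 1, b + 1) w)"
    using step.hyps by (intro lpp_step) auto
  have R: "lpp (i + 1, j) (a + 1, b + 1) w = lpp (i + 1, j) (a + 1, b) w + w (a + 1, b + 1)"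
    if "i = a" using lpp_last_right[of j b "a + 1" w] that step.hyps by simp
  have T: "lpp (i, j + 1) (a + 1, b + 1) w = lpp (i, j + 1) (a, b + 1) w + w (a + 1, b + 1)"
    if "j = b" using lpp_last_top[of i a "b + 1" w] that step.hyps by simp
  have A: "lpp (i, j) (a, b + 1) w = w (i, j) + (if i = a then lpp (i, j + 1) (a, b + 1) w
      else max (lpp (i + 1, j) (a, b + 1) w) (lpp (i, j + 1) (a, b + 1) w))"
    using step.hyps lpp_step[of i a j "b + 1" w] lpp_right[of j "b + 1" a w] by simp
  have B: "lpp (i, j) (a + 1, b) w = w (i, j) + (if j = b then lpp (i + 1, j) (a + 1, b) w
      else max (lpp (i + 1, j) (a + 1, b) w) (lpp (i, j + 1) (a + 1, b) w))"
    using step.hyps lpp_step[of i "a + 1" j b w] lpp_top[of i "a + 1" b w] by simp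
  consider "i = a" "j = b" | "i < a" "j = b" | "i = a" "j < b" | "i < a" "j < b"
    using step.hyps by linarith
  then show ?case
  proof cases
    case 1
    then show ?thesis using L A B R T by (simp add: max.commute)
  next
    case 2
    then show ?thesis using L A B T step.IH(1) by simp
  next
    case 3
    then show ?thesis using L A B R step.IH(2) by simp
  next
    case 4
    then show ?thesis using L A B step.IH by (simp only:) (simp add: max_def)
  qed
qed

lemma max_diff_mono:
  fixes p q p' q' :: real
  assumes "q' - p' \<le> q - p"
  shows "max p' q' - p' \<le> max p q - p" "max p q - q \<le> max p' q' - q'"
  using assms by linarith+

text \<open>The classical argument crosses two geodesics. Here both inequalities are carried through
  one induction: \<open>lpp (i, j + 1)\<close> minus \<open>lpp (i + 1, j)\<close> is a horizontal
  increment minus a vertical one, both based at sites treated earlier, and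
  \<open>max_diff_mono\<close> turns its monotonicity into both claims.\<close>

lemma lpp_incr_right_end:
  assumes "i \<le> a" "j \<le> b"
  shows "(i < a \<longrightarrow> lpp (i, j) (a + 1, b) w - lpp (i + 1, j) (a + 1, b) w \<le> lpp (i, j) (a, b) w - lpp (i + 1, j) (a, b) w)
    \<and> (j < b \<longrightarrow> lpp (i, j) (a, b) w - lpp (i, j + 1) (a, b) w \<le> lpp (i, j) (a + 1, b) w - lpp (i, j + 1) (a + 1, b) w)"
  using assms
proof (induction i j rule: lattice_induct)
  case (step i j)
  consider "i = a" "j = b" | "i < a" "j = b" | "i = a" "j < b" | "i < a" "j < b"
    using step.hyps by linarith
  then show ?case
  proof cases
    case 1
    then show ?thesis by simp
  next
    case 2
    then show ?thesis by (simp add: lpp_top)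
  next
    case 3
    then show ?thesis using lpp_right[of j b a w] lpp_step[of a "a + 1" j b w] by simp
  next
    case 4
    have "lpp (i, j + 1) (a + 1, b) w - lpp (i + 1, j + 1) (a + 1, b) w
        \<le> lpp (i, j + 1) (a, b) w - lpp (i + 1, j + 1) (a, b) w"
      using step.IH(2) 4 by simp
    moreover have "lpp (i + 1, j) (a, b) w - lpp (i + 1, j + 1) (a, b) w
        \<le> lpp (i + 1, j) (a + 1, b) w - lpp (i + 1, j + 1) (a + 1, b) w"
      using step.IH(1) 4 by simp
    ultimately have "lpp (i, j + 1) (a + 1, b) w - lpp (i + 1, j) (a + 1, b) w
        \<le> lpp (i, j + 1) (a, b) w - lpp (i + 1, j) (a, b) w" by linarith
    from max_diff_mono[OF this] show ?thesis
      using lpp_step[OF 4, of w] lpp_step[of i "a + 1" j b w] 4 by simp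
  qed
qed

section \<open>Independent exponential weights\<close>

definition expm :: "real \<Rightarrow> real measure" where
  "expm c = density lborel (exponential_density c)"

text \<open>Indexed by the whole type, so that environments for boxes of all sizes are laws on one
  space and a move of weights is a measurable map of that space.\<close>

definition weights_law :: "('i \<Rightarrow> real) \<Rightarrow> ('i \<Rightarrow> real) measure" where
  "weights_law \<rho> = (\<Pi>\<^sub>M p\<in>UNIV. expm (\<rho> p))"

abbreviation (input) borel_on :: "'i set \<Rightarrow> ('i \<Rightarrow> 'a :: topological_space) measure" where
  "borel_on S \<equiv> \<Pi>\<^sub>M i\<in>S. borel"

abbreviation borel_fun :: "('i \<Rightarrow> real) measure" where
  "borel_fun \<equiv> \<Pi>\<^sub>M p\<in>UNIV. borel"

lemma sets_expm [simp, measurable_cong]: "sets (expm c) = sets borel"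
  by (simp add: expm_def)

lemma space_expm [simp]: "space (expm c) = UNIV"
  by (simp add: expm_def)

lemma prob_space_expm: "0 < c \<Longrightarrow> prob_space (expm c)"
  unfolding expm_def by (rule prob_space_exponential_density)

lemma sets_weights_law [simp, measurable_cong]: "sets (weights_law \<rho>) = sets borel_fun"
  unfolding weights_law_def by (intro sets_PiM_cong) auto

lemma space_weights_law [simp]: "space (weights_law \<rho>) = UNIV"
  by (simp add: weights_law_def space_PiM PiE_UNIV_domain)

lemma prob_space_weights_law: "(\<And>p. 0 < \<rho> p) \<Longrightarrow> prob_space (weights_law \<rho>)"
  unfolding weights_law_def by (intro prob_space_PiM prob_space_expm)

section \<open>Minimum and difference of two independent exponentials\<close>

lemma nn_integral_expm:
  assumes [measurable]: "f \<in> borel_measurable borel"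
  shows "(\<integral>\<^sup>+x. f x \<partial>expm c) = (\<integral>\<^sup>+x. ennreal (exponential_density c x) * f x \<partial>lborel)"
  unfolding expm_def by (rule nn_integral_density) auto

text \<open>For positive parameters, the two-sided exponential law of \<open>X - Y\<close> with
  \<open>X\<close> and \<open>Y\<close> independent of rates \<open>\<alpha>\<close> and
  \<open>\<beta>\<close>.\<close>

definition difference_law :: "real \<Rightarrow> real \<Rightarrow> real measure" where
  "difference_law \<alpha> \<beta> =
     density lborel (\<lambda>t. \<alpha> * \<beta> / (\<alpha> + \<beta>) * exp (- \<alpha> * max 0 t - \<beta> * max 0 (- t)))"

lemma sets_difference_law [simp, measurable_cong]: "sets (difference_law \<alpha> \<beta>) = sets borel"
  by (simp add: difference_law_def)

lemma space_difference_law [simp]: "space (difference_law \<alpha> \<beta>) = UNIV"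
  by (simp add: difference_law_def)

text \<open>The substitution inverts the passage from a pair to its difference \<open>t\<close> and
  minimum \<open>m\<close>. It is a bijection of the plane, linear with determinant 1 or -1 on each
  of the half-planes \<open>t >= 0\<close> and \<open>t < 0\<close>; these are mapped to the parts
  on and below, respectively strictly above, the diagonal.\<close>

lemma lborel_min_difference:
  fixes F :: "real \<times> real \<Rightarrow> ennreal"
  assumes [measurable]: "F \<in> borel_measurable (borel \<Otimes>\<^sub>M borel)"
  shows "(\<integral>\<^sup>+t. \<integral>\<^sup>+m. F (m + max 0 t, m + max 0 (- t)) \<partial>lborel \<partial>lborel) =
    (\<integral>\<^sup>+x. \<integral>\<^sup>+y. F (x, y) \<partial>lborel \<partial>lborel)"
proof -
  have [measurable]: "F \<in> borel_measurable borel" using assms by (simp add: borel_prod)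
  have "(\<integral>\<^sup>+t. \<integral>\<^sup>+m. F (m + max 0 t, m + max 0 (- t)) \<partial>lborel \<partial>lborel) =
     (\<integral>\<^sup>+m. \<integral>\<^sup>+t. F (m + max 0 t, m + max 0 (- t)) \<partial>lborel \<partial>lborel)"
    by (rule lborel_pair.Fubini') simp
  also have "\<dots> = (\<integral>\<^sup>+m. (\<integral>\<^sup>+t. indicator {0..} t * F (m + t, m) \<partial>lborel) +
      (\<integral>\<^sup>+t. indicator {..<0} t * F (m, m - t) \<partial>lborel) \<partial>lborel)"
    by (intro nn_integral_cong, subst nn_integral_add[symmetric])
       (auto intro!: nn_integral_cong simp: max_def split: split_indicator)
  also have "\<dots> = (\<integral>\<^sup>+m. (\<integral>\<^sup>+x. indicator {m..} x * F (x, m) \<partial>lborel) +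
      (\<integral>\<^sup>+y. indicator {m<..} y * F (m, y) \<partial>lborel) \<partial>lborel)"
  proof (rule nn_integral_cong, rule arg_cong2[where f = "(+)"])
    fix m :: real
    show "(\<integral>\<^sup>+t. indicator {0..} t * F (m + t, m) \<partial>lborel) = (\<integral>\<^sup>+x. indicator {m..} x * F (x, m) \<partial>lborel)"
      by (subst (2) nn_integral_real_affine[where c = 1 and t = m])
         (auto intro!: nn_integral_cong split: split_indicator)
    show "(\<integral>\<^sup>+t. indicator {..<0} t * F (m, m - t) \<partial>lborel) = (\<integral>\<^sup>+y. indicator {m<..} y * F (m, y) \<partial>lborel)"
      by (subst (2) nn_integral_real_affine[where c = "-1" and t = m])
         (auto intro!: nn_integral_cong split: split_indicator)
  qed
  also have "\<dots> = (\<integral>\<^sup>+m. \<integral>\<^sup>+x. indicator {m..} x * F (x, m) \<partial>lborel \<partial>lborel) +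
      (\<integral>\<^sup>+m. \<integral>\<^sup>+y. indicator {m<..} y * F (m, y) \<partial>lborel \<partial>lborel)"
    unfolding indicator_def by (rule nn_integral_add) simp_all
  also have "(\<integral>\<^sup>+m. \<integral>\<^sup>+x. indicator {m..} x * F (x, m) \<partial>lborel \<partial>lborel) =
      (\<integral>\<^sup>+x. \<integral>\<^sup>+m. indicator {m..} x * F (x, m) \<partial>lborel \<partial>lborel)"
    unfolding indicator_def by (rule lborel_pair.Fubini') simp
  also have "\<dots> + (\<integral>\<^sup>+m. \<integral>\<^sup>+y. indicator {m<..} y * F (m, y) \<partial>lborel \<partial>lborel) =
      (\<integral>\<^sup>+x. (\<integral>\<^sup>+m. indicator {m..} x * F (x, m) \<partial>lborel) +
        (\<integral>\<^sup>+y. indicator {x<..} y * F (x, y) \<partial>lborel) \<partial>lborel)"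
    unfolding indicator_def by (rule nn_integral_add[symmetric]) simp_all
  also have "\<dots> = (\<integral>\<^sup>+x. \<integral>\<^sup>+y. F (x, y) \<partial>lborel \<partial>lborel)"
    unfolding indicator_def
    by (intro nn_integral_cong, subst nn_integral_add[symmetric]) (auto intro!: nn_integral_cong)
  finally show ?thesis .
qed

lemma expm_min_difference:
  fixes G :: "real \<times> real \<Rightarrow> ennreal"
  assumes [measurable]: "G \<in> borel_measurable (borel \<Otimes>\<^sub>M borel)" and "0 < \<alpha>" "0 < \<beta>"
  shows "(\<integral>\<^sup>+t. \<integral>\<^sup>+m. G (m + max 0 t, m + max 0 (- t)) \<partial>expm (\<alpha> + \<beta>) \<partial>difference_law \<alpha> \<beta>) =
    (\<integral>\<^sup>+x. \<integral>\<^sup>+y. G (x, y) \<partial>expm \<beta> \<partial>expm \<alpha>)"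
proof -
  have [measurable]: "G \<in> borel_measurable borel" using assms by (simp add: borel_prod)
  interpret E: sigma_finite_measure "expm \<beta>"
    using prob_space_expm[OF assms(3)] by (simp add: prob_space_imp_sigma_finite)
  interpret S: sigma_finite_measure "expm (\<alpha> + \<beta>)"
    using prob_space_expm[of "\<alpha> + \<beta>"] assms by (simp add: prob_space_imp_sigma_finite)
  let ?F = "\<lambda>(x, y). ennreal (exponential_density \<alpha> x) * (ennreal (exponential_density \<beta> y) * G (x, y))"
  let ?h = "\<lambda>t. \<alpha> * \<beta> / (\<alpha> + \<beta>) * exp (- \<alpha> * max 0 t - \<beta> * max 0 (- t))"
  have F [measurable]: "?F \<in> borel_measurable (borel \<Otimes>\<^sub>M borel)" by measurable
  \<comment> \<open>The exponent \<open>\<alpha> (m + max 0 t) + \<beta> (m + max 0 (- t))\<close>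
    separates into \<open>(\<alpha> + \<beta>) m\<close> and a term in \<open>t\<close> alone: this
    is the independence of minimum and difference. For \<open>m < 0\<close> one of the two
    coordinates equals \<open>m\<close>, so both sides vanish.\<close>
  have density: "?h t * exponential_density (\<alpha> + \<beta>) m =
      exponential_density \<alpha> (m + max 0 t) * exponential_density \<beta> (m + max 0 (- t))" for t m
  proof (cases "m < 0")
    case True
    then show ?thesis by (cases "t \<ge> 0") (auto simp: exponential_density_def)
  next
    case False
    have "\<alpha> * \<beta> / (\<alpha> + \<beta>) * (\<alpha> + \<beta>) = \<alpha> * \<beta>" using assms by simp
    moreover have "exp (- \<alpha> * max 0 t - \<beta> * max 0 (- t)) * exp (- m * (\<alpha> + \<beta>)) =
        exp (- (m + max 0 t) * \<alpha>) * exp (- (m + max 0 (- t)) * \<beta>)"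
      unfolding exp_add[symmetric] by (simp add: algebra_simps)
    ultimately have "(\<alpha> * \<beta> / (\<alpha> + \<beta>) * (\<alpha> + \<beta>)) * (exp (- \<alpha> * max 0 t - \<beta> * max 0 (- t)) * exp (- m * (\<alpha> + \<beta>))) =
        \<alpha> * \<beta> * (exp (- (m + max 0 t) * \<alpha>) * exp (- (m + max 0 (- t)) * \<beta>))" by simp
    moreover have "\<not> m + max 0 t < 0" "\<not> m + max 0 (- t) < 0" using False by linarith+
    ultimately show ?thesis using False
      by (simp only: exponential_density_def if_False) (simp only: mult.assoc mult.commute mult.left_commute)
  qed
  have "(\<integral>\<^sup>+t. \<integral>\<^sup>+m. G (m + max 0 t, m + max 0 (- t)) \<partial>expm (\<alpha> + \<beta>) \<partial>difference_law \<alpha> \<beta>) =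
      (\<integral>\<^sup>+t. ennreal (?h t) * (\<integral>\<^sup>+m. G (m + max 0 t, m + max 0 (- t)) \<partial>expm (\<alpha> + \<beta>)) \<partial>lborel)"
    unfolding difference_law_def by (subst nn_integral_density) auto
  also have "\<dots> = (\<integral>\<^sup>+t. \<integral>\<^sup>+m. ?F (m + max 0 t, m + max 0 (- t)) \<partial>lborel \<partial>lborel)"
  proof (intro nn_integral_cong)
    fix t :: real
    have "ennreal (?h t) * (\<integral>\<^sup>+m. G (m + max 0 t, m + max 0 (- t)) \<partial>expm (\<alpha> + \<beta>)) =
      (\<integral>\<^sup>+m. ennreal (?h t) * (ennreal (exponential_density (\<alpha> + \<beta>) m) * G (m + max 0 t, m + max 0 (- t))) \<partial>lborel)"
      by (subst nn_integral_expm) (auto intro!: nn_integral_cmult[symmetric])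
    also have "\<dots> = (\<integral>\<^sup>+m. ?F (m + max 0 t, m + max 0 (- t)) \<partial>lborel)"
    proof (intro nn_integral_cong)
      fix m :: real
      have "ennreal (?h t) * ennreal (exponential_density (\<alpha> + \<beta>) m) =
        ennreal (exponential_density \<alpha> (m + max 0 t)) * ennreal (exponential_density \<beta> (m + max 0 (- t)))"
        using assms by (subst (1 2) ennreal_mult[symmetric]) (auto simp only: density exponential_density_nonneg, auto)
      then show "ennreal (?h t) * (ennreal (exponential_density (\<alpha> + \<beta>) m) * G (m + max 0 t, m + max 0 (- t))) =
        ?F (m + max 0 t, m + max 0 (- t))" by (simp add: mult.assoc[symmetric])
    qed
    finally show "ennreal (?h t) * (\<integral>\<^sup>+m. G (m + max 0 t, m + max 0 (- t)) \<partial>expm (\<alpha> + \<beta>)) =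
      (\<integral>\<^sup>+m. ?F (m + max 0 t, m + max 0 (- t)) \<partial>lborel)" .
  qed
  also have "\<dots> = (\<integral>\<^sup>+x. \<integral>\<^sup>+y. ?F (x, y) \<partial>lborel \<partial>lborel)"
    by (rule lborel_min_difference) (rule F)
  also have "\<dots> = (\<integral>\<^sup>+x. ennreal (exponential_density \<alpha> x) * (\<integral>\<^sup>+y. G (x, y) \<partial>expm \<beta>) \<partial>lborel)"
    by (intro nn_integral_cong) (auto simp: nn_integral_expm nn_integral_cmult)
  also have "\<dots> = (\<integral>\<^sup>+x. \<integral>\<^sup>+y. G (x, y) \<partial>expm \<beta> \<partial>expm \<alpha>)"
    by (rule nn_integral_expm[symmetric]) measurable
  finally show ?thesis .
qed

text \<open>The total mass comes from the preceding identity with integrand 1, so the density itself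
  need not be integrated.\<close>

lemma prob_space_difference_law:
  assumes "0 < \<alpha>" "0 < \<beta>"
  shows "prob_space (difference_law \<alpha> \<beta>)"
proof -
  interpret A: prob_space "expm \<alpha>" using assms by (intro prob_space_expm)
  interpret B: prob_space "expm \<beta>" using assms by (intro prob_space_expm)
  interpret S: prob_space "expm (\<alpha> + \<beta>)" using assms by (intro prob_space_expm) simp
  show ?thesis
    using expm_min_difference[of "\<lambda>_. 1", OF _ assms]
      A.emeasure_space_1 B.emeasure_space_1 S.emeasure_space_1
    by (intro prob_spaceI) simp
qed

text \<open>Fubini with two coordinates split off from a possibly infinite product, so that an
  identity about two exponentials can be applied inside the law of a whole environment.\<close>

lemma nn_integral_PiM_two:
  fixes \<mu> :: "'i \<Rightarrow> real measure"
  assumes "a \<noteq> b" and \<mu>: "\<And>i. prob_space (\<mu> i)" "\<And>i. sets (\<mu> i) = sets borel"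
    and F [measurable]: "F \<in> borel_measurable borel_fun"
  shows "(\<integral>\<^sup>+w. F w \<partial>(\<Pi>\<^sub>M i\<in>UNIV. \<mu> i)) =
    (\<integral>\<^sup>+x. \<integral>\<^sup>+y. \<integral>\<^sup>+w. F (w(b := y, a := x)) \<partial>(\<Pi>\<^sub>M i\<in>UNIV - {a, b}. \<mu> i) \<partial>\<mu> b \<partial>\<mu> a)"
proof -
  note [measurable_cong] = \<mu>(2)
  have setsU: "sets (\<Pi>\<^sub>M i\<in>UNIV. \<mu> i) = sets borel_fun" by (intro sets_PiM_cong) (auto simp: \<mu>)
  have F' [measurable]: "F \<in> borel_measurable (\<Pi>\<^sub>M i\<in>UNIV. \<mu> i)"
    using F by (simp cong: measurable_cong_sets add: setsU)
  interpret A: prob_space "\<mu> a" by fact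
  interpret B: prob_space "\<mu> b" by fact
  interpret W: prob_space "\<Pi>\<^sub>M i\<in>UNIV - {a, b}. \<mu> i" by (intro prob_space_PiM \<mu>)
  interpret V: prob_space "\<Pi>\<^sub>M i\<in>UNIV - {a}. \<mu> i" by (intro prob_space_PiM \<mu>)
  have ins: "insert a (UNIV - {a}) = UNIV" "insert b (UNIV - {a, b}) = UNIV - {a}" using assms(1) by auto
  have ma: "(\<lambda>(x, w). w(a := x)) \<in> measurable (\<mu> a \<Otimes>\<^sub>M (\<Pi>\<^sub>M i\<in>UNIV - {a}. \<mu> i)) (\<Pi>\<^sub>M i\<in>UNIV. \<mu> i)"
    unfolding case_prod_beta by (rule measurable_fun_upd[where J = "UNIV - {a}"]) auto
  have mb: "(\<lambda>(x, w). w(b := x)) \<in> measurable (\<mu> b \<Otimes>\<^sub>M (\<Pi>\<^sub>M i\<in>UNIV - {a, b}. \<mu> i)) (\<Pi>\<^sub>M i\<in>UNIV - {a}. \<mu> i)"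
    unfolding case_prod_beta using assms(1) by (intro measurable_fun_upd[where J = "UNIV - {a, b}"]) auto
  have Fa: "(\<lambda>(x, w). F (w(a := x))) \<in> borel_measurable (\<mu> a \<Otimes>\<^sub>M (\<Pi>\<^sub>M i\<in>UNIV - {a}. \<mu> i))"
    using measurable_comp[OF ma F'] by (simp add: comp_def case_prod_beta)
  have "(\<integral>\<^sup>+w. F w \<partial>(\<Pi>\<^sub>M i\<in>UNIV. \<mu> i)) =
      (\<integral>\<^sup>+w. F w \<partial>distr (\<mu> a \<Otimes>\<^sub>M (\<Pi>\<^sub>M i\<in>UNIV - {a}. \<mu> i)) (\<Pi>\<^sub>M i\<in>UNIV. \<mu> i) (\<lambda>(x, w). w(a := x)))"
    using distr_pair_PiM_eq_PiM[of "UNIV - {a}" \<mu> a] \<mu> by (simp add: ins)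
  also have "\<dots> = (\<integral>\<^sup>+z. (\<lambda>(x, w). F (w(a := x))) z \<partial>(\<mu> a \<Otimes>\<^sub>M (\<Pi>\<^sub>M i\<in>UNIV - {a}. \<mu> i)))"
    using ma by (subst nn_integral_distr) (simp_all add: case_prod_beta')
  also have "\<dots> = (\<integral>\<^sup>+x. \<integral>\<^sup>+w. F (w(a := x)) \<partial>(\<Pi>\<^sub>M i\<in>UNIV - {a}. \<mu> i) \<partial>\<mu> a)"
    using V.nn_integral_fst[OF Fa] by simp
  also have "\<dots> = (\<integral>\<^sup>+x. \<integral>\<^sup>+y. \<integral>\<^sup>+w. F (w(b := y, a := x)) \<partial>(\<Pi>\<^sub>M i\<in>UNIV - {a, b}. \<mu> i) \<partial>\<mu> b \<partial>\<mu> a)"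
  proof (intro nn_integral_cong)
    fix x assume x: "x \<in> space (\<mu> a)"
    have Fx: "(\<lambda>w. F (w(a := x))) \<in> borel_measurable (\<Pi>\<^sub>M i\<in>UNIV - {a}. \<mu> i)"
      using measurable_compose_Pair1[OF x Fa] by simp
    have Fb: "(\<lambda>(y, w). F (w(b := y, a := x))) \<in> borel_measurable (\<mu> b \<Otimes>\<^sub>M (\<Pi>\<^sub>M i\<in>UNIV - {a, b}. \<mu> i))"
      using measurable_comp[OF mb Fx] by (simp add: comp_def case_prod_beta)
    have "(\<integral>\<^sup>+w. F (w(a := x)) \<partial>(\<Pi>\<^sub>M i\<in>UNIV - {a}. \<mu> i)) =
        (\<integral>\<^sup>+w. F (w(a := x)) \<partial>distr (\<mu> b \<Otimes>\<^sub>M (\<Pi>\<^sub>M i\<in>UNIV - {a, b}. \<mu> i)) (\<Pi>\<^sub>M i\<in>UNIV - {a}. \<mu> i) (\<lambda>(x, w). w(b := x)))"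
      using distr_pair_PiM_eq_PiM[of "UNIV - {a, b}" \<mu> b] \<mu> by (simp add: ins)
    also have "\<dots> = (\<integral>\<^sup>+z. (\<lambda>(y, w). F (w(b := y, a := x))) z \<partial>(\<mu> b \<Otimes>\<^sub>M (\<Pi>\<^sub>M i\<in>UNIV - {a, b}. \<mu> i)))"
      using mb Fx by (subst nn_integral_distr) (simp_all add: case_prod_beta')
    also have "\<dots> = (\<integral>\<^sup>+y. \<integral>\<^sup>+w. F (w(b := y, a := x)) \<partial>(\<Pi>\<^sub>M i\<in>UNIV - {a, b}. \<mu> i) \<partial>\<mu> b)"
      using W.nn_integral_fst[OF Fb] by simp
    finally show "(\<integral>\<^sup>+w. F (w(a := x)) \<partial>(\<Pi>\<^sub>M i\<in>UNIV - {a}. \<mu> i)) = \<dots>" .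
  qed
  finally show ?thesis .
qed

section \<open>Exchanging two columns\<close>

lemma measurable_fun_upd_UNIV:
  assumes f: "f \<in> measurable M borel_fun" and g: "g \<in> borel_measurable M"
  shows "(\<lambda>x. (f x)(a := g x)) \<in> measurable M borel_fun"
proof (rule measurable_PiM_single')
  fix i
  have "(\<lambda>x. f x i) \<in> borel_measurable M"
    using measurable_compose[OF f measurable_component_singleton[of i]] by simp
  then show "(\<lambda>x. ((f x)(a := g x)) i) \<in> borel_measurable M"
    using g by (cases "i = a") auto
qed (auto simp: space_PiM PiE_UNIV_domain)

text \<open>Read from right to left, this factors two independent exponential weights into a
  difference stored at \<open>a\<close> and an independent minimum stored at
  \<open>b\<close>.\<close>

lemma distr_min_difference:
  fixes \<mu> :: "'i \<Rightarrow> real measure"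
  assumes "a \<noteq> b" and \<mu>: "\<And>i. prob_space (\<mu> i)" "\<And>i. sets (\<mu> i) = sets borel"
    and pos: "0 < \<alpha>" "0 < \<beta>"
  shows "distr (Pi\<^sub>M UNIV (\<mu>(a := difference_law \<alpha> \<beta>, b := expm (\<alpha> + \<beta>)))) borel_fun
      (\<lambda>w. w(a := w b + max 0 (w a), b := w b + max 0 (- w a))) =
    Pi\<^sub>M UNIV (\<mu>(a := expm \<alpha>, b := expm \<beta>))" (is "distr (Pi\<^sub>M UNIV ?\<mu>1) _ ?D = Pi\<^sub>M UNIV ?\<mu>2")
proof (rule measure_eqI)
  have sets1: "sets (?\<mu>1 i) = sets borel" and sets2: "sets (?\<mu>2 i) = sets borel" for i
    by (auto simp: \<mu>)
  have S2: "sets (Pi\<^sub>M UNIV ?\<mu>2) = sets borel_fun" by (intro sets_PiM_cong sets2) auto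
  then show "sets (distr (Pi\<^sub>M UNIV ?\<mu>1) borel_fun ?D) = sets (Pi\<^sub>M UNIV ?\<mu>2)" by simp
  have S1: "sets (Pi\<^sub>M UNIV ?\<mu>1) = sets borel_fun" by (intro sets_PiM_cong sets1) auto
  have prob: "prob_space (?\<mu>1 i)" "prob_space (?\<mu>2 i)" for i
    using \<mu> pos by (auto intro: prob_space_difference_law prob_space_expm)
  have D0: "?D \<in> measurable borel_fun borel_fun"
    by (intro measurable_fun_upd_UNIV) measurable
  then have D: "?D \<in> measurable (Pi\<^sub>M UNIV ?\<mu>1) borel_fun"
    by (simp cong: measurable_cong_sets add: S1)
  fix A assume "A \<in> sets (distr (Pi\<^sub>M UNIV ?\<mu>1) borel_fun ?D)"
  then have A: "A \<in> sets borel_fun" by simp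
  let ?F = "indicator A :: _ \<Rightarrow> ennreal"
  have F: "?F \<in> borel_measurable borel_fun" using A by simp
  have FD: "(\<lambda>w. ?F (?D w)) \<in> borel_measurable borel_fun" using measurable_comp[OF D0 F] by (simp add: comp_def)
  have cong: "Pi\<^sub>M (UNIV - {a, b}) ?\<mu>1 = Pi\<^sub>M (UNIV - {a, b}) \<mu>" "Pi\<^sub>M (UNIV - {a, b}) ?\<mu>2 = Pi\<^sub>M (UNIV - {a, b}) \<mu>"
    by (rule PiM_cong, simp, simp)+
  interpret W: prob_space "Pi\<^sub>M (UNIV - {a, b}) \<mu>" by (intro prob_space_PiM \<mu>)
  let ?G = "\<lambda>(x, y). \<integral>\<^sup>+w. ?F (w(b := y, a := x)) \<partial>Pi\<^sub>M (UNIV - {a, b}) \<mu>"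
  have "(\<lambda>(p, w). w(b := snd p, a := fst p)) \<in> measurable ((borel \<Otimes>\<^sub>M borel) \<Otimes>\<^sub>M Pi\<^sub>M (UNIV - {a, b}) \<mu>) borel_fun"
  proof (rule measurable_PiM_single')
    fix i
    have "(\<lambda>z. snd z i) \<in> borel_measurable ((borel \<Otimes>\<^sub>M borel :: (real \<times> real) measure) \<Otimes>\<^sub>M Pi\<^sub>M (UNIV - {a, b}) \<mu>)"
      if "i \<in> UNIV - {a, b}"
      using measurable_comp[OF measurable_snd measurable_component_singleton[OF that, of \<mu>]]
      by (simp add: comp_def cong: measurable_cong_sets add: \<mu>)
    then show "(\<lambda>z. (case z of (p, w) \<Rightarrow> w(b := snd p, a := fst p)) i) \<in> borel_measurable
        ((borel \<Otimes>\<^sub>M borel :: (real \<times> real) measure) \<Otimes>\<^sub>M Pi\<^sub>M (UNIV - {a, b}) \<mu>)"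
      by (cases "i = a"; cases "i = b") (auto simp: case_prod_beta')
  qed (auto simp: space_PiM PiE_UNIV_domain)
  from measurable_comp[OF this F]
  have "(\<lambda>(p, w). ?F (w(b := snd p, a := fst p))) \<in> borel_measurable ((borel \<Otimes>\<^sub>M borel) \<Otimes>\<^sub>M Pi\<^sub>M (UNIV - {a, b}) \<mu>)"
    by (simp add: comp_def case_prod_beta')
  from W.borel_measurable_nn_integral[OF this]
  have G: "?G \<in> borel_measurable (borel \<Otimes>\<^sub>M borel)" by (simp add: case_prod_beta')
  have upd: "?D (w(b := m, a := t)) = w(b := m + max 0 (- t), a := m + max 0 t)" for w m t
    using assms(1) by (auto simp: fun_eq_iff)
  have "emeasure (distr (Pi\<^sub>M UNIV ?\<mu>1) borel_fun ?D) A =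
      (\<integral>\<^sup>+w. ?F w \<partial>distr (Pi\<^sub>M UNIV ?\<mu>1) borel_fun ?D)"
    by (rule nn_integral_indicator[symmetric]) (use A in simp)
  also have "\<dots> = (\<integral>\<^sup>+w. ?F (?D w) \<partial>Pi\<^sub>M UNIV ?\<mu>1)"
    by (rule nn_integral_distr[OF D]) (use F in simp)
  also have "\<dots> = (\<integral>\<^sup>+t. \<integral>\<^sup>+m. ?G (m + max 0 t, m + max 0 (- t)) \<partial>expm (\<alpha> + \<beta>) \<partial>difference_law \<alpha> \<beta>)"
    unfolding nn_integral_PiM_two[OF assms(1) prob(1) sets1 FD] cong upd
    using assms(1) by simp
  also have "\<dots> = (\<integral>\<^sup>+x. \<integral>\<^sup>+y. ?G (x, y) \<partial>expm \<beta> \<partial>expm \<alpha>)"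
    by (rule expm_min_difference[OF G pos])
  also have "\<dots> = (\<integral>\<^sup>+w. ?F w \<partial>Pi\<^sub>M UNIV ?\<mu>2)"
    unfolding nn_integral_PiM_two[OF assms(1) prob(2) sets2 F] cong using assms(1) by simp
  also have "\<dots> = emeasure (Pi\<^sub>M UNIV ?\<mu>2) A"
    using A by (subst nn_integral_indicator) (auto simp: S2)
  finally show "emeasure (distr (Pi\<^sub>M UNIV ?\<mu>1) borel_fun ?D) A = emeasure (Pi\<^sub>M UNIV ?\<mu>2) A" .
qed

text \<open>One service step of a queue. \<open>w a\<close> is the incoming increment,
  \<open>w c\<close> and \<open>w b\<close> are the weights of the left and the right column in one
  row. The move leaves the outgoing increment at \<open>a\<close> and the new weights of the row at
  \<open>c\<close> and \<open>b\<close>.\<close>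

definition burke_move :: "'i \<Rightarrow> 'i \<Rightarrow> 'i \<Rightarrow> ('i \<Rightarrow> real) \<Rightarrow> 'i \<Rightarrow> real" where
  "burke_move a b c w =
     w(a := w c + max 0 (w a - w b), b := min (w a) (w b), c := w c + max 0 (w b - w a))"

lemma measurable_burke_move: "burke_move a b c \<in> measurable borel_fun borel_fun"
  unfolding burke_move_def[abs_def] by (intro measurable_fun_upd_UNIV) measurable

text \<open>
  The minimum and the difference of \<open>w a\<close> and \<open>w b\<close> are independent, and the move merely exchanges
  this minimum with \<open>w c\<close>, which has the same law.
\<close>

lemma distr_burke_move:
  assumes distinct: "a \<noteq> b" "a \<noteq> c" "b \<noteq> c" and pos: "\<And>i. 0 < \<rho> i" and \<rho>: "\<rho> c = \<rho> a + \<rho> b"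
  shows "distr (weights_law \<rho>) borel_fun (burke_move a b c) = weights_law (\<rho>(b := \<rho> c, c := \<rho> b))"
proof -
  define \<mu> where "\<mu> i = expm (\<rho> i)" for i
  define \<nu> where "\<nu> = difference_law (\<rho> a) (\<rho> b)"
  define E where "E = expm (\<rho> a + \<rho> b)"
  have \<mu>: "prob_space (\<mu> i)" "sets (\<mu> i) = sets borel" for i
    using pos by (auto simp: \<mu>_def intro: prob_space_expm)
  have \<mu>': "prob_space ((\<mu>(b := E)) i)" "sets ((\<mu>(b := E)) i) = sets borel" for i
    using \<mu> prob_space_expm[OF add_pos_pos[OF pos[of a] pos[of b]]] by (simp_all add: E_def)
  let ?D = "\<lambda>b w. w(a := w b + max 0 (w a), b := w b + max 0 (- w a)) :: 'a \<Rightarrow> real"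
  have D: "?D b \<in> measurable borel_fun borel_fun"
    by (intro measurable_fun_upd_UNIV) measurable
  have S: "sets (Pi\<^sub>M UNIV (\<mu>(a := \<nu>, b := E))) = sets borel_fun"
    by (intro sets_PiM_cong) (auto simp: \<mu> \<nu>_def E_def)
  have D': "?D b \<in> measurable (Pi\<^sub>M UNIV (\<mu>(a := \<nu>, b := E))) borel_fun"
    using D by (simp cong: measurable_cong_sets add: S)
  have "weights_law \<rho> = Pi\<^sub>M UNIV (\<mu>(a := expm (\<rho> a), b := expm (\<rho> b)))"
    unfolding weights_law_def by (intro PiM_cong) (auto simp: \<mu>_def)
  also have "\<dots> = distr (Pi\<^sub>M UNIV (\<mu>(a := \<nu>, b := E))) borel_fun (?D b)"
    unfolding \<nu>_def E_def using distinct pos \<mu> by (intro distr_min_difference[symmetric]) auto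
  finally have "distr (weights_law \<rho>) borel_fun (burke_move a b c) =
      distr (Pi\<^sub>M UNIV (\<mu>(a := \<nu>, b := E))) borel_fun (burke_move a b c \<circ> ?D b)"
    by (simp only: distr_distr[OF measurable_burke_move D'])
  also have "burke_move a b c \<circ> ?D b = ?D c"
    using distinct by (auto simp: burke_move_def fun_eq_iff max_def min_def)
  \<comment> \<open>As \<open>c\<close> carries the rate \<open>\<rho> a + \<rho> b\<close> from the
    start, the law \<open>E\<close> of the minimum stands at both \<open>b\<close> and
    \<open>c\<close>, and either site may be read as the one holding the minimum.\<close>
  also have "\<mu>(a := \<nu>, b := E) = (\<mu>(b := E))(a := \<nu>, c := E)"
    using distinct by (auto simp: fun_eq_iff \<mu>_def E_def \<rho>)
  also have "distr (Pi\<^sub>M UNIV ((\<mu>(b := E))(a := \<nu>, c := E))) borel_fun (?D c) =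
      Pi\<^sub>M UNIV ((\<mu>(b := E))(a := expm (\<rho> a), c := expm (\<rho> b)))"
    unfolding \<nu>_def E_def using distinct pos \<mu>'[unfolded E_def] by (intro distr_min_difference) auto
  also have "\<dots> = weights_law (\<rho>(b := \<rho> c, c := \<rho> b))"
    unfolding weights_law_def using distinct by (intro PiM_cong) (auto simp: \<mu>_def E_def \<rho>)
  finally show ?thesis .
qed

section \<open>Queues and the exchange of the weights of two columns\<close>

primrec queue :: "int \<Rightarrow> int \<Rightarrow> (int \<times> int \<Rightarrow> real) \<Rightarrow> nat \<Rightarrow> real" where
  "queue c T w 0 = w (c, T)"
| "queue c T w (Suc n) = w (c, T - 1 - int n) + max 0 (queue c T w n - w (c + 1, T - 1 - int n))"

text \<open>
  The Burke moves run through the rows \<open>T - 1, \<dots>, T - n\<close>, and the site \<open>(c, T)\<close> stores the current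
  value of the queue, which is the horizontal increment towards \<open>(c + 1, T)\<close>.
\<close>

definition column_swap :: "int \<Rightarrow> int \<Rightarrow> nat \<Rightarrow> (int \<times> int \<Rightarrow> real) \<Rightarrow> int \<times> int \<Rightarrow> real" where
  "column_swap c T n w = (\<lambda>(i, j).
     if i = c \<and> j = T then queue c T w n
     else if i = c \<and> T - int n \<le> j \<and> j < T
       then w (c, j) + max 0 (w (c + 1, j) - queue c T w (nat (T - 1 - j)))
     else if i = c + 1 \<and> T - int n \<le> j \<and> j < T
       then min (queue c T w (nat (T - 1 - j))) (w (c + 1, j))
     else w (i, j))"

definition swapped_rates :: "int \<Rightarrow> int \<Rightarrow> nat \<Rightarrow> (int \<times> int \<Rightarrow> real) \<Rightarrow> int \<times> int \<Rightarrow> real" where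
  "swapped_rates c T n \<rho> = (\<lambda>(i, j).
     if i = c \<and> T - int n \<le> j \<and> j < T then \<rho> (c + 1, j)
     else if i = c + 1 \<and> T - int n \<le> j \<and> j < T then \<rho> (c, j)
     else \<rho> (i, j))"

lemma column_swap_0: "column_swap c T 0 w = w"
  by (auto simp: column_swap_def fun_eq_iff)

lemma column_swap_Suc:
  "column_swap c T (Suc n) w =
     burke_move (c, T) (c + 1, T - 1 - int n) (c, T - 1 - int n) (column_swap c T n w)"
proof (rule ext, clarify)
  fix i j
  have n: "nat (T - 1 - (T - 1 - int n)) = n" by simp
  show "column_swap c T (Suc n) w (i, j) =
     burke_move (c, T) (c + 1, T - 1 - int n) (c, T - 1 - int n) (column_swap c T n w) (i, j)"
  proof (cases "j = T - 1 - int n")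
    case True
    then have "j \<noteq> T" "T - int (Suc n) \<le> j" "j < T" "\<not> T - int n \<le> j" by auto
    then show ?thesis unfolding True by (simp add: column_swap_def burke_move_def)
  next
    case False
    then have "T - int (Suc n) \<le> j \<longleftrightarrow> T - int n \<le> j" by auto
    then show ?thesis using False by (simp add: column_swap_def burke_move_def)
  qed
qed

lemma measurable_column_swap: "column_swap c T n \<in> measurable borel_fun borel_fun"
proof (induction n)
  case 0
  then show ?case by (simp add: column_swap_0[abs_def])
next
  case (Suc n)
  then show ?case unfolding column_swap_Suc[abs_def]
    using measurable_comp[OF Suc measurable_burke_move] by (simp add: comp_def)
qed

text \<open>Each Burke move returns the site \<open>(c, T)\<close> with its old rate and independent
  of the rest, so the next row below finds the same situation.\<close>

lemma distr_column_swap: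
  assumes pos: "\<And>p. 0 < \<rho> p"
    and \<rho>: "\<And>j. T - int n \<le> j \<Longrightarrow> j < T \<Longrightarrow> \<rho> (c, j) = \<rho> (c, T) + \<rho> (c + 1, j)"
  shows "distr (weights_law \<rho>) borel_fun (column_swap c T n) = weights_law (swapped_rates c T n \<rho>)"
  using \<rho>
proof (induction n)
  case 0
  have "swapped_rates c T 0 \<rho> = \<rho>" by (auto simp: swapped_rates_def fun_eq_iff)
  moreover have "distr (weights_law \<rho>) borel_fun (\<lambda>w. w) = weights_law \<rho>"
    by (intro distr_id2) simp
  ultimately show ?case by (simp add: column_swap_0[abs_def])
next
  case (Suc n)
  let ?r = "swapped_rates c T n \<rho>" and ?j = "T - 1 - int n"
  have "distr (weights_law \<rho>) borel_fun (column_swap c T (Suc n)) =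
      distr (distr (weights_law \<rho>) borel_fun (column_swap c T n)) borel_fun (burke_move (c, T) (c + 1, ?j) (c, ?j))"
    using measurable_column_swap measurable_burke_move
    by (subst distr_distr) (auto simp: column_swap_Suc[abs_def] comp_def)
  also have "distr (weights_law \<rho>) borel_fun (column_swap c T n) = weights_law ?r"
    by (rule Suc.IH) (use Suc.prems in auto)
  also have "distr (weights_law ?r) borel_fun (burke_move (c, T) (c + 1, ?j) (c, ?j)) =
      weights_law (?r((c + 1, ?j) := ?r (c, ?j), (c, ?j) := ?r (c + 1, ?j)))"
    by (rule distr_burke_move) (use pos Suc.prems[of ?j] in \<open>auto simp: swapped_rates_def\<close>)
  also have "?r((c + 1, ?j) := ?r (c, ?j), (c, ?j) := ?r (c + 1, ?j)) = swapped_rates c T (Suc n) \<rho>"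
    by (auto simp: swapped_rates_def fun_eq_iff)
  finally show ?case .
qed

text \<open>
  \<open>P\<close> and \<open>Q\<close> are the passage times from the left and the right column, a prime marks the swapped
  weights, and \<open>1\<close> marks the row above.
\<close>

lemma queue_exchange_step:
  fixes x y A P1 Q1 Q1' I1 :: real
  defines "Q \<equiv> y + max Q1 A" and "Q' \<equiv> min I1 y + max Q1' A" and "I \<equiv> x + max 0 (I1 - y)"
  defines "P \<equiv> x + max P1 Q"
  assumes "Q1' \<le> Q1" "P1 - Q1 \<le> I1" "Q1' = Q1 \<or> P1 - Q1 = I1"
  shows "x + max 0 (y - I1) + max P1 Q' = P \<and> Q' \<le> Q \<and> P - Q \<le> I \<and> (Q' = Q \<or> P - Q = I)"
proof (cases "y \<le> I1")
  case True
  then have "Q' = y + max Q1' A" "I = x + (I1 - y)" "max 0 (y - I1) = 0"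
    by (auto simp: Q'_def I_def)
  with assms(5-7) True show ?thesis unfolding P_def Q_def by linarith
next
  case False
  then have "Q' = I1 + max Q1' A" "I = x" "max 0 (y - I1) = y - I1"
    by (auto simp: Q'_def I_def)
  with False assms(5-7) show ?thesis unfolding P_def Q_def by linarith
qed

text \<open>The last disjunction makes the induction work: the passage time from the right column
  may drop, but only where the horizontal increment attains its upper bound, the queue. There the
  enlarged weight in the left column compensates the loss exactly.\<close>

lemma lpp_column_swap_aux:
  fixes c T n w
  defines "w' \<equiv> column_swap c T n w"
  assumes "c + 2 \<le> a" "b < T" "j \<le> b" "T - int n \<le> j"
  shows "lpp (c, j) (a, b) w' = lpp (c, j) (a, b) w \<and>
    lpp (c + 1, j) (a, b) w' \<le> lpp (c + 1, j) (a, b) w \<and>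
    lpp (c, j) (a, b) w - lpp (c + 1, j) (a, b) w \<le> queue c T w (nat (T - j)) \<and>
    (lpp (c + 1, j) (a, b) w' = lpp (c + 1, j) (a, b) w \<or>
     lpp (c, j) (a, b) w - lpp (c + 1, j) (a, b) w = queue c T w (nat (T - j)))"
  using assms(4,5)
proof (induction "nat (b - j)" arbitrary: j)
  case 0
  then have j: "j = b" by simp
  have A: "lpp (c + 1 + 1, b) (a, b) w' = lpp (c + 1 + 1, b) (a, b) w"
    by (rule lpp_cong) (use assms in \<open>auto simp: column_swap_def\<close>)
  have q: "queue c T w (nat (T - b)) =
      w (c, b) + max 0 (queue c T w (nat (T - 1 - b)) - w (c + 1, b))"
    using assms(3) queue.simps(2)[of c T w "nat (T - 1 - b)"] by (simp add: Suc_nat_eq_nat_zadd1)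
  have w': "w' (c, b) = w (c, b) + max 0 (w (c + 1, b) - queue c T w (nat (T - 1 - b)))"
    "w' (c + 1, b) = min (queue c T w (nat (T - 1 - b))) (w (c + 1, b))"
    using 0 assms(3) j by (auto simp: w'_def column_swap_def)
  show ?case
    unfolding j q using assms(2) A w' by (simp add: lpp_top) linarith
next
  case (Suc m)
  then have j: "j < b" "j < T" using assms(3) by auto
  have IH: "lpp (c, j + 1) (a, b) w' = lpp (c, j + 1) (a, b) w"
    "lpp (c + 1, j + 1) (a, b) w' \<le> lpp (c + 1, j + 1) (a, b) w"
    "lpp (c, j + 1) (a, b) w - lpp (c + 1, j + 1) (a, b) w \<le> queue c T w (nat (T - 1 - j))"
    "lpp (c + 1, j + 1) (a, b) w' = lpp (c + 1, j + 1) (a, b) w \<or>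
     lpp (c, j + 1) (a, b) w - lpp (c + 1, j + 1) (a, b) w = queue c T w (nat (T - 1 - j))"
    using Suc.hyps(1)[of "j + 1"] Suc.hyps(2) Suc.prems j by (auto simp: algebra_simps)
  have A: "lpp (c + 1 + 1, j) (a, b) w' = lpp (c + 1 + 1, j) (a, b) w"
    by (rule lpp_cong) (use assms j in \<open>auto simp: column_swap_def\<close>)
  have q: "queue c T w (nat (T - j)) =
      w (c, j) + max 0 (queue c T w (nat (T - 1 - j)) - w (c + 1, j))"
    using j queue.simps(2)[of c T w "nat (T - 1 - j)"] by (simp add: Suc_nat_eq_nat_zadd1)
  have w': "w' (c, j) = w (c, j) + max 0 (w (c + 1, j) - queue c T w (nat (T - 1 - j)))"
    "w' (c + 1, j) = min (queue c T w (nat (T - 1 - j))) (w (c + 1, j))"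
    using Suc.prems j by (auto simp: w'_def column_swap_def)
  have Q: "lpp (c + 1, j) (a, b) v = v (c + 1, j) + max (lpp (c + 1, j + 1) (a, b) v) (lpp (c + 1 + 1, j) (a, b) v)" for v
    using assms(2) j lpp_step[of "c + 1" a j b v] by (simp add: max.commute)
  have P: "lpp (c, j) (a, b) v = v (c, j) + max (lpp (c, j + 1) (a, b) v) (lpp (c + 1, j) (a, b) v)" for v
    using assms(2) j lpp_step[of c a j b v] by (simp add: max.commute)
  show ?case
    unfolding P[of w] P[of w'] Q[of w] Q[of w'] q w' A IH(1)
    using queue_exchange_step[OF IH(2-4), of "w (c, j)" "w (c + 1, j)" "lpp (c + 1 + 1, j) (a, b) w"]
    by blast
qed

lemma lpp_column_swap_right:
  assumes "c + 2 \<le> a" "b < T" "i \<le> c" "j \<le> b" "T - int n \<le> j"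
  shows "lpp (i, j) (a, b) (column_swap c T n w) = lpp (i, j) (a, b) w"
  using lpp_column_cong[of i c j b a a "column_swap c T n w" w 0]
    lpp_column_swap_aux[of c a b T _ n w] assms by (auto simp: column_swap_def)

lemma lpp_column_swap_top_aux:
  assumes "j \<le> T" "T - int n \<le> j"
  shows "lpp (c, j) (c + 1, T) w =
      lpp (c, j) (c, T) (column_swap c T n w) + (w (c, T) + w (c + 1, T) - queue c T w n) \<and>
    lpp (c, j) (c + 1, T) w - lpp (c + 1, j) (c + 1, T) w = queue c T w (nat (T - j))"
  using assms
proof (induction "nat (T - j)" arbitrary: j)
  case 0
  then have "j = T" by simp
  then show ?case by (simp add: lpp_top column_swap_def)
next
  case (Suc m)
  then have j: "j < T" by auto
  let ?w' = "column_swap c T n w"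
  have m: "m = nat (T - (j + 1))" using Suc.hyps(2) by auto
  have IH: "lpp (c, j + 1) (c + 1, T) w =
      lpp (c, j + 1) (c, T) ?w' + (w (c, T) + w (c + 1, T) - queue c T w n)"
    "lpp (c, j + 1) (c + 1, T) w - lpp (c + 1, j + 1) (c + 1, T) w = queue c T w (nat (T - 1 - j))"
    using Suc.hyps(1)[OF m] Suc.prems j by (auto simp: diff_diff_eq add.commute)
  have q: "queue c T w (nat (T - j)) =
      w (c, j) + max 0 (queue c T w (nat (T - 1 - j)) - w (c + 1, j))"
    using j queue.simps(2)[of c T w "nat (T - 1 - j)"] by (simp add: Suc_nat_eq_nat_zadd1)
  have w': "?w' (c, j) = w (c, j) + max 0 (w (c + 1, j) - queue c T w (nat (T - 1 - j)))"
    using Suc.prems j by (auto simp: column_swap_def)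
  have Q: "lpp (c + 1, j) (c + 1, T) w = w (c + 1, j) + lpp (c + 1, j + 1) (c + 1, T) w"
    and R: "lpp (c, j) (c, T) ?w' = ?w' (c, j) + lpp (c, j + 1) (c, T) ?w'"
    using lpp_right j by auto
  have P: "lpp (c, j) (c + 1, T) w = w (c, j) + max (lpp (c + 1, j) (c + 1, T) w) (lpp (c, j + 1) (c + 1, T) w)"
    using lpp_step[of c "c + 1" j T w] j by simp
  show ?case using IH q w' P Q R by linarith
qed

text \<open>Towards the endpoint in row \<open>T\<close> the two columns collapse into one: the
  endpoint moves from \<open>(c + 1, T)\<close> to \<open>(c, T)\<close>, and the correction is
  random but common to all starting points.\<close>

lemma lpp_column_swap_top:
  assumes "i \<le> c" "j \<le> T" "T - int n \<le> j"
  shows "lpp (i, j) (c + 1, T) w =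
    lpp (i, j) (c, T) (column_swap c T n w) + (w (c, T) + w (c + 1, T) - queue c T w n)"
  using lpp_column_cong[of i c j T "c + 1" c w "column_swap c T n w" "w (c, T) + w (c + 1, T) - queue c T w n"]
    lpp_column_swap_top_aux[of _ T n c w] assms by (auto simp: column_swap_def)

lemma lpp_column_swap_left:
  assumes "a < c" "i \<le> a" "j \<le> b"
  shows "lpp (i, j) (a, b) (column_swap c T n w) = lpp (i, j) (a, b) w"
  using assms by (intro lpp_cong) (auto simp: column_swap_def)

section \<open>The inhomogeneous environments\<close>

lemma measurable_weights_law: "measurable (weights_law \<rho>) N = measurable borel_fun N"
  by (rule measurable_cong_sets) simp_all

text \<open>Forgets the weights outside \<open>A\<close> but remains a total function, so that
  families indexed by different sets and living on different probability spaces can be compared on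
  one space.\<close>

definition zero_off :: "'i set \<Rightarrow> ('i \<Rightarrow> real) \<Rightarrow> 'i \<Rightarrow> real" where
  "zero_off A w = (\<lambda>p. if p \<in> A then w p else 0)"

lemma measurable_zero_off: "zero_off A \<in> measurable borel_fun borel_fun"
  unfolding zero_off_def
proof (rule measurable_PiM_single')
  fix i
  show "(\<lambda>w. if i \<in> A then w i else 0) \<in> borel_measurable borel_fun"
    by (cases "i \<in> A") auto
qed (auto simp: space_PiM PiE_UNIV_domain)

lemma distr_zero_off_eq_weights_law:
  assumes "prob_space M"
    and indep: "prob_space.indep_vars M (\<lambda>_. borel) X A"
    and X: "\<And>p. p \<in> A \<Longrightarrow> distr M borel (X p) = expm (\<rho> p)"
    and pos: "\<And>p. 0 < \<rho> p"
  shows "distr M borel_fun (\<lambda>x. zero_off A (\<lambda>p. X p x)) = distr (weights_law \<rho>) borel_fun (zero_off A)"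
proof -
  interpret M: prob_space M by fact
  interpret W: prob_space "weights_law \<rho>" by (rule prob_space_weights_law) fact
  let ?ext = "\<lambda>w p. if p \<in> A then w p else (0::real)"
  have ext: "?ext \<in> measurable (\<Pi>\<^sub>M p\<in>A. borel) borel_fun"
  proof (rule measurable_PiM_single')
    fix i
    show "(\<lambda>w. if i \<in> A then w i else 0) \<in> borel_measurable (\<Pi>\<^sub>M p\<in>A. borel)"
      by (cases "i \<in> A") auto
  qed (auto simp: space_PiM PiE_UNIV_domain)
  have XA: "X p \<in> borel_measurable M" if "p \<in> A" for p
    using indep that by (simp add: M.indep_vars_def2)
  have rX: "(\<lambda>x. \<lambda>p\<in>A. X p x) \<in> measurable M (\<Pi>\<^sub>M p\<in>A. borel)"
    by (rule measurable_restrict) (rule XA)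
  have rW: "(\<lambda>w. \<lambda>p\<in>A. w p) \<in> measurable (weights_law \<rho>) (\<Pi>\<^sub>M p\<in>A. borel)"
    by (rule measurable_restrict) simp
  have setsA: "sets (\<Pi>\<^sub>M p\<in>A. expm (\<rho> p)) = sets (\<Pi>\<^sub>M p\<in>A. borel)"
    by (intro sets_PiM_cong) auto
  have "distr M (\<Pi>\<^sub>M p\<in>A. borel) (\<lambda>x. \<lambda>p\<in>A. X p x) = (\<Pi>\<^sub>M p\<in>A. expm (\<rho> p))"
  proof (cases "A = {}")
    case True
    then have "distr M (\<Pi>\<^sub>M p\<in>A. borel) (\<lambda>x. \<lambda>p\<in>A. X p x) = return (\<Pi>\<^sub>M p\<in>A. borel) (\<lambda>_. undefined)"
      by (auto intro!: M.distr_const simp: space_PiM restrict_def)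
    also have "\<dots> = (\<Pi>\<^sub>M p\<in>A. expm (\<rho> p))"
    proof (rule measure_eqI)
      fix B assume "B \<in> sets (return (\<Pi>\<^sub>M p\<in>A. borel :: real measure) (\<lambda>_. undefined))"
      then show "emeasure (return (\<Pi>\<^sub>M p\<in>A. borel) (\<lambda>_. undefined)) B = emeasure (\<Pi>\<^sub>M p\<in>A. expm (\<rho> p)) B"
        using True by (auto simp: PiM_empty sets_PiM_empty subset_singleton_iff)
    qed (simp add: setsA)
    finally show ?thesis .
  next
    case False
    have "distr M (\<Pi>\<^sub>M p\<in>A. borel) (\<lambda>x. \<lambda>p\<in>A. X p x) = (\<Pi>\<^sub>M p\<in>A. distr M borel (X p))"
      using M.indep_vars_iff_distr_eq_PiM'[OF False, of X "\<lambda>_. borel"] XA indep by simp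
    also have "\<dots> = (\<Pi>\<^sub>M p\<in>A. expm (\<rho> p))" by (intro PiM_cong) (auto simp: X)
    finally show ?thesis .
  qed
  also have "\<dots> = distr (weights_law \<rho>) (\<Pi>\<^sub>M p\<in>A. expm (\<rho> p)) (\<lambda>w. \<lambda>p\<in>A. w p)"
    unfolding weights_law_def
    by (rule distr_PiM_reindex[of UNIV "\<lambda>p. expm (\<rho> p)" "\<lambda>p. p" A, symmetric]) (auto intro: prob_space_expm pos)
  also have "\<dots> = distr (weights_law \<rho>) (\<Pi>\<^sub>M p\<in>A. borel) (\<lambda>w. \<lambda>p\<in>A. w p)"
    by (intro distr_cong setsA) auto
  finally have "distr (distr M (\<Pi>\<^sub>M p\<in>A. borel) (\<lambda>x. \<lambda>p\<in>A. X p x)) borel_fun ?ext =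
      distr (distr (weights_law \<rho>) (\<Pi>\<^sub>M p\<in>A. borel) (\<lambda>w. \<lambda>p\<in>A. w p)) borel_fun ?ext" by simp
  then show ?thesis
    unfolding distr_distr[OF ext rX] distr_distr[OF ext rW]
    by (simp add: comp_def zero_off_def[abs_def] restrict_def cong: if_cong)
qed

lemma indep_vars_weights_law:
  assumes pos: "\<And>p. 0 < \<rho> p"
  shows "prob_space.indep_vars (weights_law \<rho>) (\<lambda>_. borel) (\<lambda>p w. w p) A"
    and "distr (weights_law \<rho>) borel (\<lambda>w. w p) = expm (\<rho> p)"
proof -
  interpret W: prob_space "weights_law \<rho>" by (rule prob_space_weights_law) fact
  have S: "sets (\<Pi>\<^sub>M p\<in>UNIV. expm (\<rho> p)) = sets borel_fun" by (intro sets_PiM_cong) auto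
  have comp: "distr (weights_law \<rho>) borel (\<lambda>w. w p) = expm (\<rho> p)" for p
  proof -
    have "distr (weights_law \<rho>) borel (\<lambda>w. w p) = distr (weights_law \<rho>) (expm (\<rho> p)) (\<lambda>w. w p)"
      by (intro distr_cong) auto
    then show ?thesis
      unfolding weights_law_def using distr_PiM_component[of UNIV "\<lambda>p. expm (\<rho> p)" p] pos
      by (simp add: prob_space_expm)
  qed
  then show "distr (weights_law \<rho>) borel (\<lambda>w. w p) = expm (\<rho> p)" .
  have "W.indep_vars (\<lambda>_. borel) (\<lambda>p w. w p) UNIV"
  proof (subst W.indep_vars_iff_distr_eq_PiM')
    have "distr (weights_law \<rho>) borel_fun (\<lambda>w. \<lambda>p\<in>UNIV. w p) = weights_law \<rho>"
      by (simp add: restrict_def distr_id2)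
    then show "distr (weights_law \<rho>) borel_fun (\<lambda>w. \<lambda>p\<in>UNIV. w p) =
        (\<Pi>\<^sub>M p\<in>UNIV. distr (weights_law \<rho>) borel (\<lambda>w. w p))"
      unfolding comp by (simp add: weights_law_def)
  qed auto
  then show "W.indep_vars (\<lambda>_. borel) (\<lambda>p w. w p) A" by (rule W.indep_vars_subset) simp
qed

lemma distr_zero_off_weights_law_cong:
  assumes "\<And>p. 0 < \<rho> p" "\<And>p. 0 < \<rho>' p" "\<And>p. p \<in> A \<Longrightarrow> \<rho> p = \<rho>' p"
  shows "distr (weights_law \<rho>) borel_fun (zero_off A) = distr (weights_law \<rho>') borel_fun (zero_off A)"
  using distr_zero_off_eq_weights_law[where M = "weights_law \<rho>" and X = "\<lambda>p w. w p" and A = A and \<rho> = \<rho>']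
    indep_vars_weights_law[of \<rho>] prob_space_weights_law[of \<rho>] assms by simp

lemma measurable_lpp:
  assumes "u \<le> v"
  shows "lpp u v \<in> borel_measurable borel_fun"
proof -
  obtain i j a b where uv: "u = (i, j)" "v = (a, b)" by fastforce
  then have "i \<le> a" "j \<le> b" using assms by auto
  then have "lpp (i, j) (a, b) \<in> borel_measurable borel_fun"
  proof (induction i j rule: lattice_induct)
    case (step i j)
    consider "i = a" "j = b" | "i < a" "j = b" | "i = a" "j < b" | "i < a" "j < b"
      using step.hyps by linarith
    then show ?case
    proof cases
      case 1
      then show ?thesis by (simp add: lpp_self[abs_def])
    next
      case 2
      have "lpp (i, b) (a, b) = (\<lambda>w. w (i, b) + lpp (i + 1, b) (a, b) w)"
        using 2 by (intro ext lpp_top)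
      then show ?thesis using step.IH(1) 2 by simp
    next
      case 3
      have "lpp (a, j) (a, b) = (\<lambda>w. w (a, j) + lpp (a, j + 1) (a, b) w)"
        using 3 by (intro ext lpp_right)
      then show ?thesis using step.IH(2) 3 by simp
    next
      case 4
      have "lpp (i, j) (a, b) = (\<lambda>w. w (i, j) + max (lpp (i + 1, j) (a, b) w) (lpp (i, j + 1) (a, b) w))"
        using 4 by (intro ext lpp_step)
      then show ?thesis using step.IH 4 by simp
    qed
  qed
  then show ?thesis using uv by simp
qed

text \<open>Subtracting the passage time from \<open>(1, 1)\<close> removes exactly what is not
  invariant: the common correction of an exchange of columns and the weight at the corner. Every
  increment is a difference of two members of the family.\<close>

definition incr_family :: "('q \<Rightarrow> int \<times> int) \<Rightarrow> ((int \<times> int) \<times> 'q) set \<Rightarrow>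
    (int \<times> int \<Rightarrow> real) \<Rightarrow> (int \<times> int) \<times> 'q \<Rightarrow> real" where
  "incr_family z S w = (\<lambda>(u, q)\<in>S. lpp u (z q) w - lpp (1, 1) (z q) w)"

abbreviation (input) grid :: "int \<Rightarrow> int \<Rightarrow> (int \<times> int) set" where
  "grid k l \<equiv> {1..k} \<times> {1..l}"

lemma measurable_incr_family:
  assumes "\<And>u q. (u, q) \<in> S \<Longrightarrow> u \<le> z q \<and> (1, 1) \<le> z q"
  shows "incr_family z S \<in> measurable borel_fun (borel_on S)"
  unfolding incr_family_def
  by (rule measurable_restrict) (use assms in \<open>auto intro!: borel_measurable_diff measurable_lpp split: prod.splits\<close>)

lemma incr_family_zero_off:
  assumes "\<And>u q. (u, q) \<in> S \<Longrightarrow> (1, 1) \<le> u \<and> u \<le> z q"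
    and "\<And>u q p. (u, q) \<in> S \<Longrightarrow> (1, 1) \<le> p \<Longrightarrow> p \<le> z q \<Longrightarrow> p \<noteq> z q \<Longrightarrow> p \<in> A"
  shows "incr_family z S (zero_off A w) = incr_family z S w"
proof -
  have "lpp u (z q) (zero_off A w) = lpp u (z q) w + (zero_off A w (z q) - w (z q))"
    if "(u', q) \<in> S" "(1, 1) \<le> u" "u \<le> z q" for u u' q
  proof -
    obtain i j a b where uz: "u = (i, j)" "z q = (a, b)" by fastforce
    then have "i \<le> a" "j \<le> b" "1 \<le> i" "1 \<le> j" using that by auto
    then show ?thesis
      unfolding uz using assms(2)[OF that(1)] uz by (intro lpp_weight_at_end) (auto simp: zero_off_def)
  qed
  note * = this
  show ?thesis
    unfolding incr_family_def
  proof (rule restrict_ext, clarify)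
    fix i j q assume S: "((i, j), q) \<in> S"
    then have "(1, 1) \<le> (i, j)" "(i, j) \<le> z q" using assms(1) by blast+
    then have "(1, 1) \<le> z q" by (rule order_trans)
    then show "lpp (i, j) (z q) (zero_off A w) - lpp (1, 1) (z q) (zero_off A w) = lpp (i, j) (z q) w - lpp (1, 1) (z q) w"
      using *[OF S, of "(i, j)"] *[OF S, of "(1, 1)"]
        \<open>(1, 1) \<le> (i, j)\<close> \<open>(i, j) \<le> z q\<close> by simp
  qed
qed

lemma distr_incr_family_cong:
  assumes S: "\<And>u q. (u, q) \<in> S \<Longrightarrow> (1, 1) \<le> u \<and> u \<le> z q"
    and pos: "\<And>p. 0 < \<rho> p" "\<And>p. 0 < \<rho>' p"
    and \<rho>: "\<And>u q p. (u, q) \<in> S \<Longrightarrow> (1, 1) \<le> p \<Longrightarrow> p \<le> z q \<Longrightarrow> p \<noteq> z q \<Longrightarrow> \<rho> p = \<rho>' p"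
  shows "distr (weights_law \<rho>) (borel_on S) (incr_family z S) =
    distr (weights_law \<rho>') (borel_on S) (incr_family z S)"
proof -
  define A where "A = {p. \<exists>u q. (u, q) \<in> S \<and> (1, 1) \<le> p \<and> p \<le> z q \<and> p \<noteq> z q}"
  have zero_off: "incr_family z S \<circ> zero_off A = incr_family z S"
    using incr_family_zero_off[of S z A] S unfolding A_def by (auto simp: fun_eq_iff comp_def)
  have m: "incr_family z S \<in> measurable borel_fun (borel_on S)"
    by (rule measurable_incr_family) (use S order_trans in blast)
  have "distr (weights_law \<rho>) (borel_on S) (incr_family z S) =
      distr (distr (weights_law \<rho>) borel_fun (zero_off A)) (borel_on S) (incr_family z S)" for \<rho>
    using m measurable_zero_off by (subst distr_distr) (auto simp: zero_off measurable_weights_law)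
  moreover have "distr (weights_law \<rho>) borel_fun (zero_off A) = distr (weights_law \<rho>') borel_fun (zero_off A)"
    using \<rho> pos unfolding A_def by (intro distr_zero_off_weights_law_cong) auto
  ultimately show ?thesis by metis
qed

section \<open>Environments with several corners and the move of one column\<close>

text \<open>
  Directions are indexed by \<open>{a..b}\<close>. The rate at the corners themselves would be 0; as increments
  towards a corner do not depend on its weight, nonpositive rates are replaced by 1.
\<close>

definition env_rate :: "int \<Rightarrow> int \<Rightarrow> int \<Rightarrow> int \<Rightarrow> (int \<Rightarrow> real) \<Rightarrow> int \<times> int \<Rightarrow> real" where
  "env_rate k l a b s = (\<lambda>(i, j).
     let c = (if i < k then 0 else - s (i - k + a)) + (if j < l then 1 else s (l + b - j))
     in if c > 0 then c else 1)"

definition env_corner :: "int \<Rightarrow> int \<Rightarrow> int \<Rightarrow> int \<Rightarrow> int \<Rightarrow> int \<times> int" where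
  "env_corner k l a b q = (k + q - a, l + b - q)"

definition env_law :: "int \<Rightarrow> int \<Rightarrow> int \<Rightarrow> int \<Rightarrow> (int \<Rightarrow> real) \<Rightarrow> ((int \<times> int) \<times> int) set \<Rightarrow>
    ((int \<times> int) \<times> int \<Rightarrow> real) measure" where
  "env_law k l a b s S =
     distr (weights_law (env_rate k l a b s)) (borel_on S) (incr_family (env_corner k l a b) S)"

lemma env_rate_pos: "0 < env_rate k l a b s p"
  by (simp add: env_rate_def Let_def split: prod.split)

text \<open>The column carrying \<open>s a\<close> has moved to the position \<open>k + p - a\<close>.\<close>

definition moved_rate :: "int \<Rightarrow> int \<Rightarrow> int \<Rightarrow> int \<Rightarrow> (int \<Rightarrow> real) \<Rightarrow> int \<Rightarrow> int \<times> int \<Rightarrow> real" where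
  "moved_rate k l a b s p = (\<lambda>(i, j).
     let c = (if i < k then 0 else if i < k + p - a then - s (i - k + a + 1)
         else if i = k + p - a then - s a else - s (i - k + a))
       + (if j < l then 1 else s (l + b - j))
     in if c > 0 then c else 1)"

text \<open>The moving column has overtaken the directions \<open>q \<le> p\<close>, which shifts
  their corners one column to the left. The rows stay in place.\<close>

definition moved_corner :: "int \<Rightarrow> int \<Rightarrow> int \<Rightarrow> int \<Rightarrow> int \<Rightarrow> int \<Rightarrow> int \<times> int" where
  "moved_corner k l a b p q = (if q \<le> p then k + q - a - 1 else k + q - a, l + b - q)"

lemma moved_rate_pos: "0 < moved_rate k l a b s p v"
  by (simp add: moved_rate_def Let_def split: prod.split)

text \<open>The additional exponential variable that starts the queue is found in the environment
  itself: in the row of the corner of direction \<open>p + 1\<close>, the site left of that corner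
  has rate \<open>s (p + 1) - s a\<close>, precisely the difference of the rates of the two columns.
  The exchange then runs through all rows below, down to row 1.\<close>

lemma moved_law_step:
  assumes kl: "1 \<le> k" "1 \<le> l" and p: "a \<le> p" "p < b"
    and s: "strict_mono_on {a..b} s" "s b < 1"
  defines "S \<equiv> grid k l \<times> {a + 1..b}"
  shows "distr (weights_law (moved_rate k l a b s p)) (borel_on S) (incr_family (moved_corner k l a b p) S) =
    distr (weights_law (moved_rate k l a b s (p + 1))) (borel_on S) (incr_family (moved_corner k l a b (p + 1)) S)"
proof -
  define c T where "c = k + p - a" and "T = l + b - (p + 1)"
  define n where "n = nat (T - 1)"
  have T: "1 \<le> T" "l \<le> T" "T - int n = 1" and c: "k \<le> c" using kl p by (auto simp: T_def c_def n_def)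
  let ?R = "moved_rate k l a b s p" and ?R' = "moved_rate k l a b s (p + 1)"
  let ?Z = "moved_corner k l a b p" and ?Z' = "moved_corner k l a b (p + 1)"
  let ?W = "column_swap c T n"
  have less: "s q < s q'" if "a \<le> q" "q < q'" "q' \<le> b" for q q'
    using strict_mono_onD[OF s(1)] that by auto
  have sa: "s a < s (p + 1)" "s (p + 1) < 1"
    using less[of a "p + 1"] less[of "p + 1" b] s(2) p by (simp, cases "p + 1 = b") auto
  \<comment> \<open>Below row \<open>T\<close> all row parameters exceed \<open>s (p + 1)\<close>,
    so these rates are the true differences of parameters and the default 1 does not occur.\<close>
  have rate: "?R (c, j) = ?R (c, T) + ?R (c + 1, j)" if "T - int n \<le> j" "j < T" for j
  proof -
    have \<beta>: "s (p + 1) < (if j < l then 1 else s (l + b - j))"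
      using less[of "p + 1" "l + b - j"] that p sa by (auto simp: T_def)
    then show ?thesis using sa that T c p
      by (auto simp: moved_rate_def c_def T_def Let_def)
  qed
  have S: "(1, 1) \<le> u \<and> u \<le> ?Z q \<and> u \<le> ?Z' q" if "(u, q) \<in> S" for u q
    using that by (auto simp: S_def moved_corner_def)
  have m: "incr_family ?Z S \<in> measurable borel_fun (borel_on S)"
    "incr_family ?Z' S \<in> measurable borel_fun (borel_on S)"
    by (rule measurable_incr_family, use S order_trans in blast)+
  have "\<exists>K. \<forall>i j. 1 \<le> i \<longrightarrow> i \<le> k \<longrightarrow> 1 \<le> j \<longrightarrow> j \<le> l \<longrightarrow> lpp (i, j) (?Z q) w = lpp (i, j) (?Z' q) (?W w) + K"
    if "q \<in> {a + 1..b}" for q w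
  proof -
    \<comment> \<open>Corners of directions \<open>q \<le> p\<close> lie to the left of both
      columns. The corner of direction \<open>p + 1\<close> is in row \<open>T\<close> on the right
      column. All other corners lie to the right of both columns and below row
      \<open>T\<close>.\<close>
    consider "q \<le> p" | "q = p + 1" | "q > p + 1" by linarith
    then show ?thesis
    proof cases
      case 1
      then show ?thesis using lpp_column_swap_left[of "k + q - a - 1" c _ _ "l + b - q" T n w] that
        by (intro exI[of _ 0]) (simp add: moved_corner_def c_def)
    next
      case 2
      have "?Z q = (c + 1, T)" "?Z' q = (c, T)"
        using 2 by (auto simp: moved_corner_def c_def T_def)
      then show ?thesis using lpp_column_swap_top[of _ c _ T n w] T c by auto
    next
      case 3
      then show ?thesis using lpp_column_swap_right[of c "k + q - a" "l + b - q" T _ _ n w] that T c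
        by (intro exI[of _ 0]) (simp add: moved_corner_def c_def T_def)
    qed
  qed
  then have swap: "incr_family ?Z S w = incr_family ?Z' S (?W w)" for w
    unfolding incr_family_def
  proof (intro restrict_ext, clarify)
    fix i j q assume "((i, j), q) \<in> S"
    then have ij: "1 \<le> i" "i \<le> k" "1 \<le> j" "j \<le> l" "q \<in> {a + 1..b}" by (auto simp: S_def)
    assume "\<And>q w. q \<in> {a + 1..b} \<Longrightarrow> \<exists>K. \<forall>i j. 1 \<le> i \<longrightarrow> i \<le> k \<longrightarrow> 1 \<le> j \<longrightarrow> j \<le> l \<longrightarrow>
        lpp (i, j) (?Z q) w = lpp (i, j) (?Z' q) (?W w) + K"
    from this[OF ij(5), of w] obtain K where "\<And>i j. 1 \<le> i \<Longrightarrow> i \<le> k \<Longrightarrow> 1 \<le> j \<Longrightarrow> j \<le> l \<Longrightarrow>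
        lpp (i, j) (?Z q) w = lpp (i, j) (?Z' q) (?W w) + K" by blast
    from this[of i j] this[of 1 1] show "lpp (i, j) (?Z q) w - lpp (1, 1) (?Z q) w =
        lpp (i, j) (?Z' q) (?W w) - lpp (1, 1) (?Z' q) (?W w)"
      using ij kl by simp
  qed
  have "distr (weights_law ?R) (borel_on S) (incr_family ?Z S) =
      distr (weights_law ?R) (borel_on S) (incr_family ?Z' S \<circ> ?W)"
    by (intro arg_cong[where f = "distr _ _"] ext) (simp only: swap comp_apply)
  also have "\<dots> = distr (distr (weights_law ?R) borel_fun ?W) (borel_on S) (incr_family ?Z' S)"
    using m measurable_column_swap by (intro distr_distr[symmetric]) (auto simp: measurable_weights_law)
  also have "distr (weights_law ?R) borel_fun ?W = weights_law (swapped_rates c T n ?R)"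
    by (rule distr_column_swap) (use rate moved_rate_pos in auto)
  also have "distr (weights_law (swapped_rates c T n ?R)) (borel_on S) (incr_family ?Z' S) =
      distr (weights_law ?R') (borel_on S) (incr_family ?Z' S)"
  proof (rule distr_incr_family_cong)
    fix u q v assume uq: "(u, q) \<in> S" and v: "(1, 1) \<le> v" "v \<le> ?Z' q" "v \<noteq> ?Z' q"
    obtain i j where ij: "v = (i, j)" by fastforce
    have q: "a + 1 \<le> q" "q \<le> b" using uq by (auto simp: S_def)
    \<comment> \<open>From column \<open>c\<close> on, the rectangles below the new corners contain
      only sites below row \<open>T\<close>, apart from the corner \<open>(c, T)\<close> itself.
      Hence it is harmless that the two columns keep their old rates from row \<open>T\<close>
      upwards.\<close>
    have row: "T - int n \<le> j \<and> j < T" if "c \<le> i"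
      using that v q p T(3) unfolding ij moved_corner_def c_def T_def
      by (auto split: if_splits)
    show "swapped_rates c T n ?R v = ?R' v"
    proof (cases "i = c \<or> i = c + 1")
      case True
      then have "T - int n \<le> j \<and> j < T" using row by auto
      then show ?thesis using True c p unfolding ij swapped_rates_def moved_rate_def c_def
        by (auto simp: Let_def add.commute)
    next
      case False
      then show ?thesis using c p unfolding ij swapped_rates_def moved_rate_def c_def
        by (auto simp: Let_def)
    qed
  next
    show "0 < swapped_rates c T n ?R v" for v
      by (auto simp: swapped_rates_def moved_rate_pos split: prod.split)
  qed (use S moved_rate_pos in auto)
  finally show ?thesis .
qed

section \<open>Removing directions and shrinking the bulk\<close>

lemma distr_incr_family_restrict:
  assumes "S' \<subseteq> S"
    and S: "\<And>u q. (u, q) \<in> S \<Longrightarrow> u \<le> z q \<and> (1, 1) \<le> z q" "\<And>u q. (u, q) \<in> S \<Longrightarrow> u \<le> z' q \<and> (1, 1) \<le> z' q"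
    and eq: "distr (weights_law \<rho>) (borel_on S) (incr_family z S) =
      distr (weights_law \<rho>') (borel_on S) (incr_family z' S)"
  shows "distr (weights_law \<rho>) (\<Pi>\<^sub>M i\<in>S'. borel) (incr_family z S') =
    distr (weights_law \<rho>') (\<Pi>\<^sub>M i\<in>S'. borel) (incr_family z' S')"
proof -
  let ?f = "\<lambda>x. restrict x S' :: _ \<Rightarrow> real"
  have f: "?f \<in> measurable (borel_on S) (\<Pi>\<^sub>M i\<in>S'. borel)"
    using assms(1) by (rule measurable_restrict_subset)
  have 1: "incr_family z S' = ?f \<circ> incr_family z S" for z
    using assms(1) by (auto simp: incr_family_def fun_eq_iff restrict_def)
  have 2: "distr (weights_law \<rho>) (\<Pi>\<^sub>M i\<in>S'. borel) (incr_family z S') =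
      distr (distr (weights_law \<rho>) (borel_on S) (incr_family z S)) (\<Pi>\<^sub>M i\<in>S'. borel) ?f"
    if "\<And>u q. (u, q) \<in> S \<Longrightarrow> u \<le> z q \<and> (1, 1) \<le> z q" for \<rho> z
    unfolding 1 using f measurable_incr_family[of S z] that
    by (intro distr_distr[symmetric]) (auto simp: measurable_weights_law)
  show ?thesis using 2[of z \<rho>] 2[of z' \<rho>'] S eq by simp
qed

lemma env_law_cong:
  assumes "1 \<le> k" "1 \<le> l" "S \<subseteq> grid k l \<times> {a..b}" "\<And>q. q \<in> {a..b} \<Longrightarrow> s q = s' q"
  shows "env_law k l a b s S = env_law k l a b s' S"
  unfolding env_law_def
proof (rule distr_incr_family_cong)
  fix u q p assume "(u, q) \<in> S" and p: "(1, 1) \<le> p" "p \<le> env_corner k l a b q" "p \<noteq> env_corner k l a b q"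
  then have "q \<in> {a..b}" using assms(3) by auto
  then show "env_rate k l a b s p = env_rate k l a b s' p"
    using p by (cases p) (auto simp: env_rate_def env_corner_def Let_def assms(4))
next
  fix u q assume "(u, q) \<in> S"
  then have "(u, q) \<in> grid k l \<times> {a..b}" using assms(3) by blast
  then show "(1, 1) \<le> u \<and> u \<le> env_corner k l a b q" by (auto simp: env_corner_def)
qed (simp_all add: env_rate_pos)

lemma env_law_restrict:
  assumes "1 \<le> k'" "1 \<le> l'" "k' \<le> k" "l' \<le> l"
    and "env_law k l a b s S = env_law k' l' a' b' s' S"
    and "S \<subseteq> grid k' l' \<times> {q. a \<le> q \<and> q \<le> b \<and> a' \<le> q \<and> q \<le> b'}" "S' \<subseteq> S"
  shows "env_law k l a b s S' = env_law k' l' a' b' s' S'"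
  unfolding env_law_def
  by (rule distr_incr_family_restrict[OF assms(7)])
     (use assms(1-4,6) assms(5)[unfolded env_law_def] in \<open>auto simp: env_corner_def\<close>)

text \<open>The column of direction \<open>a\<close> travels to the right past all others. In its
  final position it lies beyond every remaining corner and no longer influences any increment of the
  family.\<close>

lemma env_law_drop_first:
  assumes kl: "1 \<le> k" "1 \<le> l" and ab: "a \<le> b" and s: "strict_mono_on {a..b} s" "s b < 1"
    and S: "S \<subseteq> grid k l \<times> {a + 1..b}"
  shows "env_law k l a b s S = env_law k l (a + 1) b s S"
proof -
  let ?S = "grid k l \<times> {a + 1..b}"
  let ?law = "\<lambda>p. distr (weights_law (moved_rate k l a b s p)) (borel_on ?S) (incr_family (moved_corner k l a b p) ?S)"
  have "?law a = ?law p" if "a \<le> p" "p \<le> b" for p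
    using that
  proof (induction p rule: int_ge_induct)
    case (step p)
    then show ?case using moved_law_step[OF kl _ _ s, of p] by simp
  qed simp
  then have law: "?law a = ?law b" using ab by simp
  have "moved_rate k l a b s a = env_rate k l a b s"
    by (auto simp: moved_rate_def env_rate_def fun_eq_iff Let_def)
  moreover have "incr_family (moved_corner k l a b a) ?S = incr_family (env_corner k l a b) ?S"
    unfolding incr_family_def by (intro ext restrict_cong refl)
      (auto simp: moved_corner_def env_corner_def)
  moreover have "incr_family (moved_corner k l a b b) ?S = incr_family (env_corner k l (a + 1) b) ?S"
    unfolding incr_family_def by (intro ext restrict_cong refl)
      (auto simp: moved_corner_def env_corner_def algebra_simps)
  moreover have "distr (weights_law (moved_rate k l a b s b)) (borel_on ?S) (incr_family (env_corner k l (a + 1) b) ?S) =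
      distr (weights_law (env_rate k l (a + 1) b s)) (borel_on ?S) (incr_family (env_corner k l (a + 1) b) ?S)"
  proof (rule distr_incr_family_cong)
    fix u q p assume "(u, q) \<in> ?S" and p: "p \<le> env_corner k l (a + 1) b q"
    then have "q \<le> b" by auto
    then show "moved_rate k l a b s b p = env_rate k l (a + 1) b s p"
      using p by (cases p) (auto simp: moved_rate_def env_rate_def env_corner_def Let_def algebra_simps)
  qed (auto simp: moved_rate_pos env_rate_pos env_corner_def)
  ultimately have "env_law k l a b s ?S = env_law k l (a + 1) b s ?S"
    using law by (simp add: env_law_def)
  then show ?thesis by (rule env_law_restrict[OF kl order_refl order_refl]) (use S in auto)
qed

lemma distr_weights_law_swap:
  assumes "\<And>p. 0 < \<rho> p"
  shows "distr (weights_law \<rho>) borel_fun (\<lambda>w p. w (prod.swap p)) = weights_law (\<lambda>p. \<rho> (prod.swap p))"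
proof -
  have "distr (weights_law \<rho>) (weights_law (\<lambda>p. \<rho> (prod.swap p))) (\<lambda>w. \<lambda>p\<in>UNIV. w (prod.swap p)) =
      weights_law (\<lambda>p. \<rho> (prod.swap p))"
    unfolding weights_law_def
    by (rule distr_PiM_reindex) (auto intro: prob_space_expm assms injI simp: prod_eq_iff)
  moreover have "distr (weights_law \<rho>) (weights_law (\<lambda>p. \<rho> (prod.swap p))) (\<lambda>w. \<lambda>p\<in>UNIV. w (prod.swap p)) =
      distr (weights_law \<rho>) borel_fun (\<lambda>w p. w (prod.swap p))"
    by (intro distr_cong) auto
  ultimately show ?thesis by simp
qed

definition transpose_index :: "(int \<times> int) \<times> int \<Rightarrow> (int \<times> int) \<times> int" where
  "transpose_index = (\<lambda>(u, q). (prod.swap u, - q))"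

text \<open>Reflection in the diagonal turns row parameters \<open>s\<close> into column parameters.
  Moving the constant 1 between rows and columns leaves every rate unchanged and restores the
  standard form with \<open>1 - s\<close>; reversing the sign of the index makes the new parameters
  increasing again.\<close>

lemma env_law_transpose:
  assumes kl: "1 \<le> k" "1 \<le> l" and S: "S \<subseteq> grid k l \<times> {a..b}"
  shows "env_law k l a b s S =
    distr (env_law l k (- b) (- a) (\<lambda>q. 1 - s (- q)) (transpose_index ` S)) (borel_on S)
      (\<lambda>x. \<lambda>i\<in>S. x (transpose_index i))"
proof -
  let ?S = "transpose_index ` S" and ?s = "\<lambda>q. 1 - s (- q)"
  let ?z = "env_corner k l a b" and ?z' = "env_corner l k (- b) (- a)"
  let ?\<Phi> = "\<lambda>x. \<lambda>i\<in>S. x (transpose_index i) :: real" and ?t = "\<lambda>w p. w (prod.swap p) :: real"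
  have \<Phi>: "?\<Phi> \<in> measurable (borel_on ?S) (borel_on S)"
    by (rule measurable_restrict) simp
  have t: "?t \<in> measurable borel_fun borel_fun"
    by (rule measurable_PiM_single') (auto simp: space_PiM PiE_UNIV_domain)
  have S': "u \<le> ?z' q \<and> (1, 1) \<le> ?z' q" if "(u, q) \<in> ?S" for u q
    using that S kl by (auto simp: transpose_index_def env_corner_def)
  have m: "incr_family ?z' ?S \<in> measurable borel_fun (borel_on ?S)"
    by (rule measurable_incr_family) (rule S')
  have rate: "(\<lambda>p. env_rate k l a b s (prod.swap p)) = env_rate l k (- b) (- a) ?s"
    by (auto simp: env_rate_def fun_eq_iff Let_def algebra_simps)
  have incr: "incr_family ?z S = ?\<Phi> \<circ> (incr_family ?z' ?S \<circ> ?t)"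
  proof (intro ext)
    fix w i
    show "incr_family ?z S w i = (?\<Phi> \<circ> (incr_family ?z' ?S \<circ> ?t)) w i"
    proof (cases "i \<in> S")
      case True
      obtain x y q where i: "i = ((x, y), q)" by (metis prod.collapse)
      with True S have b: "1 \<le> x" "x \<le> k" "1 \<le> y" "y \<le> l" "a \<le> q" "q \<le> b" by auto
      have z: "?z q = (k + q - a, l + b - q)" "?z' (- q) = (l + b - q, k + q - a)"
        by (simp_all add: env_corner_def)
      have "lpp (x, y) (?z q) w = lpp (y, x) (?z' (- q)) (?t w)"
        unfolding z by (rule lpp_transpose) (use b kl in auto)
      moreover have "lpp (1, 1) (?z q) w = lpp (1, 1) (?z' (- q)) (?t w)"
        unfolding z by (rule lpp_transpose) (use b kl in auto)
      moreover have "((y, x), - q) \<in> ?S"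
        using True unfolding i by (force simp: transpose_index_def)
      ultimately show ?thesis using True unfolding i
        by (simp add: incr_family_def transpose_index_def)
    qed (simp add: incr_family_def)
  qed
  have "env_law k l a b s S = distr (weights_law (env_rate k l a b s)) (borel_on S) (?\<Phi> \<circ> (incr_family ?z' ?S \<circ> ?t))"
    unfolding env_law_def by (simp only: incr)
  also have "\<dots> = distr (distr (weights_law (env_rate k l a b s)) (borel_on ?S) (incr_family ?z' ?S \<circ> ?t)) (borel_on S) ?\<Phi>"
    using \<Phi> measurable_comp[OF t m] by (intro distr_distr[symmetric]) (auto simp: measurable_weights_law)
  also have "distr (weights_law (env_rate k l a b s)) (borel_on ?S) (incr_family ?z' ?S \<circ> ?t) =
      distr (distr (weights_law (env_rate k l a b s)) borel_fun ?t) (borel_on ?S) (incr_family ?z' ?S)"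
    using t m by (intro distr_distr[symmetric]) (auto simp: measurable_weights_law)
  also have "distr (weights_law (env_rate k l a b s)) borel_fun ?t = weights_law (env_rate l k (- b) (- a) ?s)"
    unfolding rate[symmetric] by (rule distr_weights_law_swap) (rule env_rate_pos)
  finally show ?thesis unfolding env_law_def .
qed

text \<open>The last row of parameters is the first column of parameters of the reflected
  environment.\<close>

lemma env_law_drop_last:
  assumes kl: "1 \<le> k" "1 \<le> l" and ab: "a \<le> b" and s: "strict_mono_on {a..b} s" "0 < s a"
    and S: "S \<subseteq> grid k l \<times> {a..b - 1}"
  shows "env_law k l a b s S = env_law k l a (b - 1) s S"
proof -
  let ?s = "\<lambda>q. 1 - s (- q)"
  have "env_law l k (- b) (- a) ?s (transpose_index ` S) = env_law l k (- b + 1) (- a) ?s (transpose_index ` S)"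
  proof (rule env_law_drop_first)
    show "strict_mono_on {- b..- a} ?s"
      by (rule strict_mono_onI) (use strict_mono_onD[OF s(1)] in simp)
    show "transpose_index ` S \<subseteq> grid l k \<times> {- b + 1..- a}"
      using S by (force simp: transpose_index_def)
  qed (use kl ab s in auto)
  moreover have "S \<subseteq> grid k l \<times> {a..b}" using S by auto
  moreover have "- b + 1 = - (b - 1)" by simp
  ultimately show ?thesis
    using env_law_transpose[OF kl, of S a b s] env_law_transpose[OF kl S, of s] by metis
qed

text \<open>
  A column of bulk rate 1 is the column of an additional direction with parameter 0, and a row of
  bulk rate 1 is the row of an additional direction with parameter 1.
\<close>

lemma env_law_drop_column:
  assumes kl: "1 \<le> k" "1 \<le> l" and ab: "a \<le> b" and s: "strict_mono_on {a..b} s" "0 < s a" "s b < 1"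
    and S: "S \<subseteq> grid k l \<times> {a..b}"
  shows "env_law (k + 1) l a b s S = env_law k l a b s S"
proof -
  define s' where "s' = s(a - 1 := 0)"
  have "env_law (k + 1) l a b s S = env_law (k + 1) l a b s' S"
    using kl S by (intro env_law_cong) (auto simp: s'_def)
  also have "\<dots> = env_law k l (a - 1) b s' S"
  proof -
    have "env_corner (k + 1) l a b = env_corner k l (a - 1) b"
      by (auto simp: env_corner_def fun_eq_iff)
    moreover have "env_rate (k + 1) l a b s' = env_rate k l (a - 1) b s'"
      by (auto simp: env_rate_def fun_eq_iff Let_def s'_def algebra_simps)
    ultimately show ?thesis by (simp add: env_law_def)
  qed
  also have "\<dots> = env_law k l (a - 1 + 1) b s' S"
  proof (rule env_law_drop_first[OF kl])
    show "strict_mono_on {a - 1..b} s'"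
    proof (rule strict_mono_onI)
      fix x y assume xy: "x \<in> {a - 1..b}" "y \<in> {a - 1..b}" "x < y"
      have "s a \<le> s y" using strict_mono_onD[OF s(1), of a y] xy by (cases "a = y") auto
      then show "s' x < s' y" using xy s strict_mono_onD[OF s(1), of x y] by (auto simp: s'_def)
    qed
  qed (use S ab s in \<open>auto simp: s'_def\<close>)
  also have "\<dots> = env_law k l a b s S"
    using kl S env_law_cong[OF kl S, of s' s] by (auto simp: s'_def)
  finally show ?thesis .
qed

lemma env_law_drop_row:
  assumes kl: "1 \<le> k" "1 \<le> l" and ab: "a \<le> b" and s: "strict_mono_on {a..b} s" "0 < s a" "s b < 1"
    and S: "S \<subseteq> grid k l \<times> {a..b}"
  shows "env_law k (l + 1) a b s S = env_law k l a b s S"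
proof -
  define s' where "s' = s(b + 1 := 1)"
  have "env_law k (l + 1) a b s S = env_law k (l + 1) a b s' S"
    using kl S by (intro env_law_cong) (auto simp: s'_def)
  also have "\<dots> = env_law k l a (b + 1) s' S"
  proof -
    have "env_corner k (l + 1) a b = env_corner k l a (b + 1)"
      by (auto simp: env_corner_def fun_eq_iff)
    moreover have "env_rate k (l + 1) a b s' = env_rate k l a (b + 1) s'"
      by (auto simp: env_rate_def fun_eq_iff Let_def s'_def algebra_simps)
    ultimately show ?thesis by (simp add: env_law_def)
  qed
  also have "\<dots> = env_law k l a (b + 1 - 1) s' S"
  proof (rule env_law_drop_last[OF kl])
    show "strict_mono_on {a..b + 1} s'"
    proof (rule strict_mono_onI)
      fix x y assume xy: "x \<in> {a..b + 1}" "y \<in> {a..b + 1}" "x < y"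
      have "s x \<le> s b" using strict_mono_onD[OF s(1), of x b] xy by (cases "x = b") auto
      then show "s' x < s' y" using xy s strict_mono_onD[OF s(1), of x y] by (auto simp: s'_def)
    qed
  qed (use S ab s in \<open>auto simp: s'_def\<close>)
  also have "\<dots> = env_law k l a b s S"
    using kl S env_law_cong[OF kl S, of s' s] by (auto simp: s'_def)
  finally show ?thesis .
qed

lemma env_law_shrink_box:
  assumes kl: "1 \<le> k" "1 \<le> l" "k \<le> k'" "l \<le> l'" and ab: "a \<le> b"
    and s: "strict_mono_on {a..b} s" "0 < s a" "s b < 1"
    and S: "S \<subseteq> grid k l \<times> {a..b}"
  shows "env_law k' l' a b s S = env_law k l a b s S"
proof -
  have "env_law k' l' a b s S = env_law k l' a b s S"
    using kl(3)
  proof (induction k' rule: int_ge_induct)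
    case (step i)
    have grid_step: "S \<subseteq> grid i l' \<times> {a..b}" using S step.hyps kl by fastforce
    have "env_law (i + 1) l' a b s S = env_law i l' a b s S"
      by (rule env_law_drop_column) (use step.hyps kl ab s grid_step in auto)
    then show ?case using step.IH by simp
  qed simp
  also have "\<dots> = env_law k l a b s S"
    using kl(4)
  proof (induction l' rule: int_ge_induct)
    case (step i)
    have grid_step: "S \<subseteq> grid k i \<times> {a..b}" using S step.hyps kl by fastforce
    have "env_law k (i + 1) a b s S = env_law k i a b s S"
      by (rule env_law_drop_row) (use step.hyps kl ab s grid_step in auto)
    then show ?case using step.IH by simp
  qed simp
  finally show ?thesis .
qed

text \<open>Reduction to the stationary model: around the bulk there remain only a top row of rate
  \<open>s q\<close> and a right column of rate \<open>1 - s q\<close>, meeting in the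
  corner.\<close>

lemma env_law_single:
  assumes kl: "1 \<le> k" "1 \<le> l" and q: "a \<le> q" "q \<le> b"
    and s: "strict_mono_on {a..b} s" "0 < s a" "s b < 1"
    and S: "S \<subseteq> grid k l \<times> {q}"
  shows "env_law k l a b s S = env_law k l q q s S"
proof -
  have mono: "strict_mono_on A s" if "A \<subseteq> {a..b}" for A
    using s(1) that by (rule monotone_on_subset)
  have pos: "0 < s q"
    using strict_mono_onD[OF s(1), of a q] q s(2) by (cases "a = q") auto
  have "env_law k l a b s S = env_law k l a' b s S" if "a \<le> a'" "a' \<le> q" for a'
    using that
  proof (induction a' rule: int_ge_induct)
    case (step i)
    have "env_law k l i b s S = env_law k l (i + 1) b s S"
      by (rule env_law_drop_first[OF kl]) (use step q s S in \<open>auto intro!: mono\<close>)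
    then show ?case using step by simp
  qed simp
  then have "env_law k l a b s S = env_law k l q b s S" using q by simp
  also have "env_law k l q b s S = env_law k l q b' s S" if "b' \<le> b" "q \<le> b'" for b'
    using that
  proof (induction b' rule: int_le_induct)
    case (step i)
    have "env_law k l q i s S = env_law k l q (i - 1) s S"
      by (rule env_law_drop_last[OF kl]) (use step q pos S in \<open>auto intro!: mono\<close>)
    then show ?case using step by simp
  qed simp
  from this[of q] have "env_law k l q b s S = env_law k l q q s S" using q by simp
  finally show ?thesis .
qed

section \<open>Concentration and exit points in a single direction\<close>

lemma distributed_weights_law:
  assumes pos: "\<And>p. 0 < \<rho> p"
  shows "distributed (weights_law \<rho>) lborel (\<lambda>w. w p) (exponential_density (\<rho> p))"
proof -
  have "distr (weights_law \<rho>) lborel (\<lambda>w. w p) = distr (weights_law \<rho>) borel (\<lambda>w. w p)"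
    by (rule distr_cong) auto
  then show ?thesis
    using indep_vars_weights_law(2)[of \<rho> p] pos
    by (auto simp: distributed_def expm_def measurable_weights_law)
qed

text \<open>Chebyshev's inequality: a nonempty sum is Erlang distributed with mean
  \<open>card T / c\<close> and variance \<open>card T / c\<^sup>2\<close>.\<close>

lemma weights_law_sum_deviation:
  assumes pos: "\<And>p. 0 < \<rho> p" and "finite T" and T: "\<And>p. p \<in> T \<Longrightarrow> \<rho> p = c" and "0 < c" "0 < x"
  shows "measure (weights_law \<rho>) {w. x \<le> \<bar>(\<Sum>p\<in>T. w p) - card T / c\<bar>} \<le> card T / (c\<^sup>2 * x\<^sup>2)"
proof (cases "T = {}")
  case True
  then show ?thesis using assms(5) by simp
next
  case False
  interpret W: prob_space "weights_law \<rho>" by (rule prob_space_weights_law) fact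
  let ?X = "\<lambda>w. \<Sum>p\<in>T. w p"
  have "1 \<le> card T" using False assms(2) by (simp add: Suc_le_eq card_gt_0_iff)
  then have card: "real (card T - 1) + 1 = card T" by (simp add: of_nat_diff)
  have D: "distributed (weights_law \<rho>) lborel ?X (erlang_density (card T - 1) c)"
  proof (rule W.exponential_distributed_sum[OF assms(2) False assms(4)])
    fix p assume "p \<in> T"
    then show "distributed (weights_law \<rho>) lborel (\<lambda>w. w p) (exponential_density c)"
      using distributed_weights_law[of \<rho> p, OF pos] T by simp
  qed (rule indep_vars_weights_law(1)[OF pos])
  have "W.expectation ?X = card T / c"
    using W.erlang_ith_moment[OF assms(4) D, of 1] \<open>1 \<le> card T\<close> assms(4)
    by (cases "card T") simp_all
  then have var: "(\<integral>w. (?X w - card T / c)\<^sup>2 \<partial>weights_law \<rho>) = card T / c\<^sup>2"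
    using W.erlang_distributed_variance[OF assms(4) D] card by simp
  have int: "integrable (weights_law \<rho>) ?X" "integrable (weights_law \<rho>) (\<lambda>w. (?X w)\<^sup>2)"
    using W.erlang_ith_moment_integrable[OF assms(4) D, of 1]
      W.erlang_ith_moment_integrable[OF assms(4) D, of 2] by simp_all
  have "integrable (weights_law \<rho>) (\<lambda>w. (?X w)\<^sup>2 - 2 * (card T / c) * ?X w + (card T / c)\<^sup>2)"
    using int by simp
  then have int2: "integrable (weights_law \<rho>) (\<lambda>w. (?X w - card T / c)\<^sup>2)"
    by (simp add: power2_eq_square algebra_simps)
  have "{w. x \<le> \<bar>?X w - card T / c\<bar>} = {w \<in> space (weights_law \<rho>). x\<^sup>2 \<le> (?X w - card T / c)\<^sup>2}"
    using assms(5) by (auto simp: abs_le_square_iff[symmetric])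
  then have "measure (weights_law \<rho>) {w. x \<le> \<bar>?X w - card T / c\<bar>} \<le>
      (\<integral>w. (?X w - card T / c)\<^sup>2 \<partial>weights_law \<rho>) / x\<^sup>2"
    using integral_Markov_inequality_measure[OF int2, of "{}" "x\<^sup>2"] assms(5) by simp
  then show ?thesis by (simp add: var)
qed

lemma lpp_row_sum: "i \<le> a \<Longrightarrow> lpp (i, b) (a, b) w = (\<Sum>p\<in>{i..a} \<times> {b}. w p)"
proof (induction "nat (a - i)" arbitrary: i)
  case 0
  then show ?case by simp
next
  case (Suc n)
  then have "{i..a} \<times> {b} = insert (i, b) ({i + 1..a} \<times> {b})" by auto
  then show ?case using Suc.hyps(1)[of "i + 1"] Suc by (simp add: lpp_top)
qed

lemma lpp_column_sum: "j \<le> b \<Longrightarrow> lpp (a, j) (a, b) w = (\<Sum>p\<in>{a} \<times> {j..b}. w p)"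
proof (induction "nat (b - j)" arbitrary: j)
  case 0
  then show ?case by simp
next
  case (Suc n)
  then have "{a} \<times> {j..b} = insert (a, j) ({a} \<times> {j + 1..b})" by auto
  then show ?case using Suc.hyps(1)[of "j + 1"] Suc by (simp add: lpp_right)
qed

lemma env_law_vimage:
  assumes "(u, q) \<in> S" "(u', q) \<in> S" and S: "\<And>u q. (u, q) \<in> S \<Longrightarrow> u \<le> env_corner k l a b q \<and> (1, 1) \<le> env_corner k l a b q"
    and B: "B \<in> sets borel"
  shows "measure (env_law k l a b s S) {x \<in> space (borel_on S). x (u, q) - x (u', q) \<in> B} =
    measure (weights_law (env_rate k l a b s))
      {w. lpp u (env_corner k l a b q) w - lpp u' (env_corner k l a b q) w \<in> B}"
proof -
  have m: "(\<lambda>x. x (u, q) - x (u', q)) \<in> borel_measurable (borel_on S :: (_ \<Rightarrow> real) measure)"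
    using assms(1,2) by measurable
  have A: "{x \<in> space (borel_on S). x (u, q) - x (u', q) \<in> B} \<in> sets (borel_on S :: (_ \<Rightarrow> real) measure)"
    using measurable_sets[OF m B] by (simp add: vimage_def Int_def conj_commute)
  have "incr_family (env_corner k l a b) S \<in> measurable (weights_law (env_rate k l a b s)) (borel_on S)"
    unfolding measurable_weights_law by (rule measurable_incr_family) (rule S)
  from measure_distr[OF this A] show ?thesis
    unfolding env_law_def using assms(1,2)
    by (simp add: vimage_def incr_family_def space_PiM)
qed

text \<open>The law of an increment along row \<open>j\<close> does not depend on the height of the
  box, which may therefore be cut off at row \<open>j\<close>. There the difference of passage times
  is simply a sum of independent weights of rate \<open>s q\<close>; the corner occurs in both terms
  and cancels.\<close>

lemma single_env_row_deviation:
  assumes ij: "1 \<le> i" "i \<le> k" "1 \<le> j" "j \<le> l" and s: "0 < s q" "s q < 1" and x: "0 < x"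
  shows "measure (weights_law (env_rate k l q q s))
      {w. x \<le> \<bar>lpp (i, j) (k, l) w - lpp (k, j) (k, l) w - (k - i) / s q\<bar>} \<le> (k - i) / ((s q)\<^sup>2 * x\<^sup>2)"
proof -
  define S where "S = {((i, j), q), ((k, j), q)}"
  define B where "B = {t. x \<le> \<bar>t - (k - i) / s q\<bar>}"
  have B: "B \<in> sets borel" unfolding B_def by measurable
  have S: "((i, j), q) \<in> S" "((k, j), q) \<in> S" by (auto simp: S_def)
  have "measure (weights_law (env_rate k l q q s)) {w. lpp (i, j) (env_corner k l q q q) w - lpp (k, j) (env_corner k l q q q) w \<in> B} =
      measure (env_law k l q q s S) {x \<in> space (borel_on S). x ((i, j), q) - x ((k, j), q) \<in> B}"
    by (rule env_law_vimage[OF S _ B, symmetric]) (use ij in \<open>auto simp: S_def env_corner_def\<close>)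
  also have "env_law k l q q s S = env_law k j q q s S"
    by (rule env_law_shrink_box) (use ij s in \<open>auto simp: S_def monotone_on_def\<close>)
  also have "measure (env_law k j q q s S) {x \<in> space (borel_on S). x ((i, j), q) - x ((k, j), q) \<in> B} =
      measure (weights_law (env_rate k j q q s)) {w. lpp (i, j) (env_corner k j q q q) w - lpp (k, j) (env_corner k j q q q) w \<in> B}"
    by (rule env_law_vimage[OF S _ B]) (use ij in \<open>auto simp: S_def env_corner_def\<close>)
  also have "{w. lpp (i, j) (env_corner k j q q q) w - lpp (k, j) (env_corner k j q q q) w \<in> B} =
      {w. x \<le> \<bar>(\<Sum>p\<in>{i..k - 1} \<times> {j}. w p) - card ({i..k - 1} \<times> {j}) / s q\<bar>}"
  proof -
    have "lpp (i, j) (k, j) w - lpp (k, j) (k, j) w = (\<Sum>p\<in>{i..k - 1} \<times> {j}. w p)" for w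
    proof (cases "i = k")
      case False
      then show ?thesis
        using ij lpp_last_top[of i "k - 1" j w] lpp_row_sum[of i "k - 1" j w] by simp
    qed simp
    moreover have "real (card ({i..k - 1} \<times> {j})) = k - i" using ij by (simp add: card_cartesian_product)
    ultimately show ?thesis by (simp add: B_def env_corner_def)
  qed
  also have "measure (weights_law (env_rate k j q q s)) \<dots> \<le> card ({i..k - 1} \<times> {j}) / ((s q)\<^sup>2 * x\<^sup>2)"
    by (rule weights_law_sum_deviation) (use s x env_rate_pos in \<open>auto simp: env_rate_def\<close>)
  also have "real (card ({i..k - 1} \<times> {j})) = k - i" using ij by (simp add: card_cartesian_product)
  finally show ?thesis by (simp add: B_def env_corner_def)
qed

lemma single_env_column_deviation:
  assumes j: "j \<le> l" and s: "0 < s q" "s q < 1" and x: "0 < x"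
  shows "measure (weights_law (env_rate k l q q s))
      {w. x \<le> \<bar>lpp (k, j) (k, l) w - w (k, l) - (l - j) / (1 - s q)\<bar>} \<le> (l - j) / ((1 - s q)\<^sup>2 * x\<^sup>2)"
proof -
  have "lpp (k, j) (k, l) w - w (k, l) = (\<Sum>p\<in>{k} \<times> {j..l - 1}. w p)" for w
  proof (cases "j = l")
    case False
    then show ?thesis
      using j lpp_last_right[of j "l - 1" k w] lpp_column_sum[of j "l - 1" k w] by simp
  qed simp
  moreover have card: "real (card ({k} \<times> {j..l - 1})) = l - j" using j by (simp add: card_cartesian_product)
  moreover have "measure (weights_law (env_rate k l q q s))
      {w. x \<le> \<bar>(\<Sum>p\<in>{k} \<times> {j..l - 1}. w p) - card ({k} \<times> {j..l - 1}) / (1 - s q)\<bar>} \<le>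
      card ({k} \<times> {j..l - 1}) / ((1 - s q)\<^sup>2 * x\<^sup>2)"
    by (rule weights_law_sum_deviation) (use s x env_rate_pos in \<open>auto simp: env_rate_def\<close>)
  ultimately show ?thesis by simp
qed

text \<open>The passage time is the increment along row \<open>j\<close> plus the sum over the right
  column. A deviation by \<open>2 * x\<close> forces a deviation by \<open>x\<close> in one of the
  two.\<close>

lemma single_env_deviation:
  assumes ij: "1 \<le> i" "i \<le> k" "1 \<le> j" "j \<le> l" and s: "0 < s q" "s q < 1" and x: "0 < x"
  shows "measure (weights_law (env_rate k l q q s))
      {w. 2 * x \<le> \<bar>lpp (i, j) (k, l) w - w (k, l) - ((k - i) / s q + (l - j) / (1 - s q))\<bar>} \<le>
    (k - i) / ((s q)\<^sup>2 * x\<^sup>2) + (l - j) / ((1 - s q)\<^sup>2 * x\<^sup>2)"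
proof -
  let ?W = "weights_law (env_rate k l q q s)"
  interpret W: prob_space ?W by (rule prob_space_weights_law) (rule env_rate_pos)
  let ?A = "{w. x \<le> \<bar>lpp (i, j) (k, l) w - lpp (k, j) (k, l) w - (k - i) / s q\<bar>}"
  let ?B = "{w. x \<le> \<bar>lpp (k, j) (k, l) w - w (k, l) - (l - j) / (1 - s q)\<bar>}"
  have [measurable]: "lpp (i, j) (k, l) \<in> borel_measurable ?W" "lpp (k, j) (k, l) \<in> borel_measurable ?W"
    unfolding measurable_weights_law using ij by (auto intro: measurable_lpp)
  have [measurable]: "(\<lambda>w. w p) \<in> borel_measurable ?W" for p
    unfolding measurable_weights_law by simp
  have "{w \<in> space ?W. x \<le> \<bar>lpp (i, j) (k, l) w - lpp (k, j) (k, l) w - (k - i) / s q\<bar>} \<in> sets ?W" by measurable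
  then have A: "?A \<in> sets ?W" by simp
  have "{w \<in> space ?W. x \<le> \<bar>lpp (k, j) (k, l) w - w (k, l) - (l - j) / (1 - s q)\<bar>} \<in> sets ?W" by measurable
  then have B: "?B \<in> sets ?W" by simp
  have "measure ?W {w. 2 * x \<le> \<bar>lpp (i, j) (k, l) w - w (k, l) - ((k - i) / s q + (l - j) / (1 - s q))\<bar>} \<le>
      measure ?W (?A \<union> ?B)"
    by (rule W.finite_measure_mono) (use A B in auto)
  also have "\<dots> \<le> measure ?W ?A + measure ?W ?B" by (rule measure_Un_le[OF A B])
  finally show ?thesis
    using single_env_row_deviation[of i k j l s q x] single_env_column_deviation[of j l s q x k] ij s x by simp
qed

text \<open>A coupling of two environments: where \<open>\<rho>'\<close> is at most
  \<open>\<rho>\<close>, the rescaling lowers nonnegative weights.\<close>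

lemma distr_weights_law_scale:
  assumes pos: "\<And>p. 0 < \<rho> p" "\<And>p. 0 < \<rho>' p"
  shows "distr (weights_law \<rho>') borel_fun (\<lambda>w p. \<rho>' p / \<rho> p * w p) = weights_law \<rho>"
proof -
  interpret W: prob_space "weights_law \<rho>'" by (rule prob_space_weights_law) (rule pos)
  let ?X = "\<lambda>p w. \<rho>' p / \<rho> p * w p"
  have all: "zero_off UNIV = (\<lambda>w :: 'a \<Rightarrow> real. w)" by (simp add: zero_off_def fun_eq_iff)
  have "distr (weights_law \<rho>') borel_fun (\<lambda>w. zero_off UNIV (\<lambda>p. ?X p w)) =
      distr (weights_law \<rho>) borel_fun (zero_off UNIV)"
  proof (rule distr_zero_off_eq_weights_law)
    show "W.indep_vars (\<lambda>_. borel) ?X UNIV"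
      by (rule W.indep_vars_compose2[OF indep_vars_weights_law(1)]) (use pos in auto)
    fix p
    have "distributed (weights_law \<rho>') lborel (\<lambda>w. \<rho>' p / \<rho> p * w p) (exponential_density (\<rho>' p / (\<rho>' p / \<rho> p)))"
      by (rule W.erlang_distributed_mult_const) (use pos[of p] distributed_weights_law[OF pos(2)] in auto)
    then have "distr (weights_law \<rho>') lborel (?X p) = expm (\<rho> p)"
      using pos[of p] by (simp add: distributed_def expm_def)
    moreover have "distr (weights_law \<rho>') lborel (?X p) = distr (weights_law \<rho>') borel (?X p)"
      by (rule distr_cong) auto
    ultimately show "distr (weights_law \<rho>') borel (?X p) = expm (\<rho> p)" by simp
  qed (use pos W.prob_space_axioms in auto)
  then show ?thesis by (simp add: all distr_id2)
qed

lemma AE_weights_law_nonneg: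
  fixes \<rho> :: "int \<times> int \<Rightarrow> real"
  assumes pos: "\<And>p. 0 < \<rho> p"
  shows "AE w in weights_law \<rho>. \<forall>p. 0 \<le> w p"
proof -
  have "AE x in expm c. 0 \<le> x" for c
    unfolding expm_def by (subst AE_density) (auto simp: exponential_density_def)
  then have "AE w in weights_law \<rho>. 0 \<le> w p" for p
    unfolding weights_law_def using pos by (intro AE_PiM_component prob_space_expm) auto
  then show ?thesis by (simp add: AE_all_countable)
qed

lemma lpp_mono:
  assumes "i \<le> a" "j \<le> b"
    and "\<And>i' j'. i \<le> i' \<Longrightarrow> i' \<le> a \<Longrightarrow> j \<le> j' \<Longrightarrow> j' \<le> b \<Longrightarrow> w (i', j') \<le> w' (i', j')"
  shows "lpp (i, j) (a, b) w \<le> lpp (i, j) (a, b) w'"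
  using assms
proof (induction i j rule: lattice_induct)
  case (step i j)
  have w: "w (i, j) \<le> w' (i, j)" using step by simp
  have 1: "lpp (i + 1, j) (a, b) w \<le> lpp (i + 1, j) (a, b) w'" if "i < a" using step that by simp
  have 2: "lpp (i, j + 1) (a, b) w \<le> lpp (i, j + 1) (a, b) w'" if "j < b" using step that by simp
  consider "i = a" "j = b" | "i < a" "j = b" | "i = a" "j < b" | "i < a" "j < b"
    using step.hyps by linarith
  then show ?case
  proof cases
    case 1
    then show ?thesis using w by simp
  next
    case 2
    then show ?thesis using w 1 by (simp add: lpp_top add_mono)
  next
    case 3
    then show ?thesis using w 2 by (simp add: lpp_right add_mono)
  next
    case 4
    then show ?thesis using w 1 2 lpp_step[OF 4, of w] lpp_step[OF 4, of w'] by (simp add: add_mono max.mono)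
  qed
qed

text \<open>
  Lowering the rates along one side of the boundary enlarges the passage time through that side,
  while the unrestricted passage time of the new environment concentrates around a smaller value.
\<close>

lemma forced_exit_bound:
  assumes ij: "1 \<le> i" "i < k" "1 \<le> j" "j < l"
    and s: "0 < s q" "s q < 1" "0 < s' q" "s' q < 1"
    and e: "s' q \<le> s q \<and> e = (k - 1, l) \<or> s q \<le> s' q \<and> e = (k, l - 1)"
    and gap: "gap = (k - i) * (1 / s q - 1 / s' q) + (l - j) * (1 / (1 - s q) - 1 / (1 - s' q))" "0 < gap"
  shows "measure (weights_law (env_rate k l q q s)) {w. lpp (i, j) (k, l) w - w (k, l) \<le> lpp (i, j) e w} \<le>
    16 * ((k - i) / (s q)\<^sup>2 + (l - j) / (1 - s q)\<^sup>2 + (k - i) / (s' q)\<^sup>2 + (l - j) / (1 - s' q)\<^sup>2) / gap\<^sup>2"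
proof -
  let ?R = "env_rate k l q q s" and ?R' = "env_rate k l q q s'"
  let ?W = "weights_law ?R" and ?W' = "weights_law ?R'"
  interpret W: prob_space ?W by (rule prob_space_weights_law) (rule env_rate_pos)
  interpret W': prob_space ?W' by (rule prob_space_weights_law) (rule env_rate_pos)
  \<comment> \<open>The means satisfy \<open>m - m' = gap = 4 * x\<close>, so the level
    \<open>m - 2 * x\<close> lies halfway between them. The factor 16 in the bound is the square of
    this 4.\<close>
  define x where "x = gap / 4"
  have x: "0 < x" using gap by (simp add: x_def)
  define m where "m = (k - i) / s q + (l - j) / (1 - s q)"
  define m' where "m' = (k - i) / s' q + (l - j) / (1 - s' q)"
  have mm: "m' + 2 * x = m - 2 * x" unfolding m_def m'_def x_def gap(1) by (simp add: field_simps)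
  let ?G = "\<lambda>w. lpp (i, j) (k, l) w - w (k, l)"
  let ?f = "\<lambda>w p. ?R' p / ?R p * w p"
  obtain e1 e2 where e12: "e = (e1, e2)" by fastforce
  have eb: "i \<le> e1" "e1 \<le> k" "j \<le> e2" "e2 \<le> l" using e ij e12 by auto
  have meas: "lpp (i, j) e \<in> borel_measurable borel_fun" "lpp (i, j) (k, l) \<in> borel_measurable borel_fun"
    using eb ij by (auto intro!: measurable_lpp simp: e12)
  then have [measurable]: "lpp (i, j) e \<in> borel_measurable ?W" "lpp (i, j) (k, l) \<in> borel_measurable ?W"
      "lpp (i, j) e \<in> borel_measurable ?W'" "lpp (i, j) (k, l) \<in> borel_measurable ?W'"
      "(\<lambda>w. w p) \<in> borel_measurable ?W" "(\<lambda>w. w p) \<in> borel_measurable ?W'" for p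
    unfolding measurable_weights_law by auto
  have f: "?f \<in> measurable ?W' borel_fun"
    by (rule measurable_PiM_single') (auto simp: space_PiM PiE_UNIV_domain)
  let ?A = "{w. 2 * x \<le> \<bar>?G w - m\<bar>}" and ?B = "{w. 2 * x \<le> \<bar>?G w - m'\<bar>}" and ?E = "{w. m - 2 * x \<le> lpp (i, j) e w}"
  have "{w \<in> space ?W. 2 * x \<le> \<bar>?G w - m\<bar>} \<in> sets ?W" by measurable
  then have A: "?A \<in> sets ?W" by simp
  have "{w \<in> space ?W'. 2 * x \<le> \<bar>?G w - m'\<bar>} \<in> sets ?W'" by measurable
  then have B: "?B \<in> sets ?W'" by simp
  have "{w \<in> space ?W. m - 2 * x \<le> lpp (i, j) e w} \<in> sets ?W" by measurable
  then have E: "?E \<in> sets ?W" "?E \<in> sets borel_fun" by simp_all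
  have split: "w \<in> ?A \<union> ?E" if "?G w \<le> lpp (i, j) e w" for w
  proof (cases "m - 2 * x \<le> lpp (i, j) e w")
    case False
    then have "2 * x \<le> m - ?G w" using that by linarith
    then show ?thesis by auto
  qed simp
  have "measure ?W {w. ?G w \<le> lpp (i, j) e w} \<le> measure ?W (?A \<union> ?E)"
    by (rule W.finite_measure_mono) (use A E split in auto)
  also have "\<dots> \<le> measure ?W ?A + measure ?W ?E" by (rule measure_Un_le[OF A E(1)])
  also have "measure ?W ?E = measure (distr ?W' borel_fun ?f) ?E"
    using distr_weights_law_scale[of ?R ?R'] env_rate_pos by simp
  also have "\<dots> = measure ?W' {w. m - 2 * x \<le> lpp (i, j) e (?f w)}"
    using measure_distr[OF f E(2)] by (simp add: vimage_def)
  also have "\<dots> \<le> measure ?W' ?B"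
  proof (rule W'.finite_measure_mono_AE[OF _ B])
    show "AE w in ?W'. w \<in> {w. m - 2 * x \<le> lpp (i, j) e (?f w)} \<longrightarrow> w \<in> ?B"
      using AE_weights_law_nonneg[of ?R', OF env_rate_pos]
    proof eventually_elim
      case (elim w)
      have "lpp (i, j) e (?f w) \<le> lpp (i, j) e w"
        unfolding e12
      proof (rule lpp_mono[OF eb(1,3)])
        \<comment> \<open>Passing from \<open>s\<close> to \<open>s'\<close> raises the rates on
          only one side of the boundary, and paths to \<open>e\<close> avoid that side: the right
          column for \<open>e = (k - 1, l)\<close>, the top row for
          \<open>e = (k, l - 1)\<close>.\<close>
        fix i' j' assume "i' \<le> e1" "j' \<le> e2"
        then have "?R' (i', j') \<le> ?R (i', j')"
          using e s unfolding e12 env_rate_def by (auto simp: Let_def)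
        then have "?R' (i', j') / ?R (i', j') \<le> 1" using env_rate_pos by (simp add: divide_le_eq_1_pos)
        then show "?f w (i', j') \<le> w (i', j')" 
            using mult_right_mono[of "?R' (i', j') / ?R (i', j')" 1 "w (i', j')"] elim by simp
      qed
      also have "\<dots> \<le> ?G w"
        using lpp_last_step[of i "k - 1" j "l - 1" w] ij e by auto
      finally show ?case using mm by auto
    qed
  qed
  finally have "measure ?W {w. ?G w \<le> lpp (i, j) e w} \<le> measure ?W ?A + measure ?W' ?B" by simp
  also have "\<dots> \<le> ((k - i) / ((s q)\<^sup>2 * x\<^sup>2) + (l - j) / ((1 - s q)\<^sup>2 * x\<^sup>2)) +
      ((k - i) / ((s' q)\<^sup>2 * x\<^sup>2) + (l - j) / ((1 - s' q)\<^sup>2 * x\<^sup>2))"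
    unfolding m_def m'_def using ij s x single_env_deviation[of i k j l s q x] single_env_deviation[of i k j l s' q x]
    by (intro add_mono) simp_all
  also have "\<dots> = ((k - i) / (s q)\<^sup>2 + (l - j) / (1 - s q)\<^sup>2 + (k - i) / (s' q)\<^sup>2 + (l - j) / (1 - s' q)\<^sup>2) / x\<^sup>2"
    by (simp add: add_divide_distrib)
  also have "\<dots> = 16 * ((k - i) / (s q)\<^sup>2 + (l - j) / (1 - s q)\<^sup>2 + (k - i) / (s' q)\<^sup>2 + (l - j) / (1 - s' q)\<^sup>2) / gap\<^sup>2"
  proof -
    have "A / x\<^sup>2 = 16 * A / gap\<^sup>2" for A by (simp add: x_def power_divide)
    then show ?thesis by blast
  qed
  finally show ?thesis unfolding of_int_diff .
qed

section \<open>Optimal parameters and exits along a ray\<close>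

lemma zeta_bounds: "0 < r \<Longrightarrow> 0 < zeta r" "0 < r \<Longrightarrow> zeta r < 1"
  by (auto simp: zeta_def add_pos_pos divide_less_eq_1)

lemma inverse_zeta: "0 < r \<Longrightarrow> 1 / zeta r = 1 + 1 / sqrt r" "0 < r \<Longrightarrow> 1 / (1 - zeta r) = 1 + sqrt r"
proof -
  assume r: "0 < r"
  then have "1 + sqrt r > 0" "sqrt r > 0" by (auto intro: add_pos_pos)
  then have "1 + sqrt r \<noteq> 0" by linarith
  then have "1 - zeta r = 1 / (1 + sqrt r)" by (simp add: zeta_def eq_divide_eq left_diff_distrib)
  then show "1 / (1 - zeta r) = 1 + sqrt r" by simp
  show "1 / zeta r = 1 + 1 / sqrt r" using \<open>sqrt r > 0\<close> by (simp add: zeta_def field_simps)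
qed

lemma zeta_strict_mono: "0 < r \<Longrightarrow> r < r' \<Longrightarrow> zeta r < zeta r'"
  by (simp add: zeta_def frac_less_eq field_simps add_pos_pos)

text \<open>In direction \<open>t\<close> the function \<open>t / s + 1 / (1 - s)\<close> has its
  minimum at \<open>s = zeta t\<close>. Its excess at \<open>zeta r\<close> is the completed square
  \<open>(sqrt r - sqrt t)\<^sup>2 / sqrt r\<close>.\<close>

lemma zeta_gap_pos:
  assumes "0 < r" "0 < t" "r \<noteq> t"
  shows "0 < t * (1 / zeta r - 1 / zeta t) + (1 / (1 - zeta r) - 1 / (1 - zeta t))"
proof -
  have pos: "0 < sqrt r" "0 < sqrt t" "sqrt r \<noteq> sqrt t" using assms by auto
  have square: "y\<^sup>2 * (1 / x - 1 / y) + (x - y) = (x - y)\<^sup>2 / x" if "0 < x" "0 < y" for x y :: real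
    using that by (simp add: field_simps power2_eq_square)
  have "t * (1 / zeta r - 1 / zeta t) + (1 / (1 - zeta r) - 1 / (1 - zeta t)) =
      (sqrt t)\<^sup>2 * (1 / sqrt r - 1 / sqrt t) + (sqrt r - sqrt t)"
    using assms by (simp add: inverse_zeta)
  also have "\<dots> = (sqrt r - sqrt t)\<^sup>2 / sqrt r"
    using pos by (intro square)
  also have "\<dots> > 0" using pos by simp
  finally show ?thesis .
qed

lemma floor_mult_over_tendsto: "(\<lambda>n. real_of_int \<lfloor>t * real n\<rfloor> / real n) \<longlonglongrightarrow> t"
proof (rule tendsto_sandwich)
  have "(\<lambda>n. t - 1 / real n) \<longlonglongrightarrow> t - 0"
    by (intro tendsto_diff tendsto_const lim_1_over_n)
  then show "(\<lambda>n. t - 1 / real n) \<longlonglongrightarrow> t" by simp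
  show "\<forall>\<^sub>F n in sequentially. t - 1 / real n \<le> real_of_int \<lfloor>t * real n\<rfloor> / real n"
    using eventually_gt_at_top[of 0]
  proof eventually_elim
    case (elim n)
    have "t * real n - 1 \<le> real_of_int \<lfloor>t * real n\<rfloor>" by linarith
    then have "(t * real n - 1) / real n \<le> real_of_int \<lfloor>t * real n\<rfloor> / real n"
      by (rule divide_right_mono) simp
    then show ?case using elim by (simp add: diff_divide_distrib)
  qed
  show "\<forall>\<^sub>F n in sequentially. real_of_int \<lfloor>t * real n\<rfloor> / real n \<le> t"
    using eventually_gt_at_top[of 0]
  proof eventually_elim
    case (elim n)
    have "real_of_int \<lfloor>t * real n\<rfloor> / real n \<le> t * real n / real n" by (rule divide_right_mono) auto
    then show ?case using elim by simp
  qed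
qed simp

lemma floor_mult_at_top:
  assumes "0 < t"
  shows "filterlim (\<lambda>n. \<lfloor>t * real n\<rfloor>) at_top sequentially"
proof -
  have "filterlim (\<lambda>n. t * real n) at_top sequentially"
    by (rule filterlim_tendsto_pos_mult_at_top[OF tendsto_const assms filterlim_real_sequentially])
  then show ?thesis by (rule filterlim_compose[OF filterlim_floor_sequentially])
qed

text \<open>The competing parameter is \<open>zeta t\<close>, the optimal one for the shape of the
  box. Variances and the gap between the means both grow like \<open>n\<close>, so the bound from
  \<open>forced_exit_bound\<close> decays like \<open>1 / n\<close>. For \<open>t < r\<close> the
  unlikely exit is through the top row, otherwise through the right column.\<close>

lemma forced_exit_limit:
  assumes ij: "1 \<le> i" "1 \<le> j" and r: "0 < r" "0 < t" "r \<noteq> t" and s: "s q = zeta r"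
  defines "k \<equiv> \<lambda>n. \<lfloor>t * real n\<rfloor> + 1" and "l \<equiv> \<lambda>n. int n + 1"
  defines "e \<equiv> \<lambda>n. if t < r then (k n - 1, l n) else (k n, l n - 1)"
  shows "(\<lambda>n. measure (weights_law (env_rate (k n) (l n) q q s))
      {w. lpp (i, j) (k n, l n) w - w (k n, l n) \<le> lpp (i, j) (e n) w}) \<longlonglongrightarrow> 0"
proof (rule tendsto_sandwich[where f = "\<lambda>_. 0"])
  let ?\<sigma> = "zeta r" and ?\<tau> = "zeta t"
  let ?X = "\<lambda>n. real_of_int (k n) - real_of_int i" and ?Y = "\<lambda>n. real_of_int (l n) - real_of_int j"
  let ?g = "\<lambda>x y. x * (1 / ?\<sigma> - 1 / ?\<tau>) + y * (1 / (1 - ?\<sigma>) - 1 / (1 - ?\<tau>))"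
  let ?h = "\<lambda>x y. x / ?\<sigma>\<^sup>2 + y / (1 - ?\<sigma>)\<^sup>2 + x / ?\<tau>\<^sup>2 + y / (1 - ?\<tau>)\<^sup>2"
  let ?B = "\<lambda>n. 16 * ?h (?X n) (?Y n) / (?g (?X n) (?Y n))\<^sup>2"
  have "(\<lambda>n. real_of_int \<lfloor>t * real n\<rfloor> / real n + (1 - real_of_int i) * (1 / real n)) \<longlonglongrightarrow> t + (1 - real_of_int i) * 0"
    by (intro tendsto_intros floor_mult_over_tendsto lim_1_over_n)
  then have X: "(\<lambda>n. ?X n / real n) \<longlonglongrightarrow> t" by (simp add: k_def add_divide_distrib diff_divide_distrib add_diff_eq)
  have "(\<lambda>n. 1 + (1 - real_of_int j) * (1 / real n)) \<longlonglongrightarrow> 1 + (1 - real_of_int j) * 0"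
    by (intro tendsto_intros lim_1_over_n)
  moreover have "\<forall>\<^sub>F n in sequentially. 1 + (1 - real_of_int j) * (1 / real n) = ?Y n / real n"
    using eventually_gt_at_top[of 0] by eventually_elim (simp add: l_def field_simps)
  ultimately have Y: "(\<lambda>n. ?Y n / real n) \<longlonglongrightarrow> 1" by (simp add: tendsto_cong)
  have g: "(\<lambda>n. ?g (?X n / real n) (?Y n / real n)) \<longlonglongrightarrow> ?g t 1"
    by (intro tendsto_intros X Y)
  have h: "(\<lambda>n. ?h (?X n / real n) (?Y n / real n)) \<longlonglongrightarrow> ?h t 1"
    using zeta_bounds[OF r(1)] zeta_bounds[OF r(2)] by (intro tendsto_intros X Y) auto
  have g0: "0 < ?g t 1" using zeta_gap_pos[OF r] by simp
  have "(\<lambda>n. 1 / real n * (16 * ?h (?X n / real n) (?Y n / real n) / (?g (?X n / real n) (?Y n / real n))\<^sup>2)) \<longlonglongrightarrow>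
      0 * (16 * ?h t 1 / (?g t 1)\<^sup>2)"
    using g0 by (intro tendsto_mult[OF lim_1_over_n] tendsto_divide[OF tendsto_mult[OF tendsto_const h] tendsto_power[OF g]]) auto
  moreover have "\<forall>\<^sub>F n in sequentially.
      1 / real n * (16 * ?h (?X n / real n) (?Y n / real n) / (?g (?X n / real n) (?Y n / real n))\<^sup>2) = ?B n"
    using eventually_gt_at_top[of 0]
  proof eventually_elim
    case (elim n)
    have "?g (?X n / real n) (?Y n / real n) = ?g (?X n) (?Y n) / real n" by (simp add: add_divide_distrib)
    moreover have "?h (?X n / real n) (?Y n / real n) = ?h (?X n) (?Y n) / real n"
      by (simp add: add_divide_distrib mult.commute)
    ultimately show ?case using elim by (simp add: power_divide power2_eq_square)
  qed
  ultimately show "?B \<longlonglongrightarrow> 0" by (simp add: tendsto_cong)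
  have "\<forall>\<^sub>F n in sequentially. 0 < ?g (?X n / real n) (?Y n / real n)"
    using order_tendstoD(1)[OF g g0] .
  moreover have "\<forall>\<^sub>F n in sequentially. i \<le> \<lfloor>t * real n\<rfloor>"
    using floor_mult_at_top[OF r(2)] by (simp add: filterlim_at_top)
  moreover have "\<forall>\<^sub>F n in sequentially. j \<le> int n"
    using filterlim_int_sequentially by (simp add: filterlim_at_top)
  ultimately show "\<forall>\<^sub>F n in sequentially. measure (weights_law (env_rate (k n) (l n) q q s))
      {w. lpp (i, j) (k n, l n) w - w (k n, l n) \<le> lpp (i, j) (e n) w} \<le> ?B n"
    using eventually_gt_at_top[of 0]
  proof eventually_elim
    case (elim n)
    define s' :: "int \<Rightarrow> real" where "s' = (\<lambda>_. ?\<tau>)"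
    have "?g (?X n / real n) (?Y n / real n) = ?g (?X n) (?Y n) / real n" by (simp add: add_divide_distrib)
    then have gap: "0 < ?g (?X n) (?Y n)" using elim by (simp add: zero_less_divide_iff)
    have e: "s' q \<le> s q \<and> e n = (k n - 1, l n) \<or> s q \<le> s' q \<and> e n = (k n, l n - 1)"
      using r zeta_strict_mono[of t r] zeta_strict_mono[of r t] by (auto simp: e_def s s'_def)
    show ?case
      using forced_exit_bound[of i "k n" j "l n" s q s' "e n" "?g (?X n) (?Y n)"] ij elim e gap
        zeta_bounds[OF r(1)] zeta_bounds[OF r(2)] unfolding s s'_def
      by (simp add: k_def l_def)
  qed
qed (auto intro: always_eventually)

lemma lpp_incr_top_end:
  assumes "i \<le> a" "j \<le> b"
  shows "(i < a \<longrightarrow> lpp (i, j) (a, b) w - lpp (i + 1, j) (a, b) w \<le> lpp (i, j) (a, b + 1) w - lpp (i + 1, j) (a, b + 1) w)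
    \<and> (j < b \<longrightarrow> lpp (i, j) (a, b + 1) w - lpp (i, j + 1) (a, b + 1) w \<le> lpp (i, j) (a, b) w - lpp (i, j + 1) (a, b) w)"
  using lpp_incr_right_end[of j b i a "\<lambda>p. w (prod.swap p)"] assms
  by (simp add: lpp_transpose[of i a j b] lpp_transpose[of "i + 1" a j b] lpp_transpose[of i a "j + 1" b]
      lpp_transpose[of i a j "b + 1"] lpp_transpose[of "i + 1" a j "b + 1"] lpp_transpose[of i a "j + 1" "b + 1"])

text \<open>The sign treats two mirror cases at once: \<open>\<epsilon> = 1\<close> is the order
  that results from geodesics arriving at the corner through the right column,
  \<open>\<epsilon> = - 1\<close> the one from an arrival through the top row.\<close>

definition incr_compare :: "real \<Rightarrow> int \<times> int \<Rightarrow> int \<times> int \<Rightarrow> (int \<times> int \<Rightarrow> real) \<Rightarrow> int \<times> int \<Rightarrow>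
    (int \<times> int \<Rightarrow> real) \<Rightarrow> bool" where
  "incr_compare \<epsilon> u z w v w' \<longleftrightarrow>
     \<epsilon> * (lpp u z w - lpp (u + (1, 0)) z w) \<le> \<epsilon> * (lpp u v w' - lpp (u + (1, 0)) v w') \<and>
     \<epsilon> * (lpp u v w' - lpp (u + (0, 1)) v w') \<le> \<epsilon> * (lpp u z w - lpp (u + (0, 1)) z w)"

text \<open>When the geodesics from all three starting points arrive through
  \<open>(a + 1, b)\<close>, the increments towards the corner are those towards
  \<open>(a + 1, b)\<close>. This endpoint is one step to the right of \<open>(a, b)\<close>, so
  planar monotonicity applies.\<close>

lemma incr_compare_right:
  assumes "i < a" "j < b"
    and less: "\<And>u. u \<in> {(i, j), (i + 1, j), (i, j + 1)} \<Longrightarrow> lpp u (a, b + 1) w < lpp u (a + 1, b) w"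
  shows "incr_compare 1 (i, j) (a + 1, b + 1) w (a, b) w"
proof -
  have "lpp (i, j) (a + 1, b + 1) w = w (a + 1, b + 1) + lpp (i, j) (a + 1, b) w"
    "lpp (i + 1, j) (a + 1, b + 1) w = w (a + 1, b + 1) + lpp (i + 1, j) (a + 1, b) w"
    "lpp (i, j + 1) (a + 1, b + 1) w = w (a + 1, b + 1) + lpp (i, j + 1) (a + 1, b) w"
    using assms(1,2) less[of "(i, j)"] less[of "(i + 1, j)"] less[of "(i, j + 1)"]
      lpp_last_step[of i a j b w] lpp_last_step[of "i + 1" a j b w] lpp_last_step[of i a "j + 1" b w]
    by simp_all
  then show ?thesis using lpp_incr_right_end[of i a j b w] assms(1,2) by (simp add: incr_compare_def)
qed

lemma incr_compare_top:
  assumes "i < a" "j < b"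
    and less: "\<And>u. u \<in> {(i, j), (i + 1, j), (i, j + 1)} \<Longrightarrow> lpp u (a + 1, b) w < lpp u (a, b + 1) w"
  shows "incr_compare (- 1) (i, j) (a + 1, b + 1) w (a, b) w"
proof -
  have "lpp (i, j) (a + 1, b + 1) w = w (a + 1, b + 1) + lpp (i, j) (a, b + 1) w"
    "lpp (i + 1, j) (a + 1, b + 1) w = w (a + 1, b + 1) + lpp (i + 1, j) (a, b + 1) w"
    "lpp (i, j + 1) (a + 1, b + 1) w = w (a + 1, b + 1) + lpp (i, j + 1) (a, b + 1) w"
    using assms(1,2) less[of "(i, j)"] less[of "(i + 1, j)"] less[of "(i, j + 1)"]
      lpp_last_step[of i a j b w] lpp_last_step[of "i + 1" a j b w] lpp_last_step[of i a "j + 1" b w]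
    by simp_all
  then show ?thesis using lpp_incr_top_end[of i a j b w] assms(1,2) by (simp add: incr_compare_def)
qed

section \<open>Comparison of increments\<close>

text \<open>A box with \<open>t < r\<close> is steeper than the direction \<open>r\<close>, so its
  geodesics arrive through the right column; for \<open>t > r\<close> they arrive through the top
  row. This explains the sign \<open>sgn (r - t)\<close>.\<close>

lemma single_env_compare_limit:
  assumes ij: "1 \<le> i" "1 \<le> j" and r: "0 < r" "0 < t" "r \<noteq> t" and s: "s q = zeta r"
  defines "k \<equiv> \<lambda>n. \<lfloor>t * real n\<rfloor> + 1" and "l \<equiv> \<lambda>n. int n + 1"
  shows "(\<lambda>n. measure (weights_law (env_rate (k n) (l n) q q s))
      {w. \<not> incr_compare (sgn (r - t)) (i, j) (k n, l n) w (k n - 1, l n - 1) w}) \<longlonglongrightarrow> 0"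
proof (rule tendsto_sandwich[where f = "\<lambda>_. 0"])
  \<comment> \<open>The two increments at \<open>(i, j)\<close> involve three starting points, and
    the exit must be on the right side for each of them.\<close>
  let ?U = "{(i, j), (i + 1, j), (i, j + 1)}"
  let ?W = "\<lambda>n. weights_law (env_rate (k n) (l n) q q s)"
  define e where "e = (\<lambda>n. if t < r then (k n - 1, l n) else (k n, l n - 1))"
  let ?F = "\<lambda>u n. {w. lpp u (k n, l n) w - w (k n, l n) \<le> lpp u (e n) w}"
  have "(\<lambda>n. measure (?W n) (?F u n)) \<longlonglongrightarrow> 0" if "u \<in> ?U" for u
  proof -
    obtain x y where u: "u = (x, y)" by fastforce
    then have "1 \<le> x" "1 \<le> y" using that ij by auto
    then show ?thesis
      unfolding u e_def k_def l_def using forced_exit_limit[of x y r t s q] \<open>1 \<le> x\<close> \<open>1 \<le> y\<close> r s by simp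
  qed
  then have "(\<lambda>n. \<Sum>u\<in>?U. measure (?W n) (?F u n)) \<longlonglongrightarrow> (\<Sum>u\<in>?U. 0)"
    by (intro tendsto_sum)
  then show "(\<lambda>n. \<Sum>u\<in>?U. measure (?W n) (?F u n)) \<longlonglongrightarrow> 0" by simp
  have "\<forall>\<^sub>F n in sequentially. i + 1 \<le> \<lfloor>t * real n\<rfloor>"
    using floor_mult_at_top[OF r(2)] by (simp add: filterlim_at_top)
  moreover have "\<forall>\<^sub>F n in sequentially. j + 1 \<le> int n"
    using filterlim_int_sequentially by (simp add: filterlim_at_top)
  ultimately show "\<forall>\<^sub>F n in sequentially. measure (?W n)
      {w. \<not> incr_compare (sgn (r - t)) (i, j) (k n, l n) w (k n - 1, l n - 1) w} \<le>
      (\<Sum>u\<in>?U. measure (?W n) (?F u n))"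
  proof eventually_elim
    case (elim n)
    interpret W: prob_space "?W n" by (rule prob_space_weights_law) (rule env_rate_pos)
    have ij': "i < k n - 1" "j < l n - 1" using elim by (auto simp: k_def l_def)
    have F: "?F u n \<in> sets (?W n)" if "u \<in> ?U" for u
    proof -
      have [measurable]: "lpp u (k n, l n) \<in> borel_measurable (?W n)" "lpp u (e n) \<in> borel_measurable (?W n)"
        "(\<lambda>w. w (k n, l n)) \<in> borel_measurable (?W n)"
        using that ij' by (auto intro!: measurable_lpp simp: e_def measurable_weights_law)
      have "{w \<in> space (?W n). lpp u (k n, l n) w - w (k n, l n) \<le> lpp u (e n) w} \<in> sets (?W n)" by measurable
      then show ?thesis by simp
    qed
    have "{w. \<not> incr_compare (sgn (r - t)) (i, j) (k n, l n) w (k n - 1, l n - 1) w} \<subseteq> (\<Union>u\<in>?U. ?F u n)"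
    proof (rule subsetI, rule ccontr)
      fix w assume bad: "w \<in> {w. \<not> incr_compare (sgn (r - t)) (i, j) (k n, l n) w (k n - 1, l n - 1) w}"
        and "w \<notin> (\<Union>u\<in>?U. ?F u n)"
      then have good: "lpp u (e n) w < lpp u (k n, l n) w - w (k n, l n)" if "u \<in> ?U" for u
        using that by (auto simp: not_le)
      have less: "lpp u (e n) w < max (lpp u (k n - 1, l n) w) (lpp u (k n, l n - 1) w)"
        if "u \<in> ?U" for u
      proof -
        obtain x y where u: "u = (x, y)" by fastforce
        then have "x \<le> k n - 1" "y \<le> l n - 1" using that ij' by auto
        from lpp_last_step[OF this, of w]
        have "lpp u (k n, l n) w - w (k n, l n) = max (lpp u (k n - 1, l n) w) (lpp u (k n, l n - 1) w)"
          by (simp add: u)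
        then show ?thesis using good[OF that] by simp
      qed
      show False
      proof (cases "t < r")
        case True
        then have "lpp u (k n - 1, l n) w < lpp u (k n, l n - 1) w" if "u \<in> ?U" for u
          using less[OF that] by (simp add: e_def)
        then have "incr_compare 1 (i, j) (k n - 1 + 1, l n - 1 + 1) w (k n - 1, l n - 1) w"
          by (intro incr_compare_right ij') (simp only: diff_add_cancel)
        then show False using bad True by simp
      next
        case False
        then have "lpp u (k n, l n - 1) w < lpp u (k n - 1, l n) w" if "u \<in> ?U" for u
          using less[OF that] by (simp add: e_def)
        then have "incr_compare (- 1) (i, j) (k n - 1 + 1, l n - 1 + 1) w (k n - 1, l n - 1) w"
          by (intro incr_compare_top ij') (simp only: diff_add_cancel)
        then show False using bad False r by simp
      qed
    qed
    then have "measure (?W n) {w. \<not> incr_compare (sgn (r - t)) (i, j) (k n, l n) w (k n - 1, l n - 1) w} \<le>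
        measure (?W n) (\<Union>u\<in>?U. ?F u n)"
      by (rule W.finite_measure_mono) (use F in blast)
    also have "\<dots> \<le> (\<Sum>u\<in>?U. measure (?W n) (?F u n))"
      using F by (intro measure_UNION_le) auto
    finally show ?case .
  qed
qed (auto intro: always_eventually)

text \<open>
  Bulk weights are recovered from increments: \<open>w (i, j)\<close> is the minimum of the two increments
  of the passage time at \<open>(i, j)\<close>.
\<close>

definition bulk_weights :: "int \<Rightarrow> int \<Rightarrow> int \<Rightarrow> ((int \<times> int) \<times> int \<Rightarrow> real) \<Rightarrow> int \<times> int \<Rightarrow> real" where
  "bulk_weights a b q h = (\<lambda>(i, j). if (i, j) \<in> grid a b
     then h ((i, j), q) - max (h ((i + 1, j), q)) (h ((i, j + 1), q)) else 0)"

text \<open>The comparison written in terms of the increments alone, with the bulk weights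
  reconstructed from them. Removing directions and shrinking the box preserve the law of this
  family, so the event has to be expressed through it.\<close>

definition family_compare :: "real \<Rightarrow> int \<times> int \<Rightarrow> int \<Rightarrow> int \<Rightarrow> int \<Rightarrow> ((int \<times> int) \<times> int \<Rightarrow> real) \<Rightarrow> bool" where
  "family_compare \<epsilon> u a b q h \<longleftrightarrow>
     \<epsilon> * (h (u, q) - h (u + (1, 0), q)) \<le>
       \<epsilon> * (lpp u (a, b) (bulk_weights a b q h) - lpp (u + (1, 0)) (a, b) (bulk_weights a b q h)) \<and>
     \<epsilon> * (lpp u (a, b) (bulk_weights a b q h) - lpp (u + (0, 1)) (a, b) (bulk_weights a b q h)) \<le>
       \<epsilon> * (h (u, q) - h (u + (0, 1), q))"

lemma family_compare_incr_family:
  assumes ij: "1 \<le> i" "i < a" "1 \<le> j" "j < b" and z: "(a + 1, b + 1) \<le> z q"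
  defines "S \<equiv> grid (a + 1) (b + 1) \<times> {q}"
  shows "family_compare \<epsilon> (i, j) a b q (incr_family z S w) \<longleftrightarrow> incr_compare \<epsilon> (i, j) (z q) w (a, b) w"
proof -
  obtain z1 z2 where zq: "z q = (z1, z2)" by fastforce
  have h: "incr_family z S w ((x, y), q) = lpp (x, y) (z q) w - lpp (1, 1) (z q) w"
    if "1 \<le> x" "x \<le> a + 1" "1 \<le> y" "y \<le> b + 1" for x y
    using that by (simp add: incr_family_def S_def)
  have "bulk_weights a b q (incr_family z S w) (x, y) = w (x, y)"
    if "1 \<le> x" "x \<le> a" "1 \<le> y" "y \<le> b" for x y
    using that z zq lpp_step[of x z1 y z2 w] by (simp add: bulk_weights_def h)
  then have lpp: "lpp (x, y) (a, b) (bulk_weights a b q (incr_family z S w)) = lpp (x, y) (a, b) w"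
    if "1 \<le> x" "x \<le> a" "1 \<le> y" "y \<le> b" for x y
    using that by (intro lpp_cong) auto
  show ?thesis using ij by (simp add: family_compare_def incr_compare_def lpp h)
qed

lemma sets_Collect_not_le_conj:
  fixes f g f' g' :: "'a \<Rightarrow> real"
  assumes [measurable]: "f \<in> borel_measurable M" "g \<in> borel_measurable M"
    "f' \<in> borel_measurable M" "g' \<in> borel_measurable M"
  shows "{x \<in> space M. \<not> (f x \<le> g x \<and> f' x \<le> g' x)} \<in> sets M"
  by measurable

lemma sets_family_compare:
  fixes q :: int
  assumes ij: "1 \<le> i" "i < a" "1 \<le> j" "j < b"
  defines "S \<equiv> grid (a + 1) (b + 1) \<times> {q}"
  shows "{h \<in> space (borel_on S). \<not> family_compare \<epsilon> (i, j) a b q h} \<in> sets (borel_on S)"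
proof -
  have comp: "(\<lambda>h. h ((x, y), q) :: real) \<in> borel_measurable (borel_on S)"
    if "1 \<le> x" "x \<le> a + 1" "1 \<le> y" "y \<le> b + 1" for x y
    using that by (intro measurable_component_singleton) (auto simp: S_def)
  have bulk: "bulk_weights a b q \<in> measurable (borel_on S) borel_fun"
    unfolding bulk_weights_def
  proof (rule measurable_PiM_single')
    fix p
    show "(\<lambda>h. (\<lambda>(i, j). if (i, j) \<in> grid a b then (h ((i, j), q) :: real) - max (h ((i + 1, j), q)) (h ((i, j + 1), q)) else 0) p)
        \<in> borel_measurable (borel_on S)"
    proof (cases p)
      case (Pair x y)
      show ?thesis
      proof (cases "(x, y) \<in> grid a b")
        case True
        then have "(\<lambda>h. h ((x, y), q) - max (h ((x + 1, y), q)) (h ((x, y + 1), q)) :: real) \<in> borel_measurable (borel_on S)"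
          by (intro borel_measurable_diff borel_measurable_max comp) auto
        then show ?thesis using True Pair by simp
      qed (use Pair in auto)
    qed
  qed (auto simp: space_PiM PiE_UNIV_domain)
  have lpp: "(\<lambda>h. lpp (x, y) (a, b) (bulk_weights a b q h)) \<in> borel_measurable (borel_on S)"
    if "x \<le> a" "y \<le> b" for x y
    using measurable_compose[OF bulk measurable_lpp[of "(x, y)" "(a, b)"]] that by simp
  show ?thesis
    unfolding family_compare_def plus_prod_def fst_conv snd_conv add_0_right
    using ij by (intro sets_Collect_not_le_conj borel_measurable_times borel_measurable_const
        borel_measurable_diff comp lpp) auto
qed

text \<open>The event is decided by the increments towards one corner on the grid just one larger
  than the bulk box up to \<open>(a, b)\<close>. Its probability can thus be computed after removing
  all other directions and cutting the box down until the corner is diagonally adjacent to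
  \<open>(a, b)\<close>.\<close>

lemma env_compare_eq_single:
  assumes ij: "1 \<le> i" "i < a" "1 \<le> j" "j < b" and K: "a + 1 \<le> K" "b + 1 \<le> L"
    and q: "A \<le> q" "q \<le> B" and s: "strict_mono_on {A..B} s" "0 < s A" "s B < 1"
  shows "measure (weights_law (env_rate K L A B s)) {w. \<not> incr_compare \<epsilon> (i, j) (env_corner K L A B q) w (a, b) w} =
    measure (weights_law (env_rate (a + 1) (b + 1) q q s)) {w. \<not> incr_compare \<epsilon> (i, j) (a + 1, b + 1) w (a, b) w}"
proof -
  define S where "S = grid (a + 1) (b + 1) \<times> {q}"
  define D where "D = {h \<in> space (borel_on S). \<not> family_compare \<epsilon> (i, j) a b q h}"
  have D: "D \<in> sets (borel_on S)" unfolding D_def S_def by (rule sets_family_compare[OF ij])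
  have *: "measure (env_law K' L' A' B' s S) D =
      measure (weights_law (env_rate K' L' A' B' s)) {w. \<not> incr_compare \<epsilon> (i, j) (env_corner K' L' A' B' q) w (a, b) w}"
    if "(a + 1, b + 1) \<le> env_corner K' L' A' B' q" for K' L' A' B'
  proof -
    have "u \<le> env_corner K' L' A' B' q' \<and> (1, 1) \<le> env_corner K' L' A' B' q'" if "(u, q') \<in> S" for u q'
    proof -
      have "u \<le> (a + 1, b + 1)" "(1, 1) \<le> (a + 1, b + 1)" "q' = q" using that ij by (auto simp: S_def)
      then show ?thesis using \<open>(a + 1, b + 1) \<le> env_corner K' L' A' B' q\<close> by (meson order_trans)
    qed
    then have m: "incr_family (env_corner K' L' A' B') S \<in> measurable (weights_law (env_rate K' L' A' B' s)) (borel_on S)"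
      unfolding measurable_weights_law by (rule measurable_incr_family)
    have "incr_family (env_corner K' L' A' B') S -` D \<inter> space (weights_law (env_rate K' L' A' B' s)) =
        {w. \<not> incr_compare \<epsilon> (i, j) (env_corner K' L' A' B' q) w (a, b) w}"
      using measurable_space[OF m] family_compare_incr_family[of i a j b "env_corner K' L' A' B'" q \<epsilon>] ij that
      by (auto simp: D_def S_def)
    then show ?thesis unfolding env_law_def using measure_distr[OF m D] by simp
  qed
  have "env_law K L A B s S = env_law (a + 1) (b + 1) A B s S"
    by (rule env_law_shrink_box) (use ij K q s in \<open>auto simp: S_def\<close>)
  also have "\<dots> = env_law (a + 1) (b + 1) q q s S"
    by (rule env_law_single) (use ij K q s in \<open>auto simp: S_def\<close>)
  finally show ?thesis
    using *[of K L A B] *[of "a + 1" "b + 1" q q] K q by (simp add: env_corner_def)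
qed

section \<open>Identifying a joint law by sandwiching\<close>

text \<open>Lower orthants are stable under intersection and generate the product
  sigma-algebra.\<close>

lemma measure_eqI_joint_cdf:
  fixes P Q :: "('i \<Rightarrow> real) measure"
  assumes T: "finite T" and P: "prob_space P" "sets P = sets (borel_on T)"
    and Q: "prob_space Q" "sets Q = sets (borel_on T)"
    and eq: "\<And>t. measure P {f \<in> T \<rightarrow>\<^sub>E UNIV. \<forall>i\<in>T. f i \<le> t i} = measure Q {f \<in> T \<rightarrow>\<^sub>E UNIV. \<forall>i\<in>T. f i \<le> t i}"
  shows "P = Q"
proof -
  interpret P: prob_space P by fact
  interpret Q: prob_space Q by fact
  let ?E = "{{f \<in> T \<rightarrow>\<^sub>E UNIV. \<forall>i\<in>j. f i \<in> A i} | A j. j \<in> {T} \<and> A \<in> Pi j (\<lambda>_. range (\<lambda>a::real. {..a}))}"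
  have E: "?E = range (\<lambda>t. {f \<in> T \<rightarrow>\<^sub>E UNIV. \<forall>i\<in>T. f i \<le> t i})"
  proof (intro equalityI subsetI)
    fix X assume "X \<in> ?E"
    then obtain A where A: "X = {f \<in> T \<rightarrow>\<^sub>E UNIV. \<forall>i\<in>T. f i \<in> A i}" "A \<in> T \<rightarrow> range (\<lambda>a::real. {..a})"
      by blast
    have "\<forall>i\<in>T. \<exists>a. A i = {..a}"
    proof
      fix i assume "i \<in> T"
      then have "A i \<in> range (\<lambda>a::real. {..a})" by (rule Pi_mem[OF A(2)])
      then show "\<exists>a. A i = {..a}" by blast
    qed
    from bchoice[OF this] obtain t where t: "\<forall>i\<in>T. A i = {..t i}" by blast
    then have "X = {f \<in> T \<rightarrow>\<^sub>E UNIV. \<forall>i\<in>T. f i \<le> t i}" unfolding A(1)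
      by (intro Collect_cong conj_cong ball_cong refl) simp
    then show "X \<in> range (\<lambda>t. {f \<in> T \<rightarrow>\<^sub>E UNIV. \<forall>i\<in>T. f i \<le> t i})" by (rule range_eqI[of _ _ t])
  next
    fix X assume "X \<in> range (\<lambda>t. {f \<in> T \<rightarrow>\<^sub>E UNIV. \<forall>i\<in>T. f i \<le> (t i :: real)})"
    then obtain t where "X = {f \<in> T \<rightarrow>\<^sub>E UNIV. \<forall>i\<in>T. f i \<le> (t i :: real)}" by (rule rangeE)
    then have "X = {f \<in> T \<rightarrow>\<^sub>E UNIV. \<forall>i\<in>T. f i \<in> {..t i}}" by simp
    moreover have "(\<lambda>i. {..t i}) \<in> T \<rightarrow> range (\<lambda>a::real. {..a})" by simp
    ultimately show "X \<in> ?E" by (intro CollectI exI[of _ "\<lambda>i. {..t i}"] exI[of _ T] conjI) simp_all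
  qed
  have "sets (borel_on T :: (_ \<Rightarrow> real) measure) = sets (\<Pi>\<^sub>M i\<in>T. sigma UNIV (range (\<lambda>a::real. {..a})))"
    by (simp add: borel_eq_atMost)
  also have "\<dots> = sets (sigma (T \<rightarrow>\<^sub>E UNIV) ?E)"
  proof (rule sets_PiM_sigma)
    fix i
    show "\<exists>S\<subseteq>range (\<lambda>a::real. {..a}). countable S \<and> UNIV = \<Union> S"
      by (rule exI[of _ "range (\<lambda>n. {..real n})"]) (auto intro: real_arch_simple)
  qed (use T in auto)
  also have "\<dots> = sigma_sets (T \<rightarrow>\<^sub>E UNIV) ?E" by (rule sets_measure_of) auto
  finally have sets: "sets (borel_on T :: (_ \<Rightarrow> real) measure) = sigma_sets (T \<rightarrow>\<^sub>E UNIV) ?E" .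
  show ?thesis
  proof (rule measure_eqI_generator_eq)
    show "Int_stable ?E" unfolding E
    proof (rule Int_stableI, elim rangeE, hypsubst)
      fix t s :: "'i \<Rightarrow> real"
      have "{f \<in> T \<rightarrow>\<^sub>E UNIV. \<forall>i\<in>T. f i \<le> t i} \<inter> {f \<in> T \<rightarrow>\<^sub>E UNIV. \<forall>i\<in>T. f i \<le> s i} =
          {f \<in> T \<rightarrow>\<^sub>E UNIV. \<forall>i\<in>T. f i \<le> min (t i) (s i)}" by auto
      then show "{f \<in> T \<rightarrow>\<^sub>E UNIV. \<forall>i\<in>T. f i \<le> t i} \<inter> {f \<in> T \<rightarrow>\<^sub>E UNIV. \<forall>i\<in>T. f i \<le> s i}
          \<in> range (\<lambda>t. {f \<in> T \<rightarrow>\<^sub>E UNIV. \<forall>i\<in>T. f i \<le> t i})"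
        by (rule range_eqI[of _ _ "\<lambda>i. min (t i) (s i)"])
    qed
    show "?E \<subseteq> Pow (T \<rightarrow>\<^sub>E UNIV)" by auto
    show "sets P = sigma_sets (T \<rightarrow>\<^sub>E UNIV) ?E" "sets Q = sigma_sets (T \<rightarrow>\<^sub>E UNIV) ?E"
      using sets P Q by auto
    show "range (\<lambda>n. {f \<in> T \<rightarrow>\<^sub>E UNIV. \<forall>i\<in>T. f i \<le> real n}) \<subseteq> ?E"
      unfolding E by (intro image_subsetI rangeI)
    show "(\<Union>n. {f \<in> T \<rightarrow>\<^sub>E UNIV. \<forall>i\<in>T. f i \<le> real n}) = T \<rightarrow>\<^sub>E UNIV"
    proof (intro equalityI subsetI)
      fix f :: "'i \<Rightarrow> real" assume f: "f \<in> T \<rightarrow>\<^sub>E UNIV"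
      obtain n where n: "(\<Sum>i\<in>T. \<bar>f i\<bar>) \<le> real n" using real_arch_simple by blast
      have "f i \<le> real n" if "i \<in> T" for i
        using member_le_sum[of i T "\<lambda>i. \<bar>f i\<bar>"] that T n by auto
      then show "f \<in> (\<Union>n. {f \<in> T \<rightarrow>\<^sub>E UNIV. \<forall>i\<in>T. f i \<le> real n})" using f by blast
    qed auto
    show "emeasure P {f \<in> T \<rightarrow>\<^sub>E UNIV. \<forall>i\<in>T. f i \<le> real n} \<noteq> \<infinity>" for n by simp
    fix X assume "X \<in> ?E"
    then obtain t where "X = {f \<in> T \<rightarrow>\<^sub>E UNIV. \<forall>i\<in>T. f i \<le> t i}" unfolding E by (rule rangeE)
    then show "emeasure P X = emeasure Q X"
      using eq[of t] by (simp add: P.emeasure_eq_measure Q.emeasure_eq_measure)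
  qed
qed

text \<open>For \<open>n > 0\<close> a continuous majorant of \<open>indicator {..t}\<close> that
  falls from 1 to 0 between \<open>t\<close> and \<open>t + 1 / n\<close>. Being decreasing, it
  carries inequalities to expectations; being continuous and bounded, it carries limits.\<close>

definition ramp :: "nat \<Rightarrow> real \<Rightarrow> real \<Rightarrow> real" where
  "ramp n t x = max 0 (min 1 (1 - real n * (x - t)))"

lemma ramp_bounds: "0 \<le> ramp n t x" "ramp n t x \<le> 1"
  by (auto simp: ramp_def)

lemma ramp_antimono: "x \<le> y \<Longrightarrow> ramp n t y \<le> ramp n t x"
  unfolding ramp_def by (intro max.mono min.mono order_refl diff_mono mult_left_mono) auto

lemma isCont_ramp: "isCont (ramp n t) x"
  unfolding ramp_def by (intro continuous_intros)

lemma borel_measurable_ramp [measurable]: "ramp n t \<in> borel_measurable borel"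
  unfolding ramp_def by measurable

lemma ramp_tendsto: "(\<lambda>n. ramp n t x) \<longlonglongrightarrow> indicator {..t} x"
proof (cases "x \<le> t")
  case True
  then have "ramp n t x = 1" for n
    using mult_nonneg_nonpos[of "real n" "x - t"] by (simp add: ramp_def)
  then show ?thesis using True by simp
next
  case False
  obtain n0 where n0: "1 / (x - t) \<le> real n0" using real_arch_simple by blast
  have "ramp n t x = 0" if "n0 \<le> n" for n
  proof -
    have "1 / (x - t) \<le> real n" using n0 that by (meson of_nat_le_iff order_trans)
    then have "1 \<le> real n * (x - t)" using False by (simp add: divide_le_eq)
    then show ?thesis by (simp add: ramp_def)
  qed
  then have "\<forall>\<^sub>F n in sequentially. ramp n t x = indicator {..t} x"
    using False by (auto simp: eventually_sequentially)
  then show ?thesis by (rule tendsto_eventually)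
qed

definition ramp_prod :: "'i set \<Rightarrow> nat \<Rightarrow> ('i \<Rightarrow> real) \<Rightarrow> ('i \<Rightarrow> real) \<Rightarrow> real" where
  "ramp_prod T n t f = (\<Prod>i\<in>T. ramp n (t i) (f i))"

lemma ramp_prod_bounds: "0 \<le> ramp_prod T n t f" "ramp_prod T n t f \<le> 1"
  unfolding ramp_prod_def by (auto intro!: prod_nonneg prod_le_1 ramp_bounds)

lemma norm_ramp_prod: "norm (ramp_prod T n t f) \<le> 1"
  using ramp_prod_bounds[of T n t f] by simp

lemma ramp_prod_antimono: "(\<And>i. i \<in> T \<Longrightarrow> f i \<le> g i) \<Longrightarrow> ramp_prod T n t g \<le> ramp_prod T n t f"
  unfolding ramp_prod_def by (intro prod_mono conjI ramp_bounds ramp_antimono)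

lemma borel_measurable_ramp_prod: "ramp_prod T n t \<in> borel_measurable (borel_on T)"
  unfolding ramp_prod_def
  by (intro borel_measurable_prod measurable_compose[OF _ borel_measurable_ramp] measurable_component_singleton)

lemma ramp_prod_restrict: "ramp_prod T n t (\<lambda>i\<in>T. f i) = ramp_prod T n t f"
  unfolding ramp_prod_def by (intro prod.cong) auto

lemma ramp_prod_integral_tendsto:
  assumes "finite T" "prob_space P" "sets P = sets (borel_on T)"
  shows "(\<lambda>n. integral\<^sup>L P (ramp_prod T n t)) \<longlonglongrightarrow> measure P {f \<in> T \<rightarrow>\<^sub>E UNIV. \<forall>i\<in>T. f i \<le> t i}"
proof -
  interpret prob_space P by fact
  have space: "space P = T \<rightarrow>\<^sub>E UNIV"
    using sets_eq_imp_space_eq[OF assms(3)] by (simp add: space_PiM)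
  let ?A = "{f \<in> T \<rightarrow>\<^sub>E UNIV. \<forall>i\<in>T. f i \<le> t i}"
  have "{f \<in> space (borel_on T :: (_ \<Rightarrow> real) measure). \<forall>i\<in>T. f i \<le> t i} \<in> sets (borel_on T)"
    using assms(1) by measurable
  then have A: "?A \<in> sets P" using assms(3) by (simp add: space_PiM)
  have "(\<lambda>n. integral\<^sup>L P (ramp_prod T n t)) \<longlonglongrightarrow> integral\<^sup>L P (indicator ?A)"
  proof (rule integral_dominated_convergence[where w = "\<lambda>_. 1"])
    show "ramp_prod T n t \<in> borel_measurable P" for n
      using borel_measurable_ramp_prod assms(3) by (simp cong: measurable_cong_sets)
    show "AE f in P. (\<lambda>n. ramp_prod T n t f) \<longlonglongrightarrow> indicator ?A f"
    proof (rule AE_I2)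
      fix f assume f: "f \<in> space P"
      have "(\<lambda>n. ramp_prod T n t f) \<longlonglongrightarrow> (\<Prod>i\<in>T. indicator {..t i} (f i))"
        unfolding ramp_prod_def by (intro tendsto_prod ramp_tendsto)
      also have "(\<Prod>i\<in>T. indicator {..t i} (f i)) = (indicator ?A f :: real)"
      proof (cases "\<forall>i\<in>T. f i \<le> t i")
        case False
        then obtain i where "i \<in> T" "\<not> f i \<le> t i" by auto
        then have "(\<Prod>i\<in>T. indicator {..t i} (f i) :: real) = 0" using assms(1)
          by (intro prod_zero bexI[of _ i]) auto
        then show ?thesis using False by auto
      qed (use f space in auto)
      finally show "(\<lambda>n. ramp_prod T n t f) \<longlonglongrightarrow> indicator ?A f" .
    qed
    show "AE f in P. norm (ramp_prod T n t f) \<le> 1" for n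
      by (intro AE_I2 norm_ramp_prod)
  qed (use A in auto)
  then show ?thesis using A by simp
qed

text \<open>The \<open>X m\<close> share the law \<open>\<Lambda>\<close> but not a probability
  space, so only expectations can be compared. A decreasing test function turns
  \<open>lo \<le> X \<le> up\<close> into bounds on its expectation under \<open>\<Lambda>\<close>,
  up to the probability of the exceptional event. The outer expectations can be taken over
  \<open>P\<close>, where both tend to that of \<open>B\<close> by dominated convergence.\<close>

lemma joint_law_of_sandwich:
  fixes X lo up :: "nat \<Rightarrow> 'i \<Rightarrow> 'w \<Rightarrow> real" and lo' up' :: "nat \<Rightarrow> 'i \<Rightarrow> 'a \<Rightarrow> real"
  assumes T: "finite T" and P: "prob_space P" and W: "\<And>m. prob_space (W m)"
    and B [measurable]: "\<And>i. i \<in> T \<Longrightarrow> B i \<in> borel_measurable P"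
    and meas: "\<And>m i. i \<in> T \<Longrightarrow> X m i \<in> borel_measurable (W m)"
      "\<And>m i. i \<in> T \<Longrightarrow> lo m i \<in> borel_measurable (W m)" "\<And>m i. i \<in> T \<Longrightarrow> up m i \<in> borel_measurable (W m)"
      "\<And>m i. i \<in> T \<Longrightarrow> lo' m i \<in> borel_measurable P" "\<And>m i. i \<in> T \<Longrightarrow> up' m i \<in> borel_measurable P"
    and law: "\<And>m. distr (W m) (borel_on T) (\<lambda>w. \<lambda>i\<in>T. X m i w) = \<Lambda>"
    and lo: "\<And>m. distr P (borel_on T) (\<lambda>x. \<lambda>i\<in>T. lo' m i x) = distr (W m) (borel_on T) (\<lambda>w. \<lambda>i\<in>T. lo m i w)"
      "AE x in P. \<forall>i\<in>T. (\<lambda>m. lo' m i x) \<longlonglongrightarrow> B i x"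
    and up: "\<And>m. distr P (borel_on T) (\<lambda>x. \<lambda>i\<in>T. up' m i x) = distr (W m) (borel_on T) (\<lambda>w. \<lambda>i\<in>T. up m i w)"
      "AE x in P. \<forall>i\<in>T. (\<lambda>m. up' m i x) \<longlonglongrightarrow> B i x"
    and between: "(\<lambda>m. measure (W m) {w \<in> space (W m). \<exists>i\<in>T. \<not> (lo m i w \<le> X m i w \<and> X m i w \<le> up m i w)}) \<longlonglongrightarrow> 0"
  shows "distr P (borel_on T) (\<lambda>x. \<lambda>i\<in>T. B i x) = \<Lambda>"
proof -
  interpret P: prob_space P by fact
  let ?\<Phi> = "\<lambda>n t. ramp_prod T n t"
  let ?law = "\<lambda>M Y. distr M (borel_on T) (\<lambda>x. \<lambda>i\<in>T. Y i x) :: ('i \<Rightarrow> real) measure"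
  have integral_law: "integral\<^sup>L (?law M Y) (?\<Phi> n t) = (\<integral>x. ?\<Phi> n t (\<lambda>i. Y i x) \<partial>M)"
    if "\<And>i. i \<in> T \<Longrightarrow> Y i \<in> borel_measurable M" for M :: "'c measure" and Y n t
    using that by (subst integral_distr) (auto intro!: measurable_restrict borel_measurable_ramp_prod simp: ramp_prod_restrict)
  have \<Phi>_meas: "(\<lambda>x. ?\<Phi> n t (\<lambda>i. Y i x)) \<in> borel_measurable M"
    if "\<And>i. i \<in> T \<Longrightarrow> Y i \<in> borel_measurable M" for M :: "'c measure" and Y n t
    using measurable_compose[OF measurable_restrict[of T Y M "\<lambda>_. borel"] borel_measurable_ramp_prod[of T n t]] that
    by (simp add: ramp_prod_restrict)
  have conv: "(\<lambda>m. \<integral>x. ?\<Phi> n t (\<lambda>i. Y m i x) \<partial>P) \<longlonglongrightarrow> (\<integral>x. ?\<Phi> n t (\<lambda>i. B i x) \<partial>P)"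
    if Y: "\<And>m i. i \<in> T \<Longrightarrow> Y m i \<in> borel_measurable P" "AE x in P. \<forall>i\<in>T. (\<lambda>m. Y m i x) \<longlonglongrightarrow> B i x" for Y n t
  proof (rule integral_dominated_convergence[where w = "\<lambda>_. 1"])
    show "AE x in P. (\<lambda>m. ?\<Phi> n t (\<lambda>i. Y m i x)) \<longlonglongrightarrow> ?\<Phi> n t (\<lambda>i. B i x)"
      using Y(2)
    proof eventually_elim
      case (elim x)
      then show ?case unfolding ramp_prod_def
        by (intro tendsto_prod isCont_tendsto_compose[OF isCont_ramp]) auto
    qed
    show "AE x in P. norm (?\<Phi> n t (\<lambda>i. Y m i x)) \<le> 1" for m
      by (intro AE_I2 norm_ramp_prod)
  qed (use Y(1) B in \<open>auto intro!: \<Phi>_meas\<close>)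
  let ?bad = "\<lambda>m. {w \<in> space (W m). \<exists>i\<in>T. \<not> (lo m i w \<le> X m i w \<and> X m i w \<le> up m i w)}"
  have bad: "?bad m \<in> sets (W m)" for m
  proof -
    have "?bad m = (\<Union>i\<in>T. {w \<in> space (W m). \<not> (lo m i w \<le> X m i w \<and> X m i w \<le> up m i w)})" by auto
    also have "\<dots> \<in> sets (W m)"
    proof (intro sets.finite_UN T)
      fix i assume "i \<in> T"
      note [measurable] = meas(1-3)[OF this, of m]
      show "{w \<in> space (W m). \<not> (lo m i w \<le> X m i w \<and> X m i w \<le> up m i w)} \<in> sets (W m)" by measurable
    qed
    finally show ?thesis .
  qed
  \<comment> \<open>Test functions take values between 0 and 1, so the exceptional event costs at
    most its probability.\<close>
  have step: "(\<integral>w. ?\<Phi> n t (\<lambda>i. Y i w) \<partial>W m) \<le> (\<integral>w. ?\<Phi> n t (\<lambda>i. Z i w) \<partial>W m) + measure (W m) (?bad m)"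
    if Y: "\<And>i. i \<in> T \<Longrightarrow> Y i \<in> borel_measurable (W m)" and Z: "\<And>i. i \<in> T \<Longrightarrow> Z i \<in> borel_measurable (W m)"
      and YZ: "\<And>w i. w \<in> space (W m) \<Longrightarrow> w \<notin> ?bad m \<Longrightarrow> i \<in> T \<Longrightarrow> Z i w \<le> Y i w" for n t m Y Z
  proof -
    interpret W: prob_space "W m" by fact
    have int: "integrable (W m) (\<lambda>w. ?\<Phi> n t (\<lambda>i. V i w))" if "\<And>i. i \<in> T \<Longrightarrow> V i \<in> borel_measurable (W m)" for V
      by (intro W.integrable_const_bound[where B = 1] \<Phi>_meas that AE_I2 norm_ramp_prod)
    have ind: "integrable (W m) (indicator (?bad m) :: _ \<Rightarrow> real)"
      by (rule integrable_real_indicator[OF bad]) (simp add: W.emeasure_eq_measure)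
    have "(\<integral>w. ?\<Phi> n t (\<lambda>i. Y i w) \<partial>W m) \<le> (\<integral>w. ?\<Phi> n t (\<lambda>i. Z i w) + indicator (?bad m) w \<partial>W m)"
    proof (rule integral_mono)
      fix w assume w: "w \<in> space (W m)"
      show "?\<Phi> n t (\<lambda>i. Y i w) \<le> ?\<Phi> n t (\<lambda>i. Z i w) + indicator (?bad m) w"
      proof (cases "w \<in> ?bad m")
        case True
        then have "indicator (?bad m) w = (1::real)" by simp
        then show ?thesis using ramp_prod_bounds[of T n t] by (metis add_increasing order_refl order_trans)
      next
        case False
        then have "?\<Phi> n t (\<lambda>i. Y i w) \<le> ?\<Phi> n t (\<lambda>i. Z i w)"
          using YZ[OF w False] by (intro ramp_prod_antimono)
        then show ?thesis using False by (simp add: indicator_def)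
      qed
    next
      show "integrable (W m) (\<lambda>w. ?\<Phi> n t (\<lambda>i. Y i w))" by (rule int[OF Y])
      show "integrable (W m) (\<lambda>w. ?\<Phi> n t (\<lambda>i. Z i w) + indicator (?bad m) w)"
        by (intro Bochner_Integration.integrable_add int[OF Z] ind)
    qed
    also have "\<dots> = (\<integral>w. ?\<Phi> n t (\<lambda>i. Z i w) \<partial>W m) + measure (W m) (?bad m)"
      using bad[of m] Bochner_Integration.integral_add[OF int[OF Z] ind] by simp
    finally show ?thesis .
  qed
  have L: "integral\<^sup>L \<Lambda> (?\<Phi> n t) = (\<integral>w. ?\<Phi> n t (\<lambda>i. X m i w) \<partial>W m)" for n t m
    unfolding law[of m, symmetric] by (rule integral_law) (rule meas)
  have lo_int: "(\<integral>w. ?\<Phi> n t (\<lambda>i. lo m i w) \<partial>W m) = (\<integral>x. ?\<Phi> n t (\<lambda>i. lo' m i x) \<partial>P)" for n t m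
    using integral_law[of "lo m" "W m" n t] integral_law[of "lo' m" P n t] meas lo(1) by simp
  have up_int: "(\<integral>w. ?\<Phi> n t (\<lambda>i. up m i w) \<partial>W m) = (\<integral>x. ?\<Phi> n t (\<lambda>i. up' m i x) \<partial>P)" for n t m
    using integral_law[of "up m" "W m" n t] integral_law[of "up' m" P n t] meas up(1) by simp
  have test: "integral\<^sup>L \<Lambda> (?\<Phi> n t) = integral\<^sup>L (?law P B) (?\<Phi> n t)" for n t
  proof (rule antisym)
    \<comment> \<open>The test functions decrease, so the lower family yields the upper bound and
      the upper family the lower bound.\<close>
    have "integral\<^sup>L \<Lambda> (?\<Phi> n t) \<le> (\<integral>x. ?\<Phi> n t (\<lambda>i. lo' m i x) \<partial>P) + measure (W m) (?bad m)" for m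
      using step[of "X m" m "lo m" n t] meas(1,2) unfolding L[of n t m] lo_int by blast
    moreover have "(\<lambda>m. (\<integral>x. ?\<Phi> n t (\<lambda>i. lo' m i x) \<partial>P) + measure (W m) (?bad m)) \<longlonglongrightarrow>
        (\<integral>x. ?\<Phi> n t (\<lambda>i. B i x) \<partial>P) + 0"
      by (intro tendsto_add conv between lo(2) meas(4))
    ultimately have "integral\<^sup>L \<Lambda> (?\<Phi> n t) \<le> (\<integral>x. ?\<Phi> n t (\<lambda>i. B i x) \<partial>P) + 0"
      by (intro LIMSEQ_le_const) auto
    then show "integral\<^sup>L \<Lambda> (?\<Phi> n t) \<le> integral\<^sup>L (?law P B) (?\<Phi> n t)" by (simp add: integral_law B)
    have "(\<integral>x. ?\<Phi> n t (\<lambda>i. up' m i x) \<partial>P) - measure (W m) (?bad m) \<le> integral\<^sup>L \<Lambda> (?\<Phi> n t)" for m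
      using step[of "up m" m "X m" n t] meas(1,3) unfolding L[of n t m] up_int by (simp add: algebra_simps)
    moreover have "(\<lambda>m. (\<integral>x. ?\<Phi> n t (\<lambda>i. up' m i x) \<partial>P) - measure (W m) (?bad m)) \<longlonglongrightarrow>
        (\<integral>x. ?\<Phi> n t (\<lambda>i. B i x) \<partial>P) - 0"
      by (intro tendsto_diff conv between up(2) meas(5))
    ultimately have "(\<integral>x. ?\<Phi> n t (\<lambda>i. B i x) \<partial>P) - 0 \<le> integral\<^sup>L \<Lambda> (?\<Phi> n t)"
      by (intro LIMSEQ_le_const2) auto
    then show "integral\<^sup>L (?law P B) (?\<Phi> n t) \<le> integral\<^sup>L \<Lambda> (?\<Phi> n t)" by (simp add: integral_law B)
  qed
  have prob: "prob_space (?law P B)" "prob_space \<Lambda>"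
    using B meas(1) unfolding law[of 0, symmetric]
    by (auto intro!: prob_space.prob_space_distr P W measurable_restrict)
  have sets: "sets (?law P B) = sets (borel_on T)" "sets \<Lambda> = sets (borel_on T)"
    unfolding law[of 0, symmetric] by auto
  show ?thesis
  proof (rule measure_eqI_joint_cdf[OF T prob(1) sets(1) prob(2) sets(2)])
    fix t
    show "measure (?law P B) {f \<in> T \<rightarrow>\<^sub>E UNIV. \<forall>i\<in>T. f i \<le> t i} = measure \<Lambda> {f \<in> T \<rightarrow>\<^sub>E UNIV. \<forall>i\<in>T. f i \<le> t i}"
      using ramp_prod_integral_tendsto[OF T prob(1) sets(1), of t]
        ramp_prod_integral_tendsto[OF T prob(2) sets(2), of t] unfolding test
      by (rule LIMSEQ_unique)
  qed
qed

section \<open>Joint laws of increments\<close>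

type_synonym incr_index = "((int \<times> int) \<times> int) + ((int \<times> int) \<times> int)"

definition incr_at :: "(int \<Rightarrow> int \<times> int) \<Rightarrow> (int \<times> int \<Rightarrow> real) \<Rightarrow> incr_index \<Rightarrow> real" where
  "incr_at z w i = (case i of
     Inl (u, p) \<Rightarrow> lpp u (z p) w - lpp (u + (1, 0)) (z p) w
   | Inr (u, p) \<Rightarrow> lpp u (z p) w - lpp (u + (0, 1)) (z p) w)"

definition incr_indices :: "int \<Rightarrow> int \<Rightarrow> int \<Rightarrow> incr_index set" where
  "incr_indices k l d =
     ((({1..k - 1} \<times> {1..l}) \<times> {1..d}) <+> (({1..k} \<times> {1..l - 1}) \<times> {1..d}))"

lemma finite_incr_indices: "finite (incr_indices k l d)"
  by (simp add: incr_indices_def)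

lemma incr_indices_cases:
  assumes "i \<in> incr_indices k l d"
  obtains (I) x y p where "i = Inl ((x, y), p)" "1 \<le> x" "x + 1 \<le> k" "1 \<le> y" "y \<le> l" "p \<in> {1..d}"
    | (J) x y p where "i = Inr ((x, y), p)" "1 \<le> x" "x \<le> k" "1 \<le> y" "y + 1 \<le> l" "p \<in> {1..d}"
  using assms by (auto simp: incr_indices_def)

definition family_incr :: "((int \<times> int) \<times> int \<Rightarrow> real) \<Rightarrow> incr_index \<Rightarrow> real" where
  "family_incr h i = (case i of
     Inl (u, p) \<Rightarrow> h (u, p) - h (u + (1, 0), p)
   | Inr (u, p) \<Rightarrow> h (u, p) - h (u + (0, 1), p))"

lemma incr_at_eq_family_incr:
  assumes "i \<in> incr_indices k l d"
  shows "incr_at z w i = family_incr (incr_family z (grid k l \<times> {1..d}) w) i"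
  using assms by (cases rule: incr_indices_cases) (simp_all add: incr_at_def family_incr_def incr_family_def)

lemma measurable_family_incr:
  "(\<lambda>h. \<lambda>i\<in>incr_indices k l d. family_incr h i)
     \<in> measurable (borel_on (grid k l \<times> {1..d})) (borel_on (incr_indices k l d))"
proof (rule measurable_restrict)
  have comp: "(\<lambda>h. h ((x, y), p) :: real) \<in> borel_measurable (borel_on (grid k l \<times> {1..d}))"
    if "1 \<le> x" "x \<le> k" "1 \<le> y" "y \<le> l" "p \<in> {1..d}" for x y p
    using that by (intro measurable_component_singleton) auto
  fix i assume "i \<in> incr_indices k l d"
  then show "(\<lambda>h. family_incr h i) \<in> borel_measurable (borel_on (grid k l \<times> {1..d}))"
    by (cases rule: incr_indices_cases) (simp_all add: family_incr_def borel_measurable_diff comp)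
qed

lemma incr_at_restrict_eq:
  "(\<lambda>w. \<lambda>i\<in>incr_indices k l d. incr_at z w i) =
     (\<lambda>h. \<lambda>i\<in>incr_indices k l d. family_incr h i) \<circ> incr_family z (grid k l \<times> {1..d})"
  by (auto simp: fun_eq_iff incr_at_eq_family_incr)

lemma measurable_incr_at:
  assumes "i \<in> incr_indices k l d" "\<And>p. p \<in> {1..d} \<Longrightarrow> (k, l) \<le> z p"
  shows "(\<lambda>w. incr_at z w i) \<in> borel_measurable borel_fun"
  using assms(1)
proof (cases rule: incr_indices_cases)
  case (I x y p)
  have "(k, l) \<le> z p" using assms(2) I by simp
  then have "(x, y) \<le> z p" "(x + 1, y) \<le> z p" using I by (auto simp: less_eq_prod_def)
  then show ?thesis using I by (simp add: incr_at_def borel_measurable_diff measurable_lpp)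
next
  case (J x y p)
  have "(k, l) \<le> z p" using assms(2) J by simp
  then have "(x, y) \<le> z p" "(x, y + 1) \<le> z p" using J by (auto simp: less_eq_prod_def)
  then show ?thesis using J by (simp add: incr_at_def borel_measurable_diff measurable_lpp)
qed

lemma incr_at_cong:
  assumes "i \<in> incr_indices k l d" and "\<And>p. p \<in> {1..d} \<Longrightarrow> (k, l) \<le> z p \<and> z p \<le> (a, b)"
    and "\<And>q. q \<in> grid a b \<Longrightarrow> w q = w' q"
  shows "incr_at z w i = incr_at z w' i"
proof -
  have lpp: "lpp (x, y) (z p) w = lpp (x, y) (z p) w'"
    if "1 \<le> x" "x \<le> k" "1 \<le> y" "y \<le> l" "p \<in> {1..d}" for x y p
  proof -
    obtain z1 z2 where z: "z p = (z1, z2)" by fastforce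
    show ?thesis unfolding z using assms(2)[OF that(5)] that z
      by (intro lpp_cong assms(3)) auto
  qed
  from assms(1) show ?thesis
    by (cases rule: incr_indices_cases) (auto simp: incr_at_def lpp)
qed

lemma distr_incr_at_env:
  assumes kl: "1 \<le> k" "1 \<le> l" "k \<le> K" "l \<le> L" and d: "1 \<le> d"
    and s: "strict_mono_on {1..d} s" "0 < s 1" "s d < 1"
  shows "distr (weights_law (env_rate K L 1 d s)) (borel_on (incr_indices k l d))
      (\<lambda>w. \<lambda>i\<in>incr_indices k l d. incr_at (env_corner K L 1 d) w i) =
    distr (weights_law (env_rate k l 1 d s)) (borel_on (incr_indices k l d))
      (\<lambda>w. \<lambda>i\<in>incr_indices k l d. incr_at (env_corner k l 1 d) w i)"
proof -
  let ?S = "grid k l \<times> {1..d}" and ?T = "incr_indices k l d"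
  let ?f = "\<lambda>h. \<lambda>i\<in>?T. family_incr h i"
  have *: "distr (weights_law (env_rate K L 1 d s)) (borel_on ?T) (\<lambda>w. \<lambda>i\<in>?T. incr_at (env_corner K L 1 d) w i) =
      distr (env_law K L 1 d s ?S) (borel_on ?T) ?f" if "k \<le> K" "l \<le> L" for K L
  proof -
    have "incr_family (env_corner K L 1 d) ?S \<in> measurable (weights_law (env_rate K L 1 d s)) (borel_on ?S)"
      unfolding measurable_weights_law using kl that
      by (intro measurable_incr_family) (auto simp: env_corner_def)
    then show ?thesis
      unfolding env_law_def incr_at_restrict_eq by (intro distr_distr[symmetric] measurable_family_incr)
  qed
  show ?thesis using *[of K L] *[of k l] kl env_law_shrink_box[OF kl d s subset_refl] by simp
qed

text \<open>The slopes may vary with \<open>m\<close>, as a diagonal sequence requires; any scales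
  \<open>n m\<close> that dominate \<open>m\<close> are admissible.\<close>

lemma busemann_direction:
  assumes t: "t \<longlonglongrightarrow> r" "0 < r" and n: "\<And>m. m \<le> n m"
  shows "has_direction r (\<lambda>m. (\<lfloor>t m * real (n m)\<rfloor>, int (n m)))"
  unfolding has_direction_def fst_conv snd_conv
proof
  have nn: "filterlim n at_top sequentially"
    using n by (intro filterlim_at_top_mono[OF filterlim_ident]) auto
  then have real_n: "filterlim (\<lambda>m. real (n m)) at_top sequentially"
    by (rule filterlim_compose[OF filterlim_real_sequentially])
  have floor: "filterlim (\<lambda>m. \<lfloor>t m * real (n m)\<rfloor>) at_top sequentially"
    by (rule filterlim_compose[OF filterlim_floor_sequentially])
       (rule filterlim_tendsto_pos_mult_at_top[OF t real_n])
  have int_n: "filterlim (\<lambda>m. int (n m)) at_top sequentially"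
    by (rule filterlim_compose[OF filterlim_int_sequentially nn])
  show "filterlim (\<lambda>m. min \<lfloor>t m * real (n m)\<rfloor> (int (n m))) at_top sequentially"
    unfolding filterlim_at_top
  proof
    fix Z
    show "\<forall>\<^sub>F m in sequentially. Z \<le> min \<lfloor>t m * real (n m)\<rfloor> (int (n m))"
      using floor[unfolded filterlim_at_top, rule_format, of Z] int_n[unfolded filterlim_at_top, rule_format, of Z]
      by eventually_elim simp
  qed
  have inv: "(\<lambda>m. 1 / real (n m)) \<longlonglongrightarrow> 0"
    using tendsto_inverse_0_at_top[OF real_n] by (simp add: inverse_eq_divide)
  have pos: "\<forall>\<^sub>F m in sequentially. 0 < n m"
    using nn[unfolded filterlim_at_top, rule_format, of 1] by eventually_elim simp
  show "(\<lambda>m. real_of_int \<lfloor>t m * real (n m)\<rfloor> / real_of_int (int (n m))) \<longlonglongrightarrow> r"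
  proof (rule tendsto_sandwich)
    show "(\<lambda>m. t m - 1 / real (n m)) \<longlonglongrightarrow> r"
      using tendsto_diff[OF t(1) inv] by simp
    show "\<forall>\<^sub>F m in sequentially. t m - 1 / real (n m) \<le> real_of_int \<lfloor>t m * real (n m)\<rfloor> / real_of_int (int (n m))"
      using pos
    proof eventually_elim
      case (elim m)
      have "t m * real (n m) - 1 \<le> real_of_int \<lfloor>t m * real (n m)\<rfloor>" by linarith
      then have "(t m * real (n m) - 1) / real (n m) \<le> real_of_int \<lfloor>t m * real (n m)\<rfloor> / real (n m)"
        by (rule divide_right_mono) simp
      then show ?case using elim by (simp add: diff_divide_distrib)
    qed
    show "\<forall>\<^sub>F m in sequentially. real_of_int \<lfloor>t m * real (n m)\<rfloor> / real_of_int (int (n m)) \<le> t m"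
      using pos
    proof eventually_elim
      case (elim m)
      have "real_of_int \<lfloor>t m * real (n m)\<rfloor> / real (n m) \<le> t m * real (n m) / real (n m)"
        by (rule divide_right_mono) auto
      then show ?case using elim by simp
    qed
  qed (rule t(1))
qed

section \<open>Transfer to the two given environments\<close>

lemma distr_incr_at_zero_off:
  assumes "prob_space M" and indep: "prob_space.indep_vars M (\<lambda>_. borel) Y A"
    and Y: "\<And>p. p \<in> A \<Longrightarrow> distr M borel (Y p) = expm (\<rho> p)" and pos: "\<And>p. 0 < \<rho> p"
    and F: "F \<in> measurable borel_fun N" "\<And>w. F (zero_off A w) = F w"
  shows "(\<lambda>x. F (zero_off A (\<lambda>p. Y p x))) \<in> measurable M N"
    and "distr M N (\<lambda>x. F (zero_off A (\<lambda>p. Y p x))) = distr (weights_law \<rho>) N F"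
proof -
  interpret prob_space M by fact
  have Z: "(\<lambda>x. zero_off A (\<lambda>p. Y p x)) \<in> measurable M borel_fun"
    unfolding zero_off_def
  proof (rule measurable_PiM_single')
    fix p
    show "(\<lambda>x. if p \<in> A then Y p x else 0) \<in> borel_measurable M"
      using indep by (cases "p \<in> A") (auto simp: indep_vars_def2)
  qed (auto simp: space_PiM PiE_UNIV_domain)
  then show "(\<lambda>x. F (zero_off A (\<lambda>p. Y p x))) \<in> measurable M N"
    by (rule measurable_compose[OF _ F(1)])
  have mz: "zero_off A \<in> measurable (weights_law \<rho>) borel_fun"
    unfolding measurable_weights_law by (rule measurable_zero_off)
  have "distr M N (\<lambda>x. F (zero_off A (\<lambda>p. Y p x))) = distr (distr M borel_fun (\<lambda>x. zero_off A (\<lambda>p. Y p x))) N F"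
    using distr_distr[OF F(1) Z] by (simp add: comp_def)
  also have "distr M borel_fun (\<lambda>x. zero_off A (\<lambda>p. Y p x)) = distr (weights_law \<rho>) borel_fun (zero_off A)"
    by (rule distr_zero_off_eq_weights_law) (use assms in auto)
  also have "distr (distr (weights_law \<rho>) borel_fun (zero_off A)) N F = distr (weights_law \<rho>) N F"
    using distr_distr[OF F(1) mz] F(2) by (simp add: comp_def)
  finally show "distr M N (\<lambda>x. F (zero_off A (\<lambda>p. Y p x))) = distr (weights_law \<rho>) N F" .
qed

lemma distributed_imp_expm:
  assumes "distributed M lborel X (exponential_density c)"
  shows "distr M borel X = expm c"
proof -
  have "distr M borel X = distr M lborel X" by (rule distr_cong) auto
  then show ?thesis using assms by (simp add: distributed_def expm_def)
qed

lemma measurable_restrict_incr_at: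
  assumes "\<And>p. p \<in> {1..d} \<Longrightarrow> (k, l) \<le> z p"
  shows "(\<lambda>w. \<lambda>i\<in>incr_indices k l d. incr_at z w i) \<in> measurable borel_fun (borel_on (incr_indices k l d))"
  by (rule measurable_restrict) (rule measurable_incr_at[OF _ assms])

text \<open>Sites with nonpositive parameter sum have weight 0 in \<open>\<eta>\<close> but rate 1
  in \<open>env_rate\<close>. The two agree for the increments, because no such site lies in a
  rectangle below a corner except the corner itself.\<close>

lemma inhomogeneous_increments:
  assumes pos: "d > 0" "k > 0" "l > 0"
    and r: "\<And>p. p \<in> {1..d} \<Longrightarrow> r p > 0" "strict_mono_on {1..d} r"
    and env: "inhomogeneous_environment N \<eta> k l d r"
  defines "T \<equiv> incr_indices k l d" and "z \<equiv> env_corner k l 1 d" and "s \<equiv> \<lambda>q. zeta (r q)"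
  shows "(\<lambda>y. \<lambda>i\<in>T. incr_at z (\<lambda>q. \<eta> q y) i) \<in> measurable N (borel_on T)"
    and "distr N (borel_on T) (\<lambda>y. \<lambda>i\<in>T. incr_at z (\<lambda>q. \<eta> q y) i) =
      distr (weights_law (env_rate k l 1 d s)) (borel_on T) (\<lambda>w. \<lambda>i\<in>T. incr_at z w i)"
proof -
  let ?rate = "\<lambda>i j. a_param k r i + b_param l d r j"
  define A where "A = {p \<in> {1..k + d - 1} \<times> {1..l + d - 1}. 0 < ?rate (fst p) (snd p)}"
  let ?F = "\<lambda>w. \<lambda>i\<in>T. incr_at z w i"
  interpret N: prob_space N using env by (simp add: inhomogeneous_environment_def)
  have F: "?F \<in> measurable borel_fun (borel_on T)"
    unfolding T_def by (rule measurable_restrict_incr_at) (auto simp: z_def env_corner_def)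
  \<comment> \<open>For \<open>i \<ge> k\<close> and \<open>j \<ge> l\<close> the rate is positive
    once the direction \<open>i - k + 1\<close> of the column is smaller than the direction
    \<open>l + d - j\<close> of the row. Below \<open>z q\<close> these are at most \<open>q\<close>
    and at least \<open>q\<close>, and both equal \<open>q\<close> only at the corner.\<close>
  have inA: "p \<in> A" if q: "q \<in> {1..d}" and p: "(1, 1) \<le> p" "p \<le> z q" "p \<noteq> z q" for p q
  proof -
    obtain i j where ij: "p = (i, j)" by fastforce
    have b: "1 \<le> i" "1 \<le> j" "i \<le> k + q - 1" "j \<le> l + d - q" "i \<noteq> k + q - 1 \<or> j \<noteq> l + d - q"
      using p unfolding ij z_def env_corner_def by auto
    have "0 < ?rate i j"
    proof (cases "i < k")
      case True
      then show ?thesis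
        using b q zeta_bounds(1)[OF r(1)[of "l + d - j"]] by (auto simp: a_param_def b_param_def)
    next
      case False
      then have i': "i - k + 1 \<in> {1..d}" using b q by auto
      show ?thesis
      proof (cases "j < l")
        case True
        then show ?thesis using False zeta_bounds(2)[OF r(1)[OF i']] by (auto simp: a_param_def b_param_def)
      next
        case j: False
        then have j': "l + d - j \<in> {1..d}" "i - k + 1 < l + d - j" using b q by auto
        then have "r (i - k + 1) < r (l + d - j)" using strict_mono_onD[OF r(2) i' j'(1)] by simp
        then have "zeta (r (i - k + 1)) < zeta (r (l + d - j))" using r(1)[OF i'] by (intro zeta_strict_mono)
        then show ?thesis using False j by (auto simp: a_param_def b_param_def)
      qed
    qed
    then show ?thesis using b q by (auto simp: A_def ij)
  qed
  have FA: "?F (zero_off A w) = ?F w" for w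
  proof -
    have "incr_family z (grid k l \<times> {1..d}) (zero_off A w) = incr_family z (grid k l \<times> {1..d}) w"
    proof (rule incr_family_zero_off)
      fix u q p assume "(u, q) \<in> grid k l \<times> {1..d}" "(1, 1) \<le> p" "p \<le> z q" "p \<noteq> z q"
      then show "p \<in> A" by (intro inA[of q]) auto
    qed (auto simp: z_def env_corner_def)
    then show ?thesis
      using fun_cong[OF incr_at_restrict_eq[where k = k and l = l and d = d and z = z], of w] fun_cong[OF incr_at_restrict_eq[where k = k and l = l and d = d and z = z], of "zero_off A w"]
      by (simp add: T_def comp_def)
  qed
  have indep: "N.indep_vars (\<lambda>_. borel) \<eta> A"
    using env by (auto simp: inhomogeneous_environment_def A_def intro: N.indep_vars_subset)
  have law: "distr N borel (\<eta> p) = expm (env_rate k l 1 d s p)" if p: "p \<in> A" for p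
  proof -
    obtain i j where ij: "p = (i, j)" by fastforce
    have rate: "0 < ?rate i j" "i \<in> {1..k + d - 1}" "j \<in> {1..l + d - 1}"
      using p by (auto simp: A_def ij)
    then have "distributed N lborel (\<eta> (i, j)) (exponential_density (?rate i j))"
      using env unfolding inhomogeneous_environment_def by presburger
    moreover have "env_rate k l 1 d s p = ?rate i j"
      using rate(1) by (simp add: ij env_rate_def a_param_def b_param_def s_def Let_def)
    ultimately show ?thesis using distributed_imp_expm by (simp add: ij)
  qed
  show "(\<lambda>y. ?F (\<lambda>q. \<eta> q y)) \<in> measurable N (borel_on T)"
    using distr_incr_at_zero_off(1)[OF N.prob_space_axioms indep law env_rate_pos F FA] by (simp only: FA)
  show "distr N (borel_on T) (\<lambda>y. ?F (\<lambda>q. \<eta> q y)) =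
      distr (weights_law (env_rate k l 1 d s)) (borel_on T) ?F"
    using distr_incr_at_zero_off(2)[OF N.prob_space_axioms indep law env_rate_pos F FA] by (simp only: FA)
qed

text \<open>With the offset \<open>\<theta>\<close> fixed, these are finitely many conditions, each
  valid for all large \<open>n\<close>. The bound \<open>m \<le> n\<close> will make the chosen
  scales diverge.\<close>

lemma exists_comparison_scale:
  assumes r: "\<And>p. p \<in> {1..d} \<Longrightarrow> r p > (0::real)" and "0 < \<epsilon>" "0 < \<theta>" "\<theta> < 1"
  defines "t \<equiv> \<lambda>\<sigma> p. r p * (1 + \<sigma> * \<theta>)"
  shows "\<exists>n::nat. m \<le> n \<and> l < int n \<and> (\<forall>p\<in>{1..d}. \<forall>\<sigma>\<in>{-1, 1}. k < \<lfloor>t \<sigma> p * real n\<rfloor> \<and>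
    (\<forall>u\<in>grid k l. measure (weights_law (env_rate (\<lfloor>t \<sigma> p * real n\<rfloor> + 1) (int n + 1) p p (\<lambda>q. zeta (r q))))
      {w. \<not> incr_compare (- \<sigma>) u (\<lfloor>t \<sigma> p * real n\<rfloor> + 1, int n + 1) w (\<lfloor>t \<sigma> p * real n\<rfloor>, int n) w} < \<epsilon>))"
proof -
  have t: "0 < t \<sigma> p" "r p \<noteq> t \<sigma> p" "sgn (r p - t \<sigma> p) = - \<sigma>" if "p \<in> {1..d}" "\<sigma> \<in> {-1, 1}" for p \<sigma>
  proof -
    have "0 < \<theta> * r p" "\<theta> * r p < r p" using r[OF that(1)] assms(3,4) by auto
    then show "0 < t \<sigma> p" "r p \<noteq> t \<sigma> p" "sgn (r p - t \<sigma> p) = - \<sigma>"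
      using that(2) by (auto simp: t_def algebra_simps sgn_if)
  qed
  have "\<forall>\<^sub>F n in sequentially. m \<le> n \<and> l < int n \<and> (\<forall>p\<in>{1..d}. \<forall>\<sigma>\<in>{-1, 1}. k < \<lfloor>t \<sigma> p * real n\<rfloor> \<and>
    (\<forall>u\<in>grid k l. measure (weights_law (env_rate (\<lfloor>t \<sigma> p * real n\<rfloor> + 1) (int n + 1) p p (\<lambda>q. zeta (r q))))
      {w. \<not> incr_compare (- \<sigma>) u (\<lfloor>t \<sigma> p * real n\<rfloor> + 1, int n + 1) w (\<lfloor>t \<sigma> p * real n\<rfloor>, int n) w} < \<epsilon>))"
  proof (intro eventually_conj eventually_ball_finite ballI)
    show "\<forall>\<^sub>F n in sequentially. m \<le> n" by (rule eventually_ge_at_top)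
    show "\<forall>\<^sub>F n in sequentially. l < int n"
      using filterlim_int_sequentially[unfolded filterlim_at_top, rule_format, of "l + 1"]
      by eventually_elim simp
  next
    fix p \<sigma> assume p: "p \<in> {1..d}" and \<sigma>: "\<sigma> \<in> {-1, 1::real}"
    show "\<forall>\<^sub>F n in sequentially. k < \<lfloor>t \<sigma> p * real n\<rfloor>"
      using floor_mult_at_top[OF t(1)[OF p \<sigma>], unfolded filterlim_at_top, rule_format, of "k + 1"]
      by eventually_elim simp
    fix u assume "u \<in> grid k l"
    then obtain x y where u: "u = (x, y)" "1 \<le> x" "1 \<le> y" by auto
    have "(\<lambda>n. measure (weights_law (env_rate (\<lfloor>t \<sigma> p * real n\<rfloor> + 1) (int n + 1) p p (\<lambda>q. zeta (r q))))
        {w. \<not> incr_compare (- \<sigma>) u (\<lfloor>t \<sigma> p * real n\<rfloor> + 1, int n + 1) w (\<lfloor>t \<sigma> p * real n\<rfloor>, int n) w}) \<longlonglongrightarrow> 0"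
      using single_env_compare_limit[of x y "r p" "t \<sigma> p" "\<lambda>q. zeta (r q)" p] u r[OF p] t[OF p \<sigma>] by simp
    then show "\<forall>\<^sub>F n in sequentially. measure (weights_law (env_rate (\<lfloor>t \<sigma> p * real n\<rfloor> + 1) (int n + 1) p p (\<lambda>q. zeta (r q))))
        {w. \<not> incr_compare (- \<sigma>) u (\<lfloor>t \<sigma> p * real n\<rfloor> + 1, int n + 1) w (\<lfloor>t \<sigma> p * real n\<rfloor>, int n) w} < \<epsilon>"
      using assms(2) by (rule order_tendstoD(2))
  qed auto
  then show ?thesis by (rule eventually_happens'[OF sequentially_bot])
qed

text \<open>Forced exits are rare only in directions different from \<open>r p\<close>, while
  Busemann limits are taken along sequences of direction exactly \<open>r p\<close>. A diagonal
  sequence satisfies both demands: its slopes parameters \<open>t m \<sigma> p\<close> differ from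
  \<open>r p\<close> for every \<open>m\<close> and converge to it.\<close>

lemma busemann_increments:
  fixes I J :: "real \<Rightarrow> int \<times> int \<Rightarrow> 'a \<Rightarrow> real"
  assumes pos: "d > 0" "k > 0" "l > 0"
    and r: "\<And>p. p \<in> {1..d} \<Longrightarrow> r p > 0" "strict_mono_on {1..d} r"
    and iid: "iid_exp_environment M \<omega>" and bus: "busemann_functions M \<omega> I J"
  defines "T \<equiv> incr_indices k l d" and "s \<equiv> \<lambda>q. zeta (r q)"
    and "B \<equiv> \<lambda>i x. case i of Inl (u, p) \<Rightarrow> I (r p) u x | Inr (u, p) \<Rightarrow> J (r p) u x"
  shows "\<And>i. i \<in> T \<Longrightarrow> B i \<in> borel_measurable M"
    and "distr M (borel_on T) (\<lambda>x. \<lambda>i\<in>T. B i x) =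
      distr (weights_law (env_rate k l 1 d s)) (borel_on T) (\<lambda>w. \<lambda>i\<in>T. incr_at (env_corner k l 1 d) w i)"
proof -
  interpret M: prob_space M using iid by (simp add: iid_exp_environment_def)
  have quad: "(x, y) \<in> quadrant" if "1 \<le> x" "1 \<le> y" for x y
    using that by (simp add: quadrant_def)
  have s: "strict_mono_on {1..d} s" "0 < s 1" "s d < 1"
  proof -
    show "strict_mono_on {1..d} s"
      using strict_mono_onD[OF r(2)] r(1) unfolding s_def
      by (intro strict_mono_onI zeta_strict_mono) auto
    show "0 < s 1" "s d < 1" using pos r(1) by (auto simp: s_def zeta_bounds)
  qed
  show meas_B: "B i \<in> borel_measurable M" if "i \<in> T" for i
    using that bus r(1) quad unfolding T_def busemann_functions_def
    by (cases rule: incr_indices_cases) (simp_all add: B_def)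
  \<comment> \<open>The relative offset from \<open>r p\<close>: less than 1, so that the lower
    direction stays positive, and tending to 0.\<close>
  define \<theta> where "\<theta> m = 1 / (real m + 2)" for m
  have \<theta>: "0 < \<theta> m" "\<theta> m < 1" for m by (auto simp: \<theta>_def)
  define t where "t m \<sigma> p = r p * (1 + \<sigma> * \<theta> m)" for m \<sigma> p
  define \<epsilon> where "\<epsilon> m = 1 / real (Suc m)" for m
  define bad where "bad m \<sigma> p u n = measure (weights_law (env_rate (\<lfloor>t m \<sigma> p * real n\<rfloor> + 1) (int n + 1) p p s))
      {w. \<not> incr_compare (- \<sigma>) u (\<lfloor>t m \<sigma> p * real n\<rfloor> + 1, int n + 1) w (\<lfloor>t m \<sigma> p * real n\<rfloor>, int n) w}"
    for m \<sigma> p u and n :: nat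
  define good where "good m n \<longleftrightarrow> m \<le> n \<and> l < int n \<and> (\<forall>p\<in>{1..d}. \<forall>\<sigma>\<in>{-1, 1}.
      k < \<lfloor>t m \<sigma> p * real n\<rfloor> \<and> (\<forall>u\<in>grid k l. bad m \<sigma> p u n < \<epsilon> m))" for m n
  have "\<exists>n. good m n" for m
    using exists_comparison_scale[of d r "\<epsilon> m" "\<theta> m" m l k, OF r(1) _ \<theta>]
    unfolding good_def bad_def t_def s_def by (simp add: \<epsilon>_def)
  \<comment> \<open>For each \<open>m\<close> the offset \<open>\<theta> m\<close> and the tolerance
    \<open>\<epsilon> m\<close> are fixed first; the scale \<open>n m\<close> is then chosen large
    enough for them.\<close>
  then obtain n where "good m (n m)" for m by metis
  then have n: "m \<le> n m" "l < int (n m)"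
      "p \<in> {1..d} \<Longrightarrow> \<sigma> \<in> {-1, 1} \<Longrightarrow> k < \<lfloor>t m \<sigma> p * real (n m)\<rfloor>"
    and small: "p \<in> {1..d} \<Longrightarrow> \<sigma> \<in> {-1, 1} \<Longrightarrow> u \<in> grid k l \<Longrightarrow> bad m \<sigma> p u (n m) < \<epsilon> m"
    for m p \<sigma> u
    unfolding good_def by blast+
  define v where "v m \<sigma> p = (\<lfloor>t m \<sigma> p * real (n m)\<rfloor>, int (n m))" for m \<sigma> p
  \<comment> \<open>One bulk has to contain the comparison points of all directions on both sides.
    In an environment of size \<open>K\<close> the bulk ends at \<open>K - 1\<close>.\<close>
  have "\<exists>K. \<forall>p\<in>{1..d}. \<forall>\<sigma>\<in>{-1, 1}. v m \<sigma> p \<le> (K - 1, K - 1)" for m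
  proof -
    have "bdd_above ((\<lambda>(p, \<sigma>). max (fst (v m \<sigma> p)) (snd (v m \<sigma> p))) ` ({1..d} \<times> {-1, 1}))"
      by (rule bdd_above_finite) simp
    then obtain K where K: "\<And>p \<sigma>. (p, \<sigma>) \<in> {1..d} \<times> {-1, 1} \<Longrightarrow> max (fst (v m \<sigma> p)) (snd (v m \<sigma> p)) \<le> K"
      by (force simp: bdd_above_def)
    show ?thesis
    proof (intro exI[of _ "K + 1"] ballI)
      fix p \<sigma> assume "p \<in> {1..d}" "\<sigma> \<in> {-1, 1::real}"
      then show "v m \<sigma> p \<le> (K + 1 - 1, K + 1 - 1)" using K[of p \<sigma>] by (simp add: less_eq_prod_def)
    qed
  qed
  then have "\<forall>m. \<exists>K. \<forall>p\<in>{1..d}. \<forall>\<sigma>\<in>{-1, 1}. v m \<sigma> p \<le> (K - 1, K - 1)" by blast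
  from choice[OF this] obtain K where
    K: "\<And>m p \<sigma>. p \<in> {1..d} \<Longrightarrow> \<sigma> \<in> {-1, 1} \<Longrightarrow> v m \<sigma> p \<le> (K m - 1, K m - 1)" by blast
  have kv: "(k, l) \<le> v m \<sigma> p" "(k + 1, l + 1) \<le> v m \<sigma> p" if "p \<in> {1..d}" "\<sigma> \<in> {-1, 1}" for m \<sigma> p
    using n(2)[of m] n(3)[OF that, of m] by (simp_all add: v_def)
  have kK: "k \<le> K m - 1" "l \<le> K m - 1" for m
    using order_trans[OF kv(1)[of 1 1 m] K[of 1 1 m]] pos by auto
  let ?R = "\<lambda>m. env_rate (K m) (K m) 1 d s" and ?Z = "\<lambda>m. env_corner (K m) (K m) 1 d"
  let ?W = "\<lambda>m. weights_law (?R m)" and ?A = "\<lambda>m. grid (K m - 1) (K m - 1)"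
  have W: "prob_space (?W m)" for m by (rule prob_space_weights_law) (rule env_rate_pos)
  have kZ: "(k, l) \<le> ?Z m p" if "p \<in> {1..d}" for m p
    using kK[of m] that by (auto simp: env_corner_def)
  \<comment> \<open>Moving the endpoint to the right lowers horizontal and raises vertical
    increments. A lower bound for the former therefore comes from the direction above
    \<open>r p\<close>, a lower bound for the latter from the direction below, which accounts for
    the opposite signs.\<close>
  define bound where "bound \<sigma> m i w = incr_at (v m (case i of Inl _ \<Rightarrow> \<sigma> | Inr _ \<Rightarrow> - \<sigma>)) w i"
    for \<sigma> m w and i :: incr_index
  have sgn: "(case i of Inl _ \<Rightarrow> \<sigma> | Inr _ \<Rightarrow> - \<sigma>) \<in> {-1, 1}" if "\<sigma> \<in> {-1, 1}" for \<sigma> :: real and i :: incr_index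
    using that by (cases i) auto
  have meas_bound: "(\<lambda>w. bound \<sigma> m i w) \<in> borel_measurable borel_fun" if "i \<in> T" "\<sigma> \<in> {-1, 1}" for \<sigma> m i
    unfolding bound_def using that kv(1) sgn by (intro measurable_incr_at[of i k l d]) (auto simp: T_def)
  define F where "F \<sigma> m w = (\<lambda>i\<in>T. bound \<sigma> m i w)" for \<sigma> m w
  have F: "F \<sigma> m \<in> measurable borel_fun (borel_on T)" if "\<sigma> \<in> {-1, 1}" for \<sigma> m
    unfolding F_def by (rule measurable_restrict) (rule meas_bound[OF _ that])
  \<comment> \<open>The comparison points lie in the bulk, so the bounds read only weights of rate 1
    and have the same law under \<open>\<omega>\<close> as in the large environment.\<close>
  have bound_zero_off: "bound \<sigma> m i (zero_off (?A m) w) = bound \<sigma> m i w" if "i \<in> T" "\<sigma> \<in> {-1, 1}" for \<sigma> m i w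
    unfolding bound_def
    by (rule incr_at_cong[of i k l d _ "K m - 1" "K m - 1"])
       (use that kv(1) K sgn in \<open>auto simp: T_def zero_off_def\<close>)
  then have FA: "F \<sigma> m (zero_off (?A m) w) = F \<sigma> m w" if "\<sigma> \<in> {-1, 1}" for \<sigma> m w
    unfolding F_def using that by (intro restrict_ext) auto
  have indep: "M.indep_vars (\<lambda>_. borel) \<omega> (?A m)" for m
    using iid by (auto simp: iid_exp_environment_def quadrant_def intro: M.indep_vars_subset)
  have law: "distr M borel (\<omega> p) = expm (?R m p)" if p: "p \<in> ?A m" for m p
  proof -
    obtain i j where ij: "p = (i, j)" by fastforce
    have "distributed M lborel (\<omega> p) (exponential_density 1)"
      using p iid by (auto simp: iid_exp_environment_def quadrant_def)
    moreover have "?R m p = 1" using p by (simp add: ij env_rate_def Let_def)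
    ultimately show ?thesis using distributed_imp_expm by simp
  qed
  let ?\<omega> = "\<lambda>x q. \<omega> q x"
  have FM_meas: "(\<lambda>x. F \<sigma> m (?\<omega> x)) \<in> measurable M (borel_on T)"
    and FM_law: "distr M (borel_on T) (\<lambda>x. F \<sigma> m (?\<omega> x)) = distr (?W m) (borel_on T) (F \<sigma> m)"
    if "\<sigma> \<in> {-1, 1}" for \<sigma> m
    using distr_incr_at_zero_off[OF M.prob_space_axioms indep[of m] law[of _ m] env_rate_pos F[OF that, of m] FA[OF that, of m]]
    by (simp_all only: FA[OF that])
  have meas_bound_M: "(\<lambda>x. bound \<sigma> m i (?\<omega> x)) \<in> borel_measurable M" if "i \<in> T" "\<sigma> \<in> {-1, 1}" for \<sigma> m i
    using measurable_compose[OF FM_meas[OF that(2), of m] measurable_component_singleton[OF that(1)]] that(1)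
    by (simp add: F_def)
  have t_lim: "(\<lambda>m. t m \<sigma> p) \<longlonglongrightarrow> r p" for \<sigma> p
  proof -
    have "filterlim (\<lambda>m. real m + 2) at_top sequentially"
      using filterlim_tendsto_add_at_top[OF tendsto_const[of 2] filterlim_real_sequentially] by (simp add: add.commute)
    from tendsto_inverse_0_at_top[OF this] have "\<theta> \<longlonglongrightarrow> 0"
      by (simp add: \<theta>_def[abs_def] inverse_eq_divide)
    then have "(\<lambda>m. r p * (1 + \<sigma> * \<theta> m)) \<longlonglongrightarrow> r p * (1 + \<sigma> * 0)" by (intro tendsto_intros)
    then show ?thesis by (simp add: t_def)
  qed
  have dir: "has_direction (r p) (\<lambda>m. v m \<sigma> p)" if "p \<in> {1..d}" for \<sigma> p
    unfolding v_def by (rule busemann_direction[OF t_lim r(1)[OF that] n(1)])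
  have conv_i: "AE x in M. (\<lambda>m. bound \<sigma> m i (?\<omega> x)) \<longlonglongrightarrow> B i x" if i: "i \<in> T" and \<sigma>: "\<sigma> \<in> {-1, 1}" for \<sigma> i
    using i[unfolded T_def]
  proof (cases rule: incr_indices_cases)
    case (I x y p)
    have "AE \<xi> in M. \<forall>v. has_direction (r p) v \<longrightarrow>
        (\<lambda>n. incr_I (x, y) (v n) (?\<omega> \<xi>)) \<longlonglongrightarrow> ereal (I (r p) (x, y) \<xi>) \<and>
        (\<lambda>n. incr_J (x, y) (v n) (?\<omega> \<xi>)) \<longlonglongrightarrow> ereal (J (r p) (x, y) \<xi>)"
      using bus r(1)[OF I(6)] quad[OF I(2,4)] unfolding busemann_functions_def by blast
    then show ?thesis
    proof eventually_elim
      case (elim \<xi>)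
      have "incr_I (x, y) (v m \<sigma> p) (?\<omega> \<xi>) = ereal (bound \<sigma> m i (?\<omega> \<xi>))" for m
      proof -
        have "(k + 1, l + 1) \<le> v m \<sigma> p" by (rule kv(2)[OF I(6) \<sigma>])
        then have "(x, y) \<le> v m \<sigma> p" "(x, y) + (1, 0) \<le> v m \<sigma> p"
          using I by (auto simp: less_eq_prod_def)
        then show ?thesis by (simp add: incr_I_def last_passage_eq_lpp bound_def incr_at_def I)
      qed
      then show ?case using elim[rule_format, OF dir[OF I(6), of \<sigma>]] by (simp add: B_def I)
    qed
  next
    case (J x y p)
    have \<sigma>': "- \<sigma> \<in> {-1, 1}" using \<sigma> by auto
    have "AE \<xi> in M. \<forall>v. has_direction (r p) v \<longrightarrow>
        (\<lambda>n. incr_I (x, y) (v n) (?\<omega> \<xi>)) \<longlonglongrightarrow> ereal (I (r p) (x, y) \<xi>) \<and>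
        (\<lambda>n. incr_J (x, y) (v n) (?\<omega> \<xi>)) \<longlonglongrightarrow> ereal (J (r p) (x, y) \<xi>)"
      using bus r(1)[OF J(6)] quad[OF J(2,4)] unfolding busemann_functions_def by blast
    then show ?thesis
    proof eventually_elim
      case (elim \<xi>)
      have "incr_J (x, y) (v m (- \<sigma>) p) (?\<omega> \<xi>) = ereal (bound \<sigma> m i (?\<omega> \<xi>))" for m
      proof -
        have "(k + 1, l + 1) \<le> v m (- \<sigma>) p" by (rule kv(2)[OF J(6) \<sigma>'])
        then have "(x, y) \<le> v m (- \<sigma>) p" "(x, y) + (0, 1) \<le> v m (- \<sigma>) p"
          using J by (auto simp: less_eq_prod_def)
        then show ?thesis by (simp add: incr_J_def last_passage_eq_lpp bound_def incr_at_def J)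
      qed
      then show ?case using elim[rule_format, OF dir[OF J(6), of "- \<sigma>"]] by (simp add: B_def J)
    qed
  qed
  have finT: "finite T" unfolding T_def by (rule finite_incr_indices)
  have conv: "AE x in M. \<forall>i\<in>T. (\<lambda>m. bound \<sigma> m i (?\<omega> x)) \<longlonglongrightarrow> B i x" if "\<sigma> \<in> {-1, 1}" for \<sigma>
    by (intro AE_finite_allI[OF finT] conv_i that)
  define U where "U = grid k l \<times> {1..d} \<times> {-1, 1::real}"
  define E where "E m c = {w. \<not> incr_compare (- snd (snd c)) (fst c) (?Z m (fst (snd c))) w (v m (snd (snd c)) (fst (snd c))) w}" for m and c :: "(int \<times> int) \<times> int \<times> real"
  have E: "E m c \<in> sets (?W m) \<and> measure (?W m) (E m c) < \<epsilon> m" if c: "c \<in> U" for m c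
  proof -
    obtain x y p \<sigma> where c': "c = ((x, y), p, \<sigma>)" by (metis prod.collapse)
    have xy: "1 \<le> x" "x \<le> k" "1 \<le> y" "y \<le> l" and p: "p \<in> {1..d}" and \<sigma>: "\<sigma> \<in> {-1, 1}"
      using c by (auto simp: U_def c')
    have v: "v m \<sigma> p = (\<lfloor>t m \<sigma> p * real (n m)\<rfloor>, int (n m))" by (simp add: v_def)
    have vK: "\<lfloor>t m \<sigma> p * real (n m)\<rfloor> + 1 \<le> K m" "int (n m) + 1 \<le> K m"
      using K[OF p \<sigma>, of m] by (simp_all add: v)
    have kn: "k < \<lfloor>t m \<sigma> p * real (n m)\<rfloor>" "l < int (n m)" using n(2)[of m] n(3)[OF p \<sigma>, of m] by auto
    have "measure (?W m) (E m c) = bad m \<sigma> p (x, y) (n m)"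
      unfolding E_def c' fst_conv snd_conv v bad_def
      by (rule env_compare_eq_single) (use xy p vK kn s in auto)
    then have less: "measure (?W m) (E m c) < \<epsilon> m" using small[OF p \<sigma>, of "(x, y)" m] xy by simp
    have le: "(x, y) \<le> u" "(x + 1, y) \<le> u" "(x, y + 1) \<le> u" if "(k + 1, l + 1) \<le> u" for u
      using that xy by (auto simp: less_eq_prod_def)
    have Z: "(k + 1, l + 1) \<le> ?Z m p" using kK[of m] p by (auto simp: env_corner_def)
    note vm = kv(2)[OF p \<sigma>, of m]
    have "{w \<in> space (?W m). \<not> incr_compare (- \<sigma>) (x, y) (?Z m p) w (v m \<sigma> p) w} \<in> sets (?W m)"
      unfolding incr_compare_def plus_prod_def fst_conv snd_conv add_0_right
      by (intro sets_Collect_not_le_conj borel_measurable_times borel_measurable_const borel_measurable_diff)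
        (simp_all add: measurable_weights_law measurable_lpp le[OF Z] le[OF vm])
    then have "E m c \<in> sets (?W m)" by (simp add: E_def c')
    then show ?thesis using less by blast
  qed
  let ?outside = "\<lambda>m. {w \<in> space (?W m). \<exists>i\<in>T. \<not> (bound 1 m i w \<le> incr_at (?Z m) w i \<and> incr_at (?Z m) w i \<le> bound (- 1) m i w)}"
  have covered: "?outside m
      \<subseteq> (\<Union>c\<in>U. E m c)" for m
  proof (rule subsetI, rule ccontr)
    fix w assume w: "w \<in> ?outside m"
      and nw: "w \<notin> (\<Union>c\<in>U. E m c)"
    then obtain i where i: "i \<in> T"
      and ni: "\<not> (bound 1 m i w \<le> incr_at (?Z m) w i \<and> incr_at (?Z m) w i \<le> bound (- 1) m i w)" by blast
    have cmp: "incr_compare (- \<sigma>) u (?Z m p) w (v m \<sigma> p) w"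
      if "u \<in> grid k l" "p \<in> {1..d}" "\<sigma> \<in> {-1, 1}" for u p \<sigma>
    proof -
      have "(u, p, \<sigma>) \<in> U" using that by (simp add: U_def)
      then have "w \<notin> E m (u, p, \<sigma>)" using nw by blast
      then show ?thesis by (simp add: E_def)
    qed
    from i[unfolded T_def] show False
    proof (cases rule: incr_indices_cases)
      case (I x y p)
      then have "(x, y) \<in> grid k l" by simp
      from cmp[OF this I(6), of 1] cmp[OF this I(6), of "- 1"] ni show False
        by (simp add: incr_compare_def bound_def incr_at_def I)
    next
      case (J x y p)
      then have "(x, y) \<in> grid k l" by simp
      from cmp[OF this J(6), of 1] cmp[OF this J(6), of "- 1"] ni show False
        by (simp add: incr_compare_def bound_def incr_at_def J)
    qed
  qed
  have between: "(\<lambda>m. measure (?W m) (?outside m)) \<longlonglongrightarrow> 0"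
  proof (rule tendsto_sandwich[where f = "\<lambda>_. 0"])
    have finU: "finite U" by (simp add: U_def)
    \<comment> \<open>The index set \<open>U\<close> of starting points, directions and sides does
      not depend on \<open>m\<close>, so the union bound vanishes together with
      \<open>\<epsilon> m\<close>.\<close>
    have "measure (?W m) (?outside m) \<le> card U * \<epsilon> m" for m
    proof -
      interpret W: prob_space "?W m" by (rule W)
      have "measure (?W m) (?outside m) \<le>
          measure (?W m) (\<Union>c\<in>U. E m c)"
        by (rule W.finite_measure_mono[OF covered]) (use E finU in blast)
      also have "\<dots> \<le> (\<Sum>c\<in>U. measure (?W m) (E m c))"
        using E finU by (intro measure_UNION_le) auto
      also have "\<dots> \<le> (\<Sum>c\<in>U. \<epsilon> m)" using E by (intro sum_mono less_imp_le) blast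
      finally show ?thesis by simp
    qed
    then show "\<forall>\<^sub>F m in sequentially. measure (?W m) (?outside m) \<le> card U * \<epsilon> m"
      by (intro always_eventually allI)
    have "\<epsilon> \<longlonglongrightarrow> 0" using LIMSEQ_inverse_real_of_nat by (simp add: \<epsilon>_def[abs_def] inverse_eq_divide)
    from tendsto_mult[OF tendsto_const this] show "(\<lambda>m. card U * \<epsilon> m) \<longlonglongrightarrow> 0" by simp
  qed simp_all
  show "distr M (borel_on T) (\<lambda>x. \<lambda>i\<in>T. B i x) =
      distr (weights_law (env_rate k l 1 d s)) (borel_on T) (\<lambda>w. \<lambda>i\<in>T. incr_at (env_corner k l 1 d) w i)"
  proof (rule joint_law_of_sandwich[where W = ?W and X = "\<lambda>m i w. incr_at (?Z m) w i" and lo = "bound 1" and up = "bound (- 1)"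
        and lo' = "\<lambda>m i x. bound 1 m i (?\<omega> x)" and up' = "\<lambda>m i x. bound (- 1) m i (?\<omega> x)",
        OF finT M.prob_space_axioms W meas_B _ _ _ _ _ _ _ _ _ _ between])
    fix m
    show "distr (?W m) (borel_on T) (\<lambda>w. \<lambda>i\<in>T. incr_at (?Z m) w i) =
        distr (weights_law (env_rate k l 1 d s)) (borel_on T) (\<lambda>w. \<lambda>i\<in>T. incr_at (env_corner k l 1 d) w i)"
      unfolding T_def by (rule distr_incr_at_env) (use pos kK[of m] s in auto)
    show "distr M (borel_on T) (\<lambda>x. \<lambda>i\<in>T. bound 1 m i (?\<omega> x)) =
        distr (?W m) (borel_on T) (\<lambda>w. \<lambda>i\<in>T. bound 1 m i w)"
      using FM_law[of 1 m] by (simp add: F_def[abs_def])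
    show "distr M (borel_on T) (\<lambda>x. \<lambda>i\<in>T. bound (- 1) m i (?\<omega> x)) =
        distr (?W m) (borel_on T) (\<lambda>w. \<lambda>i\<in>T. bound (- 1) m i w)"
      using FM_law[of "- 1" m] by (simp add: F_def[abs_def])
    fix i assume i: "i \<in> T"
    show "(\<lambda>w. incr_at (?Z m) w i) \<in> borel_measurable (?W m)"
      unfolding measurable_weights_law by (rule measurable_incr_at[OF i[unfolded T_def] kZ])
    show "bound 1 m i \<in> borel_measurable (?W m)" "bound (- 1) m i \<in> borel_measurable (?W m)"
      unfolding measurable_weights_law using meas_bound[OF i] by auto
    show "(\<lambda>x. bound 1 m i (?\<omega> x)) \<in> borel_measurable M" "(\<lambda>x. bound (- 1) m i (?\<omega> x)) \<in> borel_measurable M"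
      using meas_bound_M[OF i] by auto
  qed (use conv in auto)
qed

theorem theorem2p4:
  fixes d k l :: int
    and r :: "int \<Rightarrow> real"
    and z :: "int \<Rightarrow> int \<times> int"
    and M :: "'a measure" and \<omega> :: "int \<times> int \<Rightarrow> 'a \<Rightarrow> real"
    and I J :: "real \<Rightarrow> int \<times> int \<Rightarrow> 'a \<Rightarrow> real"
    and N :: "'b measure" and \<eta> :: "int \<times> int \<Rightarrow> 'b \<Rightarrow> real"
  assumes "d > 0" and "k > 0" and "l > 0"
    and "\<And>p. p \<in> {1..d} \<Longrightarrow> r p > 0"
    and "strict_mono_on {1..d} r"
    and "\<And>p. p \<in> {1..d} \<Longrightarrow> z p = (k + p - 1, l + d - p)"
    and "iid_exp_environment M \<omega>"
    and "busemann_functions M \<omega> I J"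
    and "inhomogeneous_environment N \<eta> k l d r"
  shows "eq_in_joint_distr
    ((({1..k - 1} \<times> {1..l}) \<times> {1..d}) <+> (({1..k} \<times> {1..l - 1}) \<times> {1..d}))
    M (\<lambda>i x. case i of Inl (u, p) \<Rightarrow> ereal (I (r p) u x)
                     | Inr (v, p) \<Rightarrow> ereal (J (r p) v x))
    N (\<lambda>i y. case i of Inl (u, p) \<Rightarrow> incr_I u (z p) (\<lambda>q. \<eta> q y)
                     | Inr (v, p) \<Rightarrow> incr_J v (z p) (\<lambda>q. \<eta> q y))"
proof -
  let ?T = "incr_indices k l d" and ?Z = "env_corner k l 1 d"
  let ?B = "\<lambda>i x. case i of Inl (u, p) \<Rightarrow> I (r p) u x | Inr (u, p) \<Rightarrow> J (r p) u x"
  let ?Y = "\<lambda>i y. incr_at ?Z (\<lambda>q. \<eta> q y) i"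
  let ?X' = "\<lambda>i x. case i of Inl (u, p) \<Rightarrow> ereal (I (r p) u x) | Inr (v, p) \<Rightarrow> ereal (J (r p) v x)"
  let ?Y' = "\<lambda>i y. case i of Inl (u, p) \<Rightarrow> incr_I u (z p) (\<lambda>q. \<eta> q y) | Inr (v, p) \<Rightarrow> incr_J v (z p) (\<lambda>q. \<eta> q y)"
  let ?e = "\<lambda>f. \<lambda>i\<in>?T. ereal (f i)"
  let ?\<Lambda> = "distr (weights_law (env_rate k l 1 d (\<lambda>q. zeta (r q)))) (borel_on ?T) (\<lambda>w. \<lambda>i\<in>?T. incr_at ?Z w i)"
  have B: "?B i \<in> borel_measurable M" if "i \<in> ?T" for i
    by (rule busemann_increments(1)[OF assms(1-3) _ assms(5,7,8) that]) (rule assms(4))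
  have B_law: "distr M (borel_on ?T) (\<lambda>x. \<lambda>i\<in>?T. ?B i x) = ?\<Lambda>"
    by (rule busemann_increments(2)[OF assms(1-3) _ assms(5,7,8)]) (rule assms(4))
  have Y: "(\<lambda>y. \<lambda>i\<in>?T. ?Y i y) \<in> measurable N (borel_on ?T)"
    by (rule inhomogeneous_increments(1)[OF assms(1-3) _ assms(5,9)]) (rule assms(4))
  have Y_law: "distr N (borel_on ?T) (\<lambda>y. \<lambda>i\<in>?T. ?Y i y) = ?\<Lambda>"
    by (rule inhomogeneous_increments(2)[OF assms(1-3) _ assms(5,9)]) (rule assms(4))
  have X': "?X' i x = ereal (?B i x)" for i x by (auto split: sum.split prod.split)
  \<comment> \<open>On the index set both starting points of an increment lie below
    \<open>z p\<close>, so neither passage time is minus infinity and the difference is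
    real.\<close>
  have Y': "?Y' i y = ereal (?Y i y)" if "i \<in> ?T" for i y
    using that
  proof (cases rule: incr_indices_cases)
    case (I a b p)
    then have "(a, b) \<le> z p" "(a, b) + (1, 0) \<le> z p" "z p = ?Z p"
      using assms(6) by (auto simp: env_corner_def)
    then show ?thesis by (simp add: I incr_I_def incr_at_def last_passage_eq_lpp)
  next
    case (J a b p)
    then have "(a, b) \<le> z p" "(a, b) + (0, 1) \<le> z p" "z p = ?Z p"
      using assms(6) by (auto simp: env_corner_def)
    then show ?thesis by (simp add: J incr_J_def incr_at_def last_passage_eq_lpp)
  qed
  have Y_comp: "?Y i \<in> borel_measurable N" if "i \<in> ?T" for i
    using measurable_compose[OF Y measurable_component_singleton[OF that]] that by simp
  have mX: "(\<lambda>x. \<lambda>i\<in>?T. ?B i x) \<in> measurable M (borel_on ?T)"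
    by (rule measurable_restrict) (rule B)
  have e: "?e \<in> measurable (borel_on ?T) (borel_on ?T)"
    by (rule measurable_restrict) (intro borel_measurable_ereal measurable_component_singleton)
  have "distr M (borel_on ?T) (\<lambda>x. \<lambda>i\<in>?T. ?X' i x) =
      distr (distr M (borel_on ?T) (\<lambda>x. \<lambda>i\<in>?T. ?B i x)) (borel_on ?T) ?e"
    unfolding distr_distr[OF e mX] X' by (simp add: comp_def cong: restrict_cong)
  also have "\<dots> = distr (distr N (borel_on ?T) (\<lambda>y. \<lambda>i\<in>?T. ?Y i y)) (borel_on ?T) ?e"
    by (simp only: B_law Y_law)
  also have "\<dots> = distr N (borel_on ?T) (?e \<circ> (\<lambda>y. \<lambda>i\<in>?T. ?Y i y))"
    by (rule distr_distr[OF e Y])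
  also have "?e \<circ> (\<lambda>y. \<lambda>i\<in>?T. ?Y i y) = (\<lambda>y. \<lambda>i\<in>?T. ?Y' i y)"
    by (intro ext) (simp add: Y' restrict_def)
  finally have "distr M (borel_on ?T) (\<lambda>x. \<lambda>i\<in>?T. ?X' i x) =
      distr N (borel_on ?T) (\<lambda>y. \<lambda>i\<in>?T. ?Y' i y)" .
  moreover have "?X' i \<in> borel_measurable M" if "i \<in> ?T" for i
    unfolding X' using B[OF that] by (rule borel_measurable_ereal)
  moreover have "?Y' i \<in> borel_measurable N" if "i \<in> ?T" for i
    unfolding Y'[OF that] using Y_comp[OF that] by (rule borel_measurable_ereal)
  ultimately show ?thesis unfolding eq_in_joint_distr_def incr_indices_def[symmetric] by blast
qed

end
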